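(* Let $N\ge8$ be an integer and $\widehat\alpha_N^\dagger=\alpha^\dagger\!\left(-e^{-\pi\sqrt{N/3}}\right)$. Then $$\sqrt{\frac{3}{N}}\frac{1}{\pi}=\sum_{k=0}^\infty\frac{\left(\frac12\right)_k\left(\frac13\right)_k\left(\frac23\right)_k}{(k!)^3}\left(\widehat b_N^\dagger k+\widehat a_N^\dagger\right)\left(\widehat X_N^\dagger\right)^k,$$ where $\widehat b_N^\dagger=1-2\widehat\alpha_N^\dagger$, $\widehat a_N^\dagger=\frac{1}{\sqrt N}\widehat C_N(q)\big|_{q=e^{-\pi/\sqrt{3N}}}$, and $\widehat X_N^\dagger=4\widehat\alpha_N^\dagger(1-\widehat\alpha_N^\dagger)$.
   Context: Let $a(q)=\sum_{m,n\in\mathbb Z}q^{m^2+mn+n^2}$ and for a positive integer $N$ $$\widehat C_N(q)=\frac{1}{a^2(-q)a^2(-q^N)}\det\begin{pmatrix}a(-q)&a(-q^N)\\ q\frac{d}{dq}a(-q)&q\frac{d}{dq}a(-q^N)\end{pmatrix}.$$ Let $\eta(\tau)=e^{\pi i\tau/12}\prod_{k\ge1}(1-e^{2\pi ik\tau})$ be the Dedekind eta function, and define $\alpha^\dagger$ by $\frac{1}{\alpha^\dagger(e^{2\pi i\tau})}=1+\frac{1}{27}\frac{\eta^{12}(\tau)}{\eta^{12}(3\tau)}$ (so $\alpha^\dagger(-e^{-\pi\sqrt{N/3}})$ is its value at $e^{2\pi i\tau}$ with $\tau=\tfrac12+\tfrac{i}{2}\sqrt{N/3}$). $(a)_k$ is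 the Pochhammer symbol. *)

theory Defs
  imports "HOL-Analysis.Analysis"
begin

definition theta_a :: "complex \<Rightarrow> complex" where
  "theta_a q = (\<Sum>\<^sub>\<infinity>(m, n)\<in>(UNIV :: (int \<times> int) set). q powi (m\<^sup>2 + m * n + n\<^sup>2))"

text \<open>
  Here \<open>-q^N\<close> means \<open>-(q^N)\<close>, also for even \<open>N\<close>, and the derivatives are those of the
  composite functions \<open>q \<mapsto> a(-q)\<close> and \<open>q \<mapsto> a(-q^N)\<close>.
\<close>

definition C_hat :: "nat \<Rightarrow> complex \<Rightarrow> complex" where
  "C_hat N q =
     1 / ((theta_a (- q))\<^sup>2 * (theta_a (- (q ^ N)))\<^sup>2) *
     det (vector
       [vector [theta_a (- q), theta_a (- (q ^ N))],
        vector [q * deriv (\<lambda>z. theta_a (- z)) q, q * deriv (\<lambda>z. theta_a (- (z ^ N))) q]]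
       :: complex ^ 2 ^ 2)"

definition dedekind_eta :: "complex \<Rightarrow> complex" where
  "dedekind_eta \<tau> =
     exp (of_real pi * \<i> * \<tau> / 12) *
     (\<Prod>k. 1 - exp (2 * of_real pi * \<i> * of_nat (Suc k) * \<tau>))"

text \<open>
  \<open>\<alpha>\<^sup>\<dagger>\<close> is a function of the nome \<open>q = exp (2 \<pi> \<i> \<tau>)\<close>; the definition picks the preimage \<open>\<tau>\<close>
  of \<open>q\<close> given by the principal logarithm. The lemma \<open>alpha_dagger_exp\<close> shows that the choice
  does not matter.
\<close>

definition alpha_dagger :: "complex \<Rightarrow> complex" where
  "alpha_dagger q =
     (let \<tau> = Ln q / (2 * of_real pi * \<i>)
      in 1 / (1 + 1 / 27 * (dedekind_eta \<tau> ^ 12 / dedekind_eta (3 * \<tau>) ^ 12)))"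

lemma dedekind_eta_add_int_pow12:
  "dedekind_eta (\<tau> + of_int n) ^ 12 = exp (of_real pi * \<i> * of_int n) * dedekind_eta \<tau> ^ 12"
proof -
  have per: "exp (2 * of_real pi * \<i> * of_nat (Suc k) * (\<tau> + of_int n)) =
        exp (2 * of_real pi * \<i> * of_nat (Suc k) * \<tau>)" for k
  proof -
    have "2 * of_real pi * \<i> * of_nat (Suc k) * (\<tau> + of_int n) =
        2 * of_real pi * \<i> * of_nat (Suc k) * \<tau> + of_real (of_int (2 * (int (Suc k) * n)) * pi) * \<i>"
      by (simp add: algebra_simps)
    then show ?thesis
      unfolding exp_eq by blast
  qed
  have "exp (of_real pi * \<i> * (\<tau> + of_int n) / 12) ^ 12 =
      exp (of_real pi * \<i> * of_int n) * exp (of_real pi * \<i> * \<tau> / 12) ^ 12"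
    by (simp flip: exp_of_nat_mult exp_add add: algebra_simps add_divide_distrib)
  then show ?thesis
    unfolding dedekind_eta_def per by (simp add: power_mult_distrib)
qed

lemma alpha_dagger_exp:
  "1 / alpha_dagger (exp (2 * of_real pi * \<i> * \<tau>)) =
     1 + 1 / 27 * (dedekind_eta \<tau> ^ 12 / dedekind_eta (3 * \<tau>) ^ 12)"
proof -
  define \<sigma> where "\<sigma> = Ln (exp (2 * of_real pi * \<i> * \<tau>)) / (2 * of_real pi * \<i>)"
  have "exp (2 * of_real pi * \<i> * \<sigma>) = exp (2 * of_real pi * \<i> * \<tau>)"
    by (simp add: \<sigma>_def)
  then obtain n :: int where
    "2 * of_real pi * \<i> * \<sigma> = 2 * of_real pi * \<i> * \<tau> + of_real (of_int (2 * n) * pi) * \<i>"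
    unfolding exp_eq by blast
  then have "2 * of_real pi * \<i> * \<sigma> = 2 * of_real pi * \<i> * (\<tau> + of_int n)"
    by (simp add: algebra_simps)
  then have \<sigma>: "\<sigma> = \<tau> + of_int n"
    by simp
  have \<sigma>3: "3 * \<sigma> = 3 * \<tau> + of_int (3 * n)"
    by (simp add: \<sigma> algebra_simps)
  have "exp (of_real pi * \<i> * of_int (3 * n)) = exp (of_real pi * \<i> * of_int n :: complex)"
    unfolding exp_eq by (rule exI[of _ n]) (simp add: algebra_simps)
  then have "dedekind_eta \<sigma> ^ 12 / dedekind_eta (3 * \<sigma>) ^ 12 =
      dedekind_eta \<tau> ^ 12 / dedekind_eta (3 * \<tau>) ^ 12"
    unfolding \<sigma>3 dedekind_eta_add_int_pow12 by (simp add: \<sigma> dedekind_eta_add_int_pow12)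
  then show ?thesis
    unfolding alpha_dagger_def Let_def \<sigma>_def[symmetric] by simp
qed

end

theory Submission
  imports Defs "HOL-Complex_Analysis.Complex_Analysis" "HOL-Probability.Characteristic_Functions"
begin

text \<open>
  Let \<open>\<theta>(x; q) = \<Sum> (-1)\<^sup>n q\<^bsup>n(n-1)/2\<^esup> x\<^sup>n\<close>, let \<open>\<omega>\<close> be a primitive cube root of unity and put \<open>x = e\<^sup>u\<close>. Summing the
  triple series over \<open>i + j + k = 3s\<close> gives
  \<open>\<theta>(x; q)\<^sup>3 + \<theta>(\<omega>x; q)\<^sup>3 + \<theta>(\<omega>\<^sup>2x; q)\<^sup>3 = 3 a(q) \<theta>(x\<^sup>3; q\<^sup>3)\<close> and
  \<open>\<theta>(x; q) \<theta>(\<omega>x; q) \<theta>(\<omega>\<^sup>2x; q) = h(q) \<theta>(x\<^sup>3; q\<^sup>3)\<close>. Since \<open>\<theta>\<close> satisfies a heat equation, the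
  coefficients of \<open>u, u\<^sup>3, u\<^sup>5\<close> in these identities become differential equations in \<open>q\<close>. Together with
  the triple product values \<open>\<theta>(\<omega>; q) = (1 - \<omega>) \<Prod>(1 - q\<^bsup>3n\<^esup>)\<close> and \<open>\<theta>'(1; q) = - \<Prod>(1 - q\<^sup>n)\<^sup>3\<close> they give
  \<open>q d\<alpha>/dq = a\<^sup>2 \<alpha> (1 - \<alpha>)\<close> and the hypergeometric equation of \<open>a\<close> as a function of \<open>\<alpha>\<close>, hence, by
  Clausen's formula, \<open>a\<^sup>2 = \<^sub>3F\<^sub>2(1/2, 1/3, 2/3; 1, 1; 4\<alpha>(1 - \<alpha>))\<close> as long as \<open>a\<close> does not vanish and the
  argument stays in the unit disc; this holds for \<open>- e\<^bsup>-\<pi>\<surd>(N/3)\<^esup> \<le> q \<le> 0\<close> and \<open>N \<ge> 8\<close>.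

  The second ingredient is \<open>a(-q) = - \<surd>N a(-q\<^sup>N)\<close> at \<open>q = e\<^bsup>-\<pi>/\<surd>(3N)\<^esup>\<close>. As
  \<open>a(-q) = \<theta>\<^sub>4(q) \<theta>\<^sub>4(q\<^sup>3) - \<theta>\<^sub>2(q) \<theta>\<^sub>2(q\<^sup>3)\<close>, it follows from Jacobi's inversion formula, and its derivative
  in \<open>N\<close> expresses \<open>C_hat\<close> by the value and the derivative of \<open>a\<close> at \<open>-q\<^sup>N\<close>. The minus sign is what
  makes the two derivative terms of the series cancel, leaving \<open>\<surd>(3/N)/\<pi>\<close>.
\<close>

section \<open>Moments of theta series\<close>

text \<open>As a function of x, theta(x; q) never occurs. Only its Taylor coefficients in u at the
  cube roots of unity do, collected in formal power series, so the analysis takes place in q alone.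
  The obstacle is that the heat equation trades one q-derivative for two u-derivatives: each
  differentiation raises the order of the moments, and no finite system results by itself. Let x1,
  x2, ... be the moments at \<omega> divided by the zeroth one and K = theta'(1)^3 /
  theta(\<omega>)^3. The identities express x3, and where x1 is nonzero also x4, as polynomials in
  x1, x2, K. Then q d/dq preserves the polynomials in x1, x2, K, and the differential equations are
  checked there. Since a is a constant times x1 and \<alpha> = 1 + K / (8 x1^3), the quantity x2 has
  to drop out of the final equations. The bound on N comes from |4 \<alpha> (1 - \<alpha>)| < 1.
  With m = \<alpha> / (1 - \<alpha>) this is 4 m / (1 + m)^2, which is small enough for |m| < 3 - 2
  sqrt 2; the estimate |m| <= 27 exp(-pi sqrt(N/3)) reaches that range at N = 8.\<close>

lemma has_sum_sum:
  fixes f :: "'i \<Rightarrow> 'a \<Rightarrow> 'b :: topological_comm_monoid_add"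
  assumes "\<And>i. i \<in> I \<Longrightarrow> (f i has_sum S i) A"
  shows "((\<lambda>x. \<Sum>i\<in>I. f i x) has_sum (\<Sum>i\<in>I. S i)) A"
  using assms by (induction I rule: infinite_finite_induct) (auto intro: has_sum_add)

lemma summable_on_times_complex:
  fixes f :: "'a \<Rightarrow> complex" and g :: "'b \<Rightarrow> complex"
  assumes "f summable_on A" "g summable_on B"
  shows "(\<lambda>(x, y). f x * g y) summable_on A \<times> B"
proof -
  have f: "(\<lambda>x. norm (f x)) summable_on A" and g: "(\<lambda>x. norm (g x)) summable_on B"
    using assms by (simp_all add: summable_on_iff_abs_summable_on_complex)
  have "(\<lambda>p. norm (case p of (x, y) \<Rightarrow> f x * g y)) summable_on A \<times> B"
    unfolding Infinite_Sum.abs_summable_on_Sigma_iff using f g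
    by (auto simp: norm_mult infsum_cmult_right' infsum_nonneg
        intro!: summable_on_cmult_left summable_on_cmult_right)
  then show ?thesis
    by (simp add: summable_on_iff_abs_summable_on_complex)
qed

lemma infsum_times_complex:
  fixes f :: "'a \<Rightarrow> complex" and g :: "'b \<Rightarrow> complex"
  assumes "f summable_on A" "g summable_on B"
  shows "infsum f A * infsum g B = (\<Sum>\<^sub>\<infinity>(x, y)\<in>A \<times> B. f x * g y)"
proof -
  have "(\<Sum>\<^sub>\<infinity>(x, y)\<in>A \<times> B. f x * g y) = (\<Sum>\<^sub>\<infinity>x\<in>A. \<Sum>\<^sub>\<infinity>y\<in>B. f x * g y)"
    using infsum_Sigma'_banach[OF summable_on_times_complex[OF assms]] by simp
  then show ?thesis
    by (simp add: infsum_cmult_right' infsum_cmult_left')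
qed

text \<open>Formally the expansion in u of the sum of w i * exp (l i * u). As a formal series it
  makes sense as soon as every single moment is summable.\<close>

definition moment_fps :: "('a \<Rightarrow> complex) \<Rightarrow> ('a \<Rightarrow> complex) \<Rightarrow> complex fps" where
  "moment_fps w l = Abs_fps (\<lambda>k. (\<Sum>\<^sub>\<infinity>i. w i * l i ^ k) / fact k)"

definition moments_summable :: "('a \<Rightarrow> complex) \<Rightarrow> ('a \<Rightarrow> complex) \<Rightarrow> bool" where
  "moments_summable w l \<longleftrightarrow> (\<forall>k. (\<lambda>i. w i * l i ^ k) summable_on UNIV)"

text \<open>This is exp(l u) exp(l' u) = exp((l + l') u) summed over pairs: the binomial theorem for
  L^n matches the Cauchy product of the coefficients.\<close>

lemma
  assumes "moments_summable w l" "moments_summable w' l'"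
  defines "W \<equiv> \<lambda>(i, j). w i * w' j" and "L \<equiv> \<lambda>(i, j). l i + l' j"
  shows moments_summable_times: "moments_summable W L"
    and moment_fps_mult: "moment_fps w l * moment_fps w' l' = moment_fps W L"
proof -
  define t where "t k m = (\<lambda>(i, j). (w i * l i ^ k) * (w' j * l' j ^ m))" for k m
  have t: "t k m summable_on UNIV" for k m
    using summable_on_times_complex[of "\<lambda>i. w i * l i ^ k" UNIV "\<lambda>j. w' j * l' j ^ m" UNIV] assms(1,2)
    unfolding t_def moments_summable_def by simp
  have infsum_t: "(\<Sum>\<^sub>\<infinity>i. w i * l i ^ k) * (\<Sum>\<^sub>\<infinity>j. w' j * l' j ^ m) = infsum (t k m) UNIV" for k m
    using infsum_times_complex[of "\<lambda>i. w i * l i ^ k" UNIV "\<lambda>j. w' j * l' j ^ m" UNIV] assms(1,2)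
    unfolding t_def moments_summable_def by simp
  have WL: "W x * L x ^ n = (\<Sum>k\<le>n. of_nat (n choose k) * t k (n - k) x)" for x n
    unfolding W_def L_def t_def
    by (simp add: binomial_ring sum_distrib_left split_beta mult_ac)
  have hs: "((\<lambda>x. W x * L x ^ n) has_sum (\<Sum>k\<le>n. of_nat (n choose k) * infsum (t k (n - k)) UNIV)) UNIV" for n
    unfolding WL by (intro has_sum_sum has_sum_cmult_right has_sum_infsum t)
  show "moments_summable W L"
    unfolding moments_summable_def using hs has_sum_imp_summable by blast
  show "moment_fps w l * moment_fps w' l' = moment_fps W L"
  proof (rule fps_ext)
    fix n
    have "(\<Sum>\<^sub>\<infinity>x. W x * L x ^ n) = (\<Sum>k\<le>n. of_nat (n choose k) * infsum (t k (n - k)) UNIV)"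
      using hs infsumI by blast
    then have "moment_fps W L $ n =
        (\<Sum>k\<le>n. infsum (t k (n - k)) UNIV / (fact k * fact (n - k)))"
      by (simp add: moment_fps_def sum_divide_distrib binomial_fact)
    also have "\<dots> = (moment_fps w l * moment_fps w' l') $ n"
      by (simp add: moment_fps_def fps_mult_nth infsum_t[symmetric] atLeast0AtMost)
    finally show "(moment_fps w l * moment_fps w' l') $ n = moment_fps W L $ n" ..
  qed
qed

text \<open>The exponent n(n-1)/2 is nonnegative for every integer n. Taking it as a natural number
  makes each theta series a power series in q, also at q = 0.\<close>

definition triangle :: "int \<Rightarrow> nat" where
  "triangle n = nat (n * (n - 1) div 2)"

lemma two_triangle: "2 * int (triangle n) = n * (n - 1)"
proof -
  have "n * (n - 1) \<ge> 0"
    by (cases "n \<ge> 1") (auto intro: mult_nonneg_nonneg mult_nonpos_nonpos)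
  moreover have "even (n * (n - 1))"
    by simp
  ultimately show ?thesis
    by (simp add: triangle_def)
qed

lemma triangle_eqI: "2 * int m = n * (n - 1) \<Longrightarrow> triangle n = m"
  using two_triangle[of n] by linarith

lemma triangle_0 [simp]: "triangle 0 = 0"
  by (simp add: triangle_def)

lemma triangle_1 [simp]: "triangle 1 = 0"
  by (simp add: triangle_def)

lemma triangle_reflect: "triangle (1 - n) = triangle n"
  using two_triangle[of n] by (intro triangle_eqI) (simp add: algebra_simps)

lemma triangle_minus_nat: "triangle (- int j) = triangle (1 + int j)"
  using triangle_reflect[of "1 + int j"] by simp

lemma two_triangle_Suc_nat: "2 * triangle (1 + int j) = j * (j + 1)"
proof -
  have "int (2 * triangle (1 + int j)) = int (j * (j + 1))"
    using two_triangle[of "1 + int j"] by (simp add: algebra_simps)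
  then show ?thesis
    by (simp only: of_nat_eq_iff)
qed

lemma triangle_Suc_nat_ge: "j \<le> triangle (1 + int j)"
proof (cases j)
  case (Suc i)
  then show ?thesis
    using two_triangle_Suc_nat[of j] by simp
qed simp

text \<open>
  \<open>theta_mom k z q\<close> is the \<open>k\<close>-th derivative at \<open>u = 0\<close> of \<open>e\<^bsup>-u/2\<^esup> \<theta>(z e\<^sup>u; q)\<close>. The shift by \<open>1/2\<close>
  makes the reflection \<open>n \<mapsto> 1 - n\<close> act by a sign.
\<close>

definition theta_weight :: "complex \<Rightarrow> complex \<Rightarrow> int \<Rightarrow> complex" where
  "theta_weight z q n = (- z) powi n * q ^ triangle n"

definition half_shift :: "int \<Rightarrow> complex" where
  "half_shift n = of_int n - 1 / 2"

definition theta_mom :: "nat \<Rightarrow> complex \<Rightarrow> complex \<Rightarrow> complex" where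
  "theta_mom k z q = (\<Sum>\<^sub>\<infinity>n. theta_weight z q n * half_shift n ^ k)"

text \<open>Termwise differentiation of the series of n^k x^n yields the series of (n+1)^(k+1) x^n,
  which is the induction step.\<close>

lemma summable_Suc_power_geometric:
  fixes x :: real
  assumes "\<bar>x\<bar> < 1"
  shows "summable (\<lambda>n. real (Suc n) ^ k * x ^ n)"
  using assms
proof (induction k arbitrary: x)
  case (Suc k)
  have "summable (\<lambda>n. real n ^ k * y ^ n)" if "norm y < 1" for y :: real
  proof -
    have "summable (\<lambda>n. (real (Suc n) ^ k * y ^ n) * y)"
      using Suc.IH[of y] that by (intro summable_mult2) simp
    then have "summable (\<lambda>n. real (Suc n) ^ k * y ^ Suc n)"
      by (simp add: mult_ac)
    then show ?thesis
      using summable_Suc_iff[of "\<lambda>n. real n ^ k * y ^ n"] by simp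
  qed
  then have "summable (\<lambda>n. diffs (\<lambda>n. real n ^ k) n * x ^ n)"
    using Suc.prems by (intro termdiff_converges[where K = 1]) auto
  then show ?case
    by (simp add: diffs_def)
qed (use assms in \<open>simp add: summable_geometric\<close>)

text \<open>The two halves are exchanged by n -> 1 - n, so 1 + j and -j have the same exponent
  \<open>triangle\<close>. Pairing them folds a two-sided theta series into a power series in
  q.\<close>

lemma UNIV_int_halves:
  "(UNIV :: int set) = range (\<lambda>j. 1 + int j) \<union> range (\<lambda>j. - int j)"
  "range (\<lambda>j. 1 + int j) \<inter> range (\<lambda>j. - int j) = {}"
proof -
  have "n \<in> range (\<lambda>j. 1 + int j) \<union> range (\<lambda>j. - int j)" for n
  proof (cases "n \<ge> 1")
    case True
    then have "n = 1 + int (nat (n - 1))" by simp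
    then show ?thesis by blast
  next
    case False
    then have "n = - int (nat (- n))" by simp
    then show ?thesis by blast
  qed
  then show "(UNIV :: int set) = range (\<lambda>j. 1 + int j) \<union> range (\<lambda>j. - int j)" by auto
qed auto

lemma summable_on_int_halves:
  fixes f :: "int \<Rightarrow> complex"
  assumes "(\<lambda>j. f (1 + int j)) summable_on UNIV" "(\<lambda>j. f (- int j)) summable_on UNIV"
  shows "f summable_on UNIV"
proof -
  have "f summable_on range (\<lambda>j. 1 + int j)"
    using assms(1) summable_on_reindex[of "\<lambda>j. 1 + int j" UNIV f] by (simp add: inj_on_def o_def)
  moreover have "f summable_on range (\<lambda>j. - int j)"
    using assms(2) summable_on_reindex[of "\<lambda>j. - int j" UNIV f] by (simp add: inj_on_def o_def)
  ultimately show ?thesis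
    using summable_on_Un_disjoint UNIV_int_halves by metis
qed

lemma sums_int_halves:
  fixes f :: "int \<Rightarrow> complex"
  assumes "f summable_on UNIV"
  shows "(\<lambda>j. f (1 + int j) + f (- int j)) sums (\<Sum>\<^sub>\<infinity>n. f n)"
proof -
  have s: "f summable_on range (\<lambda>j. 1 + int j)" "f summable_on range (\<lambda>j. - int j)"
    using assms summable_on_subset_banach by blast+
  have "infsum f UNIV = infsum f (range (\<lambda>j. 1 + int j)) + infsum f (range (\<lambda>j. - int j))"
    using infsum_Un_disjoint[OF s] UNIV_int_halves by metis
  also have "\<dots> = (\<Sum>\<^sub>\<infinity>j. f (1 + int j)) + (\<Sum>\<^sub>\<infinity>j. f (- int j))"
    using infsum_reindex[of "\<lambda>j. 1 + int j" UNIV f] infsum_reindex[of "\<lambda>j. - int j" UNIV f]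
    by (simp add: inj_on_def o_def)
  finally have *: "infsum f UNIV = (\<Sum>\<^sub>\<infinity>j. f (1 + int j)) + (\<Sum>\<^sub>\<infinity>j. f (- int j))" .
  have "((\<lambda>j. f (1 + int j)) has_sum (\<Sum>\<^sub>\<infinity>j. f (1 + int j))) UNIV"
    using s(1) summable_on_reindex[of "\<lambda>j. 1 + int j" UNIV f] by (simp add: inj_on_def o_def)
  moreover have "((\<lambda>j. f (- int j)) has_sum (\<Sum>\<^sub>\<infinity>j. f (- int j))) UNIV"
    using s(2) summable_on_reindex[of "\<lambda>j. - int j" UNIV f] by (simp add: inj_on_def o_def)
  ultimately show ?thesis
    unfolding * by (intro has_sum_imp_sums has_sum_add)
qed

text \<open>Uniform over \<open>norm q \<le> r\<close>, as the locally uniform convergence in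
  \<open>theta_mom_deriv\<close> requires. The quadratic exponent is only used through j <=
  j(j+1)/2.\<close>

lemma theta_term_bound:
  assumes "norm z = 1" "norm q \<le> r" "r < 1" "n = 1 + int j \<or> n = - int j"
  shows "norm (theta_weight z q n * half_shift n ^ k) \<le> real (Suc j) ^ k * r ^ j"
proof -
  have r: "0 \<le> r" using assms(2) norm_ge_zero order_trans by blast
  have n: "norm (half_shift n) \<le> real (Suc j)"
  proof -
    have "half_shift n = of_real (of_int n - 1 / 2)"
      by (simp add: half_shift_def)
    then have "norm (half_shift n) = \<bar>of_int n - 1 / 2\<bar>"
      by (simp only: norm_of_real)
    then show ?thesis
      using assms(4) by auto
  qed
  have t: "triangle n = triangle (1 + int j)"
    using assms(4) triangle_minus_nat by auto
  have "norm q ^ triangle n \<le> r ^ triangle n"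
    using assms by (intro power_mono) auto
  also have "\<dots> \<le> r ^ j"
    using triangle_Suc_nat_ge[of j] r assms(3) t by (intro power_decreasing) auto
  finally have q: "norm q ^ triangle n \<le> r ^ j" .
  have "norm (theta_weight z q n * half_shift n ^ k) = norm q ^ triangle n * norm (half_shift n) ^ k"
    using assms(1) by (simp add: theta_weight_def norm_mult norm_power norm_power_int)
  also have "\<dots> \<le> r ^ j * real (Suc j) ^ k"
    using q n r by (intro mult_mono power_mono) auto
  finally show ?thesis by (simp add: mult.commute)
qed

lemma theta_summable:
  assumes "norm z = 1" "norm q < 1"
  shows "moments_summable (theta_weight z q) half_shift"
  unfolding moments_summable_def
proof (intro allI summable_on_int_halves norm_summable_imp_summable_on)
  fix k
  have s: "summable (\<lambda>j. real (Suc j) ^ k * norm q ^ j)"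
    using assms by (intro summable_Suc_power_geometric) auto
  show "summable (\<lambda>j. norm (theta_weight z q (1 + int j) * half_shift (1 + int j) ^ k))"
    by (rule summable_comparison_test'[OF s, of 0])
      (use theta_term_bound[of z q "norm q" "1 + int j" j k for j] assms in auto)
  show "summable (\<lambda>j. norm (theta_weight z q (- int j) * half_shift (- int j) ^ k))"
    by (rule summable_comparison_test'[OF s, of 0])
      (use theta_term_bound[of z q "norm q" "- int j" j k for j] assms in auto)
qed

text \<open>The coefficient of q^(j(j+1)/2) once the terms n = 1 + j and n = -j are merged.\<close>

definition theta_coeff :: "nat \<Rightarrow> complex \<Rightarrow> nat \<Rightarrow> complex" where
  "theta_coeff k z j = (- z) powi (1 + int j) * half_shift (1 + int j) ^ k +
     (- z) powi (- int j) * half_shift (- int j) ^ k"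

lemma theta_mom_sums:
  assumes "norm z = 1" "norm q < 1"
  shows "(\<lambda>j. theta_coeff k z j * q ^ triangle (1 + int j)) sums theta_mom k z q"
proof -
  have "(\<lambda>n. theta_weight z q n * half_shift n ^ k) summable_on UNIV"
    using theta_summable[OF assms] by (simp add: moments_summable_def)
  from sums_int_halves[OF this] show ?thesis
    by (simp add: theta_mom_def theta_coeff_def theta_weight_def triangle_minus_nat algebra_simps)
qed

text \<open>The heat equation on coefficients: (n - 1/2)^2 = 2 * n(n-1)/2 + 1/4, so q d/dq acts as
  half of (d/du)^2 - 1/4.\<close>

lemma theta_coeff_heat:
  "theta_coeff k z j * of_nat (triangle (1 + int j)) =
     (theta_coeff (k + 2) z j - theta_coeff k z j / 4) / 2"
proof -
  have "2 * complex_of_nat (triangle (1 + int j)) = of_nat (j * (j + 1))"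
    using arg_cong[OF two_triangle_Suc_nat[of j], of complex_of_nat] by simp
  then have t: "complex_of_nat (triangle (1 + int j)) = of_nat j * (of_nat j + 1) / 2"
    by (simp add: field_simps)
  have h: "half_shift (1 + int j) ^ 2 = of_nat j * (of_nat j + 1) + 1 / 4"
    "half_shift (- int j) ^ 2 = of_nat j * (of_nat j + 1) + 1 / 4"
    by (simp_all add: half_shift_def power2_eq_square algebra_simps)
  then show ?thesis
    by (simp only: theta_coeff_def t power_add h) (simp add: field_simps)
qed

text \<open>The second conclusion is empty at q = 0. The third one supplies the derivative there,
  where only the term j = 1, the one with exponent 1, contributes; it is needed to fix constants of
  integration.\<close>

lemma theta_mom_deriv:
  assumes "norm z = 1" "norm q < 1"
  obtains D where "(theta_mom k z has_field_derivative D) (at q)"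
    "q * D = (theta_mom (k + 2) z q - theta_mom k z q / 4) / 2"
    "q = 0 \<Longrightarrow> D = theta_coeff k z 1"
proof -
  define T where "T j = triangle (1 + int j)" for j
  define f where "f j x = theta_coeff k z j * x ^ T j" for j x
  define f' where "f' j x = theta_coeff k z j * (of_nat (T j) * x ^ (T j - 1))" for j x
  have "\<exists>g g'. \<forall>x\<in>ball 0 1. (\<lambda>j. f j x) sums g x \<and> (\<lambda>j. f' j x) sums g' x \<and>
      (g has_field_derivative g' x) (at x)"
  proof (rule series_and_derivative_comparison_local)
    show "(f j has_field_derivative f' j x) (at x)" for j x
      unfolding f_def f'_def by (auto intro!: derivative_eq_intros)
    fix x :: complex assume x: "x \<in> ball 0 1"
    define r where "r = (1 + norm x) / 2"
    have r: "norm x < r" "r < 1" using x by (auto simp: r_def)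
    then have r0: "0 \<le> r" using norm_ge_zero[of x] by linarith
    have "norm (f j y) \<le> 2 * (real (Suc j) ^ k * r ^ j)" if "y \<in> ball x (r - norm x)" for j y
    proof -
      have y: "norm y \<le> r"
        using that norm_triangle_ineq2[of y x] by (auto simp: dist_norm norm_minus_commute)
      have "f j y = theta_weight z y (1 + int j) * half_shift (1 + int j) ^ k +
          theta_weight z y (- int j) * half_shift (- int j) ^ k"
        by (simp add: f_def T_def theta_coeff_def theta_weight_def triangle_minus_nat algebra_simps)
      then show ?thesis
        using norm_triangle_ineq theta_term_bound[of z y r "1 + int j" j k]
          theta_term_bound[of z y r "- int j" j k] assms(1) y r(2)
        by (smt (verit, best))
    qed
    moreover have "summable (\<lambda>j. 2 * (real (Suc j) ^ k * r ^ j))"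
      using r r0 by (intro summable_mult summable_Suc_power_geometric) auto
    ultimately show "\<exists>d h. 0 < d \<and> summable h \<and>
        (\<forall>\<^sub>F n in sequentially. \<forall>y\<in>ball x d \<inter> ball 0 1. norm (f n y) \<le> h n)"
      using r by (intro exI[of _ "r - norm x"] exI[of _ "\<lambda>j. 2 * (real (Suc j) ^ k * r ^ j)"]) auto
  qed simp
  then obtain g g' where g: "\<And>x. x \<in> ball 0 1 \<Longrightarrow> (\<lambda>j. f j x) sums g x"
    "\<And>x. x \<in> ball 0 1 \<Longrightarrow> (\<lambda>j. f' j x) sums g' x"
    "\<And>x. x \<in> ball 0 1 \<Longrightarrow> (g has_field_derivative g' x) (at x)"
    by blast
  have "g x = theta_mom k z x" if "x \<in> ball 0 1" for x
    using g(1)[OF that] theta_mom_sums[of z x k] assms(1) that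
    unfolding f_def T_def by (simp add: sums_unique2)
  then have "(theta_mom k z has_field_derivative g' q) (at q)"
    using has_field_derivative_transform_within_open[OF g(3)[of q], of "ball 0 1" "theta_mom k z"] assms(2)
    by simp
  moreover have "q * g' q = (theta_mom (k + 2) z q - theta_mom k z q / 4) / 2"
  proof -
    have "q * f' j q = (theta_coeff (k + 2) z j * q ^ T j - theta_coeff k z j * q ^ T j / 4) / 2" for j
    proof -
      have "q * f' j q = theta_coeff k z j * of_nat (T j) * q ^ T j"
        by (cases "T j") (simp_all add: f'_def)
      then show ?thesis
        using theta_coeff_heat[of k z j] by (simp add: T_def algebra_simps)
    qed
    moreover have "(\<lambda>j. (theta_coeff (k + 2) z j * q ^ T j - theta_coeff k z j * q ^ T j / 4) / 2)
        sums ((theta_mom (k + 2) z q - theta_mom k z q / 4) / 2)"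
      unfolding T_def by (intro sums_divide sums_diff theta_mom_sums assms)
    ultimately have "(\<lambda>j. q * f' j q) sums ((theta_mom (k + 2) z q - theta_mom k z q / 4) / 2)"
      by (simp only:)
    moreover have "(\<lambda>j. q * f' j q) sums (q * g' q)"
      using g(2)[of q] assms(2) by (intro sums_mult) auto
    ultimately show ?thesis
      using sums_unique2 by blast
  qed
  moreover have "g' q = theta_coeff k z 1" if "q = 0"
  proof -
    have "f' j 0 = (if j = 1 then theta_coeff k z 1 else 0)" for j
    proof -
      have "T 0 = 0" "T 1 = 1" "T j > 1" if "j > 1"
        using two_triangle_Suc_nat[of 0] two_triangle_Suc_nat[of 1] two_triangle_Suc_nat[of j]
          triangle_Suc_nat_ge[of j] that by (auto simp: T_def)
      then show ?thesis
        by (cases "j = 0"; cases "j = 1")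
          (use two_triangle_Suc_nat[of 0] two_triangle_Suc_nat[of 1] in
            \<open>auto simp: f'_def T_def power_0_left\<close>)
    qed
    then have "(\<lambda>j. f' j 0) sums theta_coeff k z 1"
      using sums_single[of 1 "\<lambda>_. theta_coeff k z 1"] by simp
    then show ?thesis
      using g(2)[of q] that by (simp add: sums_unique2)
  qed
  ultimately show ?thesis
    using that by blast
qed

lemma theta_mom_0:
  assumes "norm z = 1"
  shows "theta_mom k z 0 = theta_coeff k z 0"
proof -
  have "0 < triangle (1 + int j)" if "j \<noteq> 0" for j
    using triangle_Suc_nat_ge[of j] that by linarith
  moreover have "triangle (1 + int 0) = 0"
    by (simp add: triangle_def)
  ultimately have "theta_coeff k z j * 0 ^ triangle (1 + int j) = (if j = 0 then theta_coeff k z 0 else 0)" for j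
    by (cases "j = 0") auto
  then have "(\<lambda>j. theta_coeff k z j * 0 ^ triangle (1 + int j)) sums theta_coeff k z 0"
    using sums_single[of 0 "\<lambda>_. theta_coeff k z 0"] by simp
  then show ?thesis
    using theta_mom_sums[of z 0 k] assms by (simp add: sums_unique2)
qed

section \<open>The Jacobi triple product\<close>

text \<open>Defined by the q-Pascal rule and not as a quotient of q-factorials, so that the finite
  identities below hold for every q, roots of unity included.\<close>

fun gauss_binom :: "complex \<Rightarrow> nat \<Rightarrow> nat \<Rightarrow> complex" where
  "gauss_binom q m 0 = 1"
| "gauss_binom q 0 (Suc j) = 0"
| "gauss_binom q (Suc m) (Suc j) = gauss_binom q m j + q ^ Suc j * gauss_binom q m (Suc j)"

definition q_fact :: "complex \<Rightarrow> nat \<Rightarrow> complex" where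
  "q_fact q n = (\<Prod>k<n. 1 - q ^ Suc k)"

lemma gauss_binom_eq_0: "m < j \<Longrightarrow> gauss_binom q m j = 0"
  by (induction q m j rule: gauss_binom.induct) auto

lemma gauss_binom_q_fact:
  "j \<le> m \<Longrightarrow> gauss_binom q m j * q_fact q j * q_fact q (m - j) = q_fact q m"
proof (induction q m j rule: gauss_binom.induct)
  case (3 q m j)
  have j: "j \<le> m" using 3 by simp
  have IH1: "gauss_binom q m j * q_fact q j * q_fact q (m - j) = q_fact q m"
    using 3 by simp
  have IH2: "gauss_binom q m (Suc j) * q_fact q (Suc j) * q_fact q (m - j) =
      q_fact q m * (1 - q ^ (m - j))"
  proof (cases "j = m")
    case False
    then have "m - j = Suc (m - Suc j)" and "Suc j \<le> m"
      using j by auto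
    then show ?thesis
      using 3(2) by (simp add: q_fact_def mult_ac)
  qed (simp add: gauss_binom_eq_0)
  have "gauss_binom q (Suc m) (Suc j) * q_fact q (Suc j) * q_fact q (Suc m - Suc j) =
      (gauss_binom q m j * q_fact q j * q_fact q (m - j)) * (1 - q ^ Suc j) +
      q ^ Suc j * (gauss_binom q m (Suc j) * q_fact q (Suc j) * q_fact q (m - j))"
    by (simp add: q_fact_def algebra_simps)
  also have "\<dots> = q_fact q m * (1 - q ^ Suc j * q ^ (m - j))"
    unfolding IH1 IH2 by (simp add: algebra_simps)
  also have "\<dots> = q_fact q (Suc m)"
    using j by (simp add: q_fact_def flip: power_add)
  finally show ?case .
qed (simp_all add: q_fact_def)

text \<open>Brings the two sums produced by a q-Pascal step under a common index.\<close>

lemma sum_atMost_shift_add: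
  fixes f g :: "nat \<Rightarrow> complex"
  assumes "g (Suc m) = 0"
  shows "(\<Sum>j\<le>m. f (Suc j)) + (\<Sum>j\<le>m. g j) = g 0 + (\<Sum>j\<le>m. f (Suc j) + g (Suc j))"
proof -
  have "(\<Sum>j\<le>m. g j) = (\<Sum>j\<le>Suc m. g j)"
    using assms by simp
  also have "\<dots> = g 0 + (\<Sum>j\<le>m. g (Suc j))"
    by (rule sum.atMost_Suc_shift)
  finally show ?thesis
    by (simp add: sum.distrib)
qed

text \<open>The q-binomial theorem. Splitting off the factor k = 0 leaves the product for m factors
  at x q, hence the induction over arbitrary x.\<close>

lemma gauss_binom_theorem:
  "(\<Prod>k<m. 1 - x * q ^ k) = (\<Sum>j\<le>m. (-1) ^ j * q ^ triangle (int j) * gauss_binom q m j * x ^ j)"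
proof (induction m arbitrary: x)
  case (Suc m)
  define c where "c j = (-1) ^ j * q ^ triangle (int j) * x ^ j" for j
  have tri: "triangle (1 + int j) = triangle (int j) + j" for j
    using two_triangle[of "int j"] by (intro triangle_eqI) (simp add: algebra_simps)
  have c: "c (Suc j) = - x * q ^ j * c j" for j
    by (simp add: c_def tri power_add algebra_simps)
  have "(\<Prod>k<Suc m. 1 - x * q ^ k) = (1 - x) * (\<Prod>k<m. 1 - (x * q) * q ^ k)"
    by (simp only: prod.lessThan_Suc_shift) (simp add: mult_ac)
  also have "\<dots> = (\<Sum>j\<le>m. c (Suc j) * gauss_binom q m j) + (\<Sum>j\<le>m. c j * q ^ j * gauss_binom q m j)"
    unfolding Suc.IH c sum.distrib[symmetric] sum_distrib_left
    by (intro sum.cong refl) (simp add: c_def power_mult_distrib algebra_simps)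
  \<comment> \<open>The summand is rewritten as a function of \<open>Suc j\<close> to match
    \<open>sum_atMost_shift_add\<close>; the case expression is only evaluated at
    successors.\<close>
  also have "\<dots> = (\<Sum>j\<le>m. c (Suc j) * (case Suc j of Suc i \<Rightarrow> gauss_binom q m i)) +
      (\<Sum>j\<le>m. c j * q ^ j * gauss_binom q m j)"
    by simp
  also have "\<dots> = c 0 + (\<Sum>j\<le>m. c (Suc j) * gauss_binom q (Suc m) (Suc j))"
    by (subst sum_atMost_shift_add[where f = "\<lambda>j. c j * (case j of Suc i \<Rightarrow> gauss_binom q m i)"
          and g = "\<lambda>j. c j * q ^ j * gauss_binom q m j"])
      (simp_all add: gauss_binom_eq_0 algebra_simps)
  also have "\<dots> = (\<Sum>j\<le>Suc m. c j * gauss_binom q (Suc m) j)"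
    by (subst sum.atMost_Suc_shift) simp
  finally show ?case
    by (simp add: c_def mult_ac)
qed simp

text \<open>Using x - q^(k+1) in place of 1 - q^(k+1)/x keeps both sides polynomial in x. The
  induction on n starts from the q-binomial theorem and multiplies by one more such factor.\<close>

lemma finite_jacobi_triple_product:
  "(\<Prod>k<m. 1 - x * q ^ k) * (\<Prod>k<n. x - q ^ Suc k) =
     (\<Sum>j\<le>m + n. (-1) ^ (j + n) * q ^ triangle (int j - int n) * gauss_binom q (m + n) j * x ^ j)"
proof (induction n)
  case 0
  then show ?case using gauss_binom_theorem[of x q m] by simp
next
  case (Suc n)
  define c where "c j = (-1) ^ (j + n) * q ^ triangle (int j - int n)" for j
  define d where "d j = (-1) ^ (j + Suc n) * q ^ triangle (int j - int (Suc n))" for j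
  have cd: "d (Suc j) = c j" for j
    by (simp add: c_def d_def)
  have cd': "c j * q ^ Suc n = - d j * q ^ j" for j
  proof -
    have "triangle (int j - int n) + Suc n = triangle (int j - int (Suc n)) + j"
      using two_triangle[of "int j - int n"] two_triangle[of "int j - int (Suc n)"]
      by (auto simp: algebra_simps)
    then have "q ^ triangle (int j - int n) * q ^ Suc n = q ^ triangle (int j - int (Suc n)) * q ^ j"
      by (simp only: power_add[symmetric])
    then show ?thesis by (simp add: c_def d_def mult.assoc)
  qed
  have "(\<Prod>k<m. 1 - x * q ^ k) * (\<Prod>k<Suc n. x - q ^ Suc k) =
      (\<Sum>j\<le>m + n. c j * gauss_binom q (m + n) j * x ^ j) * (x - q ^ Suc n)"
    using Suc.IH by (simp add: c_def mult_ac)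
  also have "\<dots> = (\<Sum>j\<le>m + n. c j * gauss_binom q (m + n) j * x ^ Suc j) +
      (\<Sum>j\<le>m + n. - (c j * q ^ Suc n) * gauss_binom q (m + n) j * x ^ j)"
    unfolding sum_distrib_right sum.distrib[symmetric]
    by (intro sum.cong refl) (simp add: algebra_simps)
  also have "\<dots> = (\<Sum>j\<le>m + n. d (Suc j) * x ^ Suc j * (case Suc j of Suc i \<Rightarrow> gauss_binom q (m + n) i)) +
      (\<Sum>j\<le>m + n. d j * x ^ j * q ^ j * gauss_binom q (m + n) j)"
    unfolding cd cd' by (simp add: mult_ac)
  also have "\<dots> = d 0 + (\<Sum>j\<le>m + n. d (Suc j) * x ^ Suc j * gauss_binom q (Suc (m + n)) (Suc j))"
    by (subst sum_atMost_shift_add[where f = "\<lambda>j. d j * x ^ j * (case j of Suc i \<Rightarrow> gauss_binom q (m + n) i)"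
          and g = "\<lambda>j. d j * x ^ j * q ^ j * gauss_binom q (m + n) j"])
      (simp_all add: gauss_binom_eq_0 algebra_simps)
  also have "\<dots> = (\<Sum>j\<le>Suc (m + n). d j * x ^ j * gauss_binom q (Suc (m + n)) j)"
    by (subst sum.atMost_Suc_shift) simp
  finally show ?case
    by (simp add: d_def mult_ac)
qed

section \<open>Passage from the finite to the infinite triple product\<close>

definition euler_prod :: "complex \<Rightarrow> complex" where
  "euler_prod q = (\<Prod>k. 1 - q ^ Suc k)"

lemma one_minus_power_nonzero:
  fixes q :: complex
  assumes "norm q < 1"
  shows "1 - q ^ Suc k \<noteq> 0"
proof -
  have "norm (q ^ Suc k) \<le> norm q ^ 1"
    using assms unfolding norm_power by (intro power_decreasing) auto
  then have "norm (q ^ Suc k) < 1"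
    using assms by simp
  then show ?thesis
    by (metis eq_iff_diff_eq_0 less_irrefl norm_one)
qed

lemma
  assumes "norm q < 1"
  shows q_fact_tendsto: "q_fact q \<longlonglongrightarrow> euler_prod q"
    and euler_prod_nonzero: "euler_prod q \<noteq> 0"
proof -
  have "summable (\<lambda>k. norm ((1 - q ^ Suc k) - 1))"
    using assms by (simp add: norm_mult norm_power summable_mult summable_geometric)
  then have c: "convergent_prod (\<lambda>k. 1 - q ^ Suc k)"
    using summable_imp_convergent_prod_complex[of "\<lambda>k. - (q ^ Suc k)"]
      one_minus_power_nonzero[OF assms] by simp
  have "(\<lambda>n. (\<Prod>i\<le>n. 1 - q ^ Suc i)) \<longlonglongrightarrow> euler_prod q"
    unfolding euler_prod_def by (rule convergent_prod_LIMSEQ[OF c])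
  then have "(\<lambda>n. q_fact q (Suc n)) \<longlonglongrightarrow> euler_prod q"
    by (simp only: q_fact_def lessThan_Suc_atMost)
  then show "q_fact q \<longlonglongrightarrow> euler_prod q"
    by (rule LIMSEQ_imp_Suc)
  show "euler_prod q \<noteq> 0"
    unfolding euler_prod_def using prodinf_nonzero[OF c] one_minus_power_nonzero[OF assms] by blast
qed

lemma q_fact_nonzero: "norm q < 1 \<Longrightarrow> q_fact q n \<noteq> 0"
  using one_minus_power_nonzero by (auto simp: q_fact_def)

lemma gauss_binom_eq:
  assumes "norm q < 1" "j \<le> m"
  shows "gauss_binom q m j = q_fact q m / (q_fact q j * q_fact q (m - j))"
  using gauss_binom_q_fact[OF assms(2), of q] q_fact_nonzero[OF assms(1)]
  by (simp add: field_simps)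

text \<open>Both \<open>q_fact q\<close> and its reciprocal converge, hence are bounded. A bound
  uniform in m and j gives the dominating series for Tannery's theorem.\<close>

lemma gauss_binom_bounded:
  assumes "norm q < 1"
  obtains M where "0 < M" "\<And>m j. norm (gauss_binom q m j) \<le> M"
proof -
  have "Bseq (q_fact q)"
    using q_fact_tendsto[OF assms] convergent_imp_Bseq convergentI by blast
  then obtain A where A: "A > 0" "\<And>n. norm (q_fact q n) \<le> A"
    by (auto elim: BseqE)
  have "Bseq (\<lambda>n. inverse (q_fact q n))"
    using tendsto_inverse[OF q_fact_tendsto[OF assms] euler_prod_nonzero[OF assms]]
      convergent_imp_Bseq convergentI by blast
  then obtain B where B: "B > 0" "\<And>n. norm (inverse (q_fact q n)) \<le> B"
    by (auto elim: BseqE)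
  have "norm (gauss_binom q m j) \<le> A * (B * B)" for m j
  proof (cases "j \<le> m")
    case True
    then have "gauss_binom q m j = q_fact q m * (inverse (q_fact q j) * inverse (q_fact q (m - j)))"
      using gauss_binom_eq[OF assms True] by (simp add: field_simps)
    then show ?thesis
      using A B by (simp add: norm_mult del: norm_inverse) (intro mult_mono; simp)
  qed (use A B in \<open>simp add: gauss_binom_eq_0\<close>)
  then show ?thesis
    using that[of "A * (B * B)"] A B by simp
qed

lemma gauss_binom_tendsto:
  assumes "norm q < 1"
  shows "(\<lambda>N. gauss_binom q (N + N) (nat (int N + n))) \<longlonglongrightarrow> 1 / euler_prod q"
proof -
  have E: "euler_prod q \<noteq> 0" and lim: "q_fact q \<longlonglongrightarrow> euler_prod q"
    using euler_prod_nonzero[OF assms] q_fact_tendsto[OF assms] .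
  have sub: "(\<lambda>N. q_fact q (g N)) \<longlonglongrightarrow> euler_prod q" if "filterlim g at_top sequentially" for g
    using filterlim_compose[OF lim that] .
  have F: "filterlim (\<lambda>N. nat (int N + m)) at_top sequentially" for m
    by (rule filterlim_at_top_mono[OF filterlim_minus_const_nat_at_top[of "nat \<bar>m\<bar>"]])
      (auto intro!: always_eventually)
  have "filterlim (\<lambda>N::nat. N + N) at_top sequentially"
    by (rule filterlim_at_top_mono[OF filterlim_ident]) (auto intro!: always_eventually)
  then have "(\<lambda>N. q_fact q (N + N) / (q_fact q (nat (int N + n)) * q_fact q (nat (int N + (- n)))))
      \<longlonglongrightarrow> euler_prod q / (euler_prod q * euler_prod q)"
    using E by (intro tendsto_divide tendsto_mult sub F) auto
  moreover have "\<forall>\<^sub>F N in sequentially. q_fact q (N + N) / (q_fact q (nat (int N + n)) * q_fact q (nat (int N + (- n)))) =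
      gauss_binom q (N + N) (nat (int N + n))"
    using eventually_ge_at_top[of "nat \<bar>n\<bar>"]
  proof eventually_elim
    case (elim N)
    then have "nat (int N + n) \<le> N + N" "N + N - nat (int N + n) = nat (int N + (- n))"
      by auto
    then show ?case
      using gauss_binom_eq[OF assms, of "nat (int N + n)" "N + N"] by simp
  qed
  ultimately have "(\<lambda>N. gauss_binom q (N + N) (nat (int N + n))) \<longlonglongrightarrow> euler_prod q / (euler_prod q * euler_prod q)"
    by (rule Lim_transform_eventually)
  then show ?thesis using E by simp
qed

text \<open>Padding by zeros turns sums of growing length into series over one fixed index set, the
  form in which Tannery's theorem applies.\<close>

lemma sum_symmetric_int:
  fixes f :: "int \<Rightarrow> complex"
  shows "(\<Sum>j\<le>N + N. f (int j - int N)) =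
    (\<Sum>j. (if 1 + j \<le> N then f (1 + int j) else 0) + (if j \<le> N then f (- int j) else 0))"
proof -
  have "(\<Sum>j\<le>N + N. f (int j - int N)) = (\<Sum>n\<in>{- int N..int N}. f n)"
    by (rule sum.reindex_bij_witness[of _ "\<lambda>n. nat (n + int N)" "\<lambda>j. int j - int N"]) auto
  also have "{- int N..int N} = (\<lambda>j. 1 + int j) ` {..<N} \<union> (\<lambda>j. - int j) ` {..N}"
  proof (intro equalityI subsetI)
    fix n assume "n \<in> {- int N..int N}"
    then show "n \<in> (\<lambda>j. 1 + int j) ` {..<N} \<union> (\<lambda>j. - int j) ` {..N}"
      by (cases "n \<ge> 1") (auto simp: image_iff Bex_def intro: exI[of _ "nat (n - 1)"] exI[of _ "nat (- n)"])
  qed auto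
  also have "(\<Sum>n\<in>\<dots>. f n) = (\<Sum>j<N. f (1 + int j)) + (\<Sum>j\<le>N. f (- int j))"
    by (subst sum.union_disjoint) (auto simp: sum.reindex inj_on_def)
  also have "(\<Sum>j<N. f (1 + int j)) = (\<Sum>j. if 1 + j \<le> N then f (1 + int j) else 0)"
    by (subst suminf_finite[of "{..<N}"]) (auto intro!: sum.cong)
  also have "(\<Sum>j\<le>N. f (- int j)) = (\<Sum>j. if j \<le> N then f (- int j) else 0)"
    by (subst suminf_finite[of "{..N}"]) (auto intro!: sum.cong)
  also have "(\<Sum>j. if 1 + j \<le> N then f (1 + int j) else 0) + (\<Sum>j. if j \<le> N then f (- int j) else 0) =
    (\<Sum>j. (if 1 + j \<le> N then f (1 + int j) else 0) + (if j \<le> N then f (- int j) else 0))"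
    by (intro suminf_add summable_finite[of "{..<N}"] summable_finite[of "{..N}"]) auto
  finally show ?thesis .
qed

text \<open>The case m = n = N of the finite triple product, with moments inserted: each Gaussian
  binomial tends to 1 / \<open>euler_prod q\<close>, and Tannery's theorem exchanges limit and
  sum.\<close>

lemma theta_partial_sums_tendsto:
  assumes z: "norm z = 1" and q: "norm q < 1"
  shows "(\<lambda>N. \<Sum>j\<le>N + N. theta_weight z q (int j - int N) * half_shift (int j - int N) ^ k *
      gauss_binom q (N + N) j) \<longlonglongrightarrow> theta_mom k z q / euler_prod q"
proof -
  define f where "f N n = theta_weight z q n * half_shift n ^ k * gauss_binom q (N + N) (nat (int N + n))" for N n
  define a where "a j N = (if 1 + j \<le> N then f N (1 + int j) else 0) + (if j \<le> N then f N (- int j) else 0)" for j N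
  define b where "b j = theta_coeff k z j * q ^ triangle (1 + int j) * (1 / euler_prod q)" for j
  obtain M where M: "0 < M" "\<And>m j. norm (gauss_binom q m j) \<le> M"
    using gauss_binom_bounded[OF q] by blast
  have f_bound: "norm (f N n) \<le> real (Suc j) ^ k * norm q ^ j * M" if "n = 1 + int j \<or> n = - int j" for N n j
    unfolding f_def norm_mult[of _ "gauss_binom _ _ _"]
    using theta_term_bound[OF z order_refl q that] M by (intro mult_mono) auto
  have f_lim: "(\<lambda>N. f N n) \<longlonglongrightarrow> theta_weight z q n * half_shift n ^ k * (1 / euler_prod q)" for n
    unfolding f_def by (intro tendsto_mult tendsto_const gauss_binom_tendsto q)
  have "a j \<longlonglongrightarrow> b j" for j
  proof -
    have "(\<lambda>N. f N (1 + int j) + f N (- int j)) \<longlonglongrightarrow>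
        theta_weight z q (1 + int j) * half_shift (1 + int j) ^ k * (1 / euler_prod q) +
        theta_weight z q (- int j) * half_shift (- int j) ^ k * (1 / euler_prod q)"
      by (intro tendsto_add f_lim)
    also have "theta_weight z q (1 + int j) * half_shift (1 + int j) ^ k * (1 / euler_prod q) +
        theta_weight z q (- int j) * half_shift (- int j) ^ k * (1 / euler_prod q) = b j"
      by (simp add: b_def theta_coeff_def theta_weight_def triangle_minus_nat algebra_simps add_divide_distrib)
    finally show ?thesis
    proof (rule Lim_transform_eventually)
      show "\<forall>\<^sub>F N in sequentially. f N (1 + int j) + f N (- int j) = a j N"
        using eventually_ge_at_top[of "1 + j"] by eventually_elim (simp add: a_def)
    qed
  qed
  moreover have "norm (a j N) \<le> 2 * (real (Suc j) ^ k * norm q ^ j * M)" for j N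
  proof -
    have 1: "0 \<le> real (Suc j) ^ k * norm q ^ j * M" using M by simp
    have "norm (if 1 + j \<le> N then f N (1 + int j) else 0) \<le> real (Suc j) ^ k * norm q ^ j * M"
      using f_bound[of "1 + int j" j N] 1 by (simp del: of_nat_Suc)
    moreover have "norm (if j \<le> N then f N (- int j) else 0) \<le> real (Suc j) ^ k * norm q ^ j * M"
      using f_bound[of "- int j" j N] 1 by (simp del: of_nat_Suc)
    ultimately show ?thesis
      unfolding a_def by (intro order_trans[OF norm_triangle_ineq]) linarith
  qed
  moreover have "summable (\<lambda>j. 2 * (real (Suc j) ^ k * norm q ^ j * M))"
    using q by (intro summable_mult summable_mult2 summable_Suc_power_geometric) auto
  ultimately have "(\<lambda>N. \<Sum>j. a j N) \<longlonglongrightarrow> suminf b"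
    by (intro conjunct2[OF conjunct2[OF tannerys_theorem[where M = "\<lambda>j. 2 * (real (Suc j) ^ k * norm q ^ j * M)"]]]
        always_eventually) (simp_all del: of_nat_Suc)
  moreover have "suminf b = theta_mom k z q / euler_prod q"
    using sums_mult2[OF theta_mom_sums[OF z q, of k], of "1 / euler_prod q"]
    by (simp add: b_def[abs_def] sums_iff)
  moreover have "(\<Sum>j. a j N) = (\<Sum>j\<le>N + N. theta_weight z q (int j - int N) * half_shift (int j - int N) ^ k *
      gauss_binom q (N + N) j)" for N
    using sum_symmetric_int[where f = "f N" and N = N] by (simp add: a_def f_def)
  ultimately show ?thesis by simp
qed

lemma minus_powi_diff:
  fixes z :: complex
  assumes "z \<noteq> 0"
  shows "(-1) ^ (j + N) * z ^ j = (- z) powi (int j - int N) * z ^ N"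
proof -
  have "(- z) powi (int j - int N) = (- z) ^ j / (- z) ^ N"
    using assms by (subst power_int_diff) auto
  also have "\<dots> = ((-1) ^ j * z ^ j) / ((-1) ^ N * z ^ N)"
    by (metis power_minus)
  also have "\<dots> * z ^ N = (-1) ^ (j + N) * z ^ j"
    using assms by (simp add: power_add field_simps)
  finally show ?thesis by simp
qed

text \<open>The finite triple product contains the factor 1 - x, so its derivative at x = 1 is minus
  the product of the remaining factors; these tend to the square of the Euler product.\<close>

lemma theta_mom_jacobi:
  assumes q: "norm q < 1"
  shows "theta_mom 1 1 q = - (euler_prod q ^ 3)"
proof -
  define S where "S k N = (\<Sum>j\<le>N + N. theta_weight 1 q (int j - int N) * half_shift (int j - int N) ^ k *
      gauss_binom q (N + N) j)" for k N
  have S: "S 1 N = - (q_fact q (N - 1) * q_fact q N)" if "N > 0" for N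
  proof -
    define c where "c j = theta_weight 1 q (int j - int N) * gauss_binom q (N + N) j" for j
    define R where "R x = (\<Prod>k<N - 1. 1 - x * q ^ Suc k) * (\<Prod>k<N. x - q ^ Suc k)" for x
    have eq: "(\<Sum>j\<le>N + N. c j * x ^ j) = (1 - x) * R x" for x
    proof -
      have "(\<Prod>k<N. 1 - x * q ^ k) = (1 - x) * (\<Prod>k<N - 1. 1 - x * q ^ Suc k)"
        using prod.lessThan_Suc_shift[of "\<lambda>k. 1 - x * q ^ k" "N - 1"] that by simp
      moreover have "c j = (-1) ^ (j + N) * q ^ triangle (int j - int N) * gauss_binom q (N + N) j" for j
        using minus_powi_diff[of 1 j N] by (simp add: c_def theta_weight_def)
      ultimately show ?thesis
        using finite_jacobi_triple_product[where x = x and q = q and m = N and n = N] by (simp add: R_def mult.assoc)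
    qed
    have "R field_differentiable at 1"
      unfolding R_def by (intro derivative_intros holomorphic_on_imp_differentiable_at[of _ UNIV] holomorphic_intros) auto
    then obtain D where "(R has_field_derivative D) (at 1)"
      using field_differentiable_def by blast
    then have "((\<lambda>x. (1 - x) * R x) has_field_derivative - R 1) (at 1)"
      by (auto intro!: derivative_eq_intros)
    moreover have "((\<lambda>x. \<Sum>j\<le>N + N. c j * x ^ j) has_field_derivative (\<Sum>j\<le>N + N. c j * of_nat j)) (at 1)"
      by (auto intro!: derivative_eq_intros sum.cong)
    ultimately have "(\<Sum>j\<le>N + N. c j * of_nat j) = - R 1"
      unfolding eq by (metis DERIV_unique)
    moreover have "(\<Sum>j\<le>N + N. c j) = 0"
      using eq[of 1] by simp
    \<comment> \<open>Here \<open>half_shift\<close> of j - N is j - (N + 1/2). The constant part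
      multiplies the value of the product at x = 1, which is 0.\<close>
    moreover have "S 1 N = (\<Sum>j\<le>N + N. c j * of_nat j) - (of_nat N + 1 / 2) * (\<Sum>j\<le>N + N. c j)"
      unfolding S_def c_def sum_distrib_left sum_subtractf[symmetric]
      by (intro sum.cong) (auto simp: half_shift_def algebra_simps)
    ultimately show ?thesis
      by (simp add: R_def q_fact_def)
  qed
  have "S 1 \<longlonglongrightarrow> theta_mom 1 1 q / euler_prod q"
    unfolding S_def by (rule theta_partial_sums_tendsto) (use q in auto)
  then have 1: "(\<lambda>N. S 1 (Suc N)) \<longlonglongrightarrow> theta_mom 1 1 q / euler_prod q"
    by (rule LIMSEQ_Suc)
  have "(\<lambda>N. - (q_fact q N * q_fact q (Suc N))) \<longlonglongrightarrow> - (euler_prod q * euler_prod q)"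
    by (intro tendsto_minus tendsto_mult LIMSEQ_Suc q_fact_tendsto q)
  moreover have "S 1 (Suc N) = - (q_fact q N * q_fact q (Suc N))" for N
    using S[of "Suc N"] by simp
  ultimately have "(\<lambda>N. S 1 (Suc N)) \<longlonglongrightarrow> - (euler_prod q * euler_prod q)"
    by (simp only:)
  with 1 have "theta_mom 1 1 q / euler_prod q = - (euler_prod q * euler_prod q)"
    by (rule LIMSEQ_unique)
  then show ?thesis
    using euler_prod_nonzero[OF q] by (simp add: field_simps power3_eq_cube)
qed

definition omega :: complex where
  "omega = Complex (- 1 / 2) (sqrt 3 / 2)"

lemma omega_sum: "1 + omega + omega\<^sup>2 = 0"
  by (simp add: omega_def complex_eq_iff power2_eq_square)

lemma omega_cubed: "omega ^ 3 = 1"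
proof -
  have "omega ^ 3 - 1 = (omega - 1) * (1 + omega + omega\<^sup>2)"
    by (simp add: algebra_simps power2_eq_square power3_eq_cube)
  then show ?thesis by (simp add: omega_sum)
qed

lemma norm_omega: "norm omega = 1"
  by (simp add: omega_def cmod_def power_divide)

text \<open>The factors at x = \<omega> are completed by those of the Euler product, because (1 -
  x)(1 - \<omega> x)(1 - \<omega>^2 x) = 1 - x^3.\<close>

lemma theta_mom_omega:
  assumes q: "norm q < 1"
  shows "theta_mom 0 omega q = (1 - omega) * euler_prod (q ^ 3)"
proof -
  have w0: "omega \<noteq> 0" using norm_omega by auto
  have q3: "norm (q ^ 3) < 1"
    using q by (simp add: norm_power power_less_one_iff)
  define S where "S N = (\<Sum>j\<le>N + N. theta_weight omega q (int j - int N) * half_shift (int j - int N) ^ 0 *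
      gauss_binom q (N + N) j)" for N
  \<comment> \<open>One product runs over k = 0..N-1 and not over k = 1..N; the factors 1 - \<omega>
    q^N and 1 - \<omega> account for this shift.\<close>
  have S: "S N * q_fact q N * (1 - omega * q ^ N) = (1 - omega) * q_fact (q ^ 3) N" for N
  proof -
    have "(\<Prod>k<N. 1 - omega * q ^ k) * (\<Prod>k<N. omega - q ^ Suc k) = S N * omega ^ N"
      unfolding finite_jacobi_triple_product S_def sum_distrib_right
    proof (intro sum.cong refl)
      fix j
      show "(- 1) ^ (j + N) * q ^ triangle (int j - int N) * gauss_binom q (N + N) j * omega ^ j =
          theta_weight omega q (int j - int N) * half_shift (int j - int N) ^ 0 *
          gauss_binom q (N + N) j * omega ^ N"
        using minus_powi_diff[OF w0, of j N] by (simp add: theta_weight_def mult_ac)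
    qed
    moreover have "(\<Prod>k<N. omega - q ^ Suc k) = omega ^ N * (\<Prod>k<N. 1 - omega\<^sup>2 * q ^ Suc k)"
    proof -
      have "omega * (omega\<^sup>2 * x) = x" for x
        using omega_cubed by (simp add: power3_eq_cube power2_eq_square mult_ac)
      then have "omega - q ^ Suc k = omega * (1 - omega\<^sup>2 * q ^ Suc k)" for k
        by (simp add: right_diff_distrib del: power_Suc)
      then show ?thesis
        by (simp add: prod.distrib prod_constant del: power_Suc)
    qed
    ultimately have 1: "S N = (\<Prod>k<N. 1 - omega * q ^ k) * (\<Prod>k<N. 1 - omega\<^sup>2 * q ^ Suc k)"
      using w0 by simp
    have 2: "(\<Prod>k<N. 1 - omega * q ^ k) * (1 - omega * q ^ N) = (1 - omega) * (\<Prod>k<N. 1 - omega * q ^ Suc k)"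
      using prod.lessThan_Suc_shift[of "\<lambda>k. 1 - omega * q ^ k" N]
        prod.lessThan_Suc[of "\<lambda>k. 1 - omega * q ^ k" N] by simp
    have 3: "(1 - omega * x) * (1 - omega\<^sup>2 * x) * (1 - x) = 1 - x ^ 3" for x
    proof -
      have "(1 - omega * x) * (1 - omega\<^sup>2 * x) * (1 - x) =
          1 - (1 + omega + omega\<^sup>2) * x + (omega + omega\<^sup>2 + omega ^ 3) * x\<^sup>2 - omega ^ 3 * x ^ 3"
        by (simp add: algebra_simps power2_eq_square power3_eq_cube)
      also have "\<dots> = 1 - x ^ 3"
        using omega_sum by (simp add: omega_cubed algebra_simps)
      finally show ?thesis .
    qed
    have "S N * q_fact q N * (1 - omega * q ^ N) =
        (1 - omega) * (\<Prod>k<N. (1 - omega * q ^ Suc k) * (1 - omega\<^sup>2 * q ^ Suc k) * (1 - q ^ Suc k))"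
      unfolding 1 q_fact_def prod.distrib using 2 by (simp add: mult_ac del: power_Suc)
    also have "\<dots> = (1 - omega) * q_fact (q ^ 3) N"
      unfolding 3 q_fact_def by (simp only: power_mult[symmetric] mult.commute)
    finally show ?thesis .
  qed
  have "(\<lambda>N. S N * q_fact q N * (1 - omega * q ^ N)) \<longlonglongrightarrow>
      theta_mom 0 omega q / euler_prod q * euler_prod q * (1 - omega * 0)"
    unfolding S_def
    by (intro tendsto_mult tendsto_diff tendsto_const theta_partial_sums_tendsto q_fact_tendsto q norm_omega
        LIMSEQ_power_zero)
  moreover have "(\<lambda>N. S N * q_fact q N * (1 - omega * q ^ N)) \<longlonglongrightarrow> (1 - omega) * euler_prod (q ^ 3)"
    unfolding S by (intro tendsto_mult tendsto_const q_fact_tendsto q3)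
  ultimately show ?thesis
    using LIMSEQ_unique euler_prod_nonzero[OF q] by fastforce
qed

section \<open>Cubic theta identities\<close>

type_synonym int3 = "int \<times> int \<times> int"

definition weight3 :: "complex \<Rightarrow> int3 \<Rightarrow> complex" where
  "weight3 q = (\<lambda>(i, j, k). theta_weight 1 q i * (theta_weight 1 q j * theta_weight 1 q k))"

definition shift3 :: "int3 \<Rightarrow> complex" where
  "shift3 = (\<lambda>(i, j, k). half_shift i + (half_shift j + half_shift k))"

definition theta_fps :: "complex \<Rightarrow> complex \<Rightarrow> complex fps" where
  "theta_fps z q = moment_fps (theta_weight z q) half_shift"

lemma theta_fps_nth: "theta_fps z q $ k = theta_mom k z q / fact k"
  by (simp add: theta_fps_def moment_fps_def theta_mom_def)

lemma theta_weight_scale: "theta_weight z q n = z powi n * theta_weight 1 q n"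
  unfolding theta_weight_def by (metis (no_types, lifting) mult.assoc mult_minus1_right power_int_mult_distrib)

lemma shift3_eq: "shift3 (i, j, k) = of_int (i + j + k) - 3 / 2"
  by (simp add: shift3_def half_shift_def)

lemma
  assumes "norm x = 1" "norm y = 1" "norm z = 1" "norm q < 1"
  defines "W \<equiv> \<lambda>(i, j, k). x powi i * y powi j * z powi k * weight3 q (i, j, k)"
  shows theta_fps_mult3: "theta_fps x q * (theta_fps y q * theta_fps z q) = moment_fps W shift3"
    and moments_summable3: "moments_summable W shift3"
proof -
  have W: "W = (\<lambda>(i, jk). theta_weight x q i * (\<lambda>(j, k). theta_weight y q j * theta_weight z q k) jk)"
    by (auto simp: W_def weight3_def fun_eq_iff theta_weight_scale[of x] theta_weight_scale[of y]
        theta_weight_scale[of z] mult_ac)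
  have L: "shift3 = (\<lambda>(i, jk). half_shift i + (\<lambda>(j, k). half_shift j + half_shift k) jk)"
    by (auto simp: shift3_def fun_eq_iff)
  note s = theta_summable[OF assms(1,4)] theta_summable[OF assms(2,4)] theta_summable[OF assms(3,4)]
  show "theta_fps x q * (theta_fps y q * theta_fps z q) = moment_fps W shift3"
    unfolding W L theta_fps_def moment_fps_mult[OF s(2,3)]
    by (rule moment_fps_mult[OF s(1) moments_summable_times[OF s(2,3)]])
  show "moments_summable W shift3"
    unfolding W L by (rule moments_summable_times[OF s(1) moments_summable_times[OF s(2,3)]])
qed

definition hex_form :: "int \<Rightarrow> int \<Rightarrow> int" where
  "hex_form m n = m\<^sup>2 + m * n + n\<^sup>2"

lemma two_hex_form: "2 * hex_form m n = m\<^sup>2 + n\<^sup>2 + (m + n)\<^sup>2"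
  by (simp add: hex_form_def power2_eq_square algebra_simps)

lemma hex_form_nonneg: "0 \<le> hex_form m n"
  using two_hex_form[of m n] zero_le_power2[of m] zero_le_power2[of n] zero_le_power2[of "m + n"]
  by linarith

text \<open>A triple with i + j + k = 3 s is described by its mean s and its deviations m, n, - m -
  n. In these coordinates the exponent splits into 3 \<open>triangle s\<close> and the hexagonal
  form.\<close>

definition sublattice_index :: "int \<times> int \<times> int \<Rightarrow> int3" where
  "sublattice_index = (\<lambda>(s, m, n). (s + m, s + n, s - m - n))"

lemma bij_sublattice_index:
  "bij_betw sublattice_index UNIV {(i, j, k). 3 dvd i + j + k}"
  by (rule bij_betw_byWitness[where f' =
        "\<lambda>(i, j, k). ((i + j + k) div 3, i - (i + j + k) div 3, j - (i + j + k) div 3)"])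
    (auto simp: sublattice_index_def algebra_simps)

lemma weight3_sublattice:
  "weight3 q (sublattice_index (s, m, n)) = theta_weight 1 (q ^ 3) s * q ^ nat (hex_form m n)"
proof -
  have "int (triangle (s + m) + triangle (s + n) + triangle (s - m - n)) = int (3 * triangle s + nat (hex_form m n))"
    using two_triangle[of "s + m"] two_triangle[of "s + n"] two_triangle[of "s - m - n"] two_triangle[of s]
      two_hex_form[of m n] hex_form_nonneg[of m n]
    by (simp add: power2_eq_square algebra_simps)
  then have t: "triangle (s + m) + triangle (s + n) + triangle (s - m - n) = 3 * triangle s + nat (hex_form m n)"
    by (simp only: of_nat_eq_iff)
  have "(-1 :: complex) powi (s + m) * ((-1) powi (s + n) * (-1) powi (s - m - n)) = (-1) powi (3 * s)"
    by (simp add: power_int_minus_left)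
  also have "\<dots> = (-1) powi s"
    by (simp add: power_int_minus_left)
  finally have sg: "(-1 :: complex) powi (s + m) * ((-1) powi (s + n) * (-1) powi (s - m - n)) = (-1) powi s" .
  have "weight3 q (sublattice_index (s, m, n)) =
      ((-1) powi (s + m) * ((-1) powi (s + n) * (-1) powi (s - m - n))) *
      q ^ (triangle (s + m) + triangle (s + n) + triangle (s - m - n))"
    by (simp add: weight3_def sublattice_index_def theta_weight_def power_add mult_ac)
  then show ?thesis
    unfolding sg t by (simp add: theta_weight_def power_add power_mult)
qed

lemma shift3_sublattice: "shift3 (sublattice_index (s, m, n)) = 3 * half_shift s"
  by (simp add: sublattice_index_def shift3_eq half_shift_def algebra_simps)

lemma theta_a_eq: "theta_a q = (\<Sum>\<^sub>\<infinity>(m, n). q ^ nat (hex_form m n))"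
  unfolding theta_a_def hex_form_def[symmetric]
  using hex_form_nonneg by (intro infsum_cong) (auto simp: power_int_def)

text \<open>The series is the slice s = 0 of the summable triple theta series.\<close>

lemma hex_summable:
  fixes q :: complex
  assumes "norm q < 1"
  shows "(\<lambda>(m, n). q ^ nat (hex_form m n)) summable_on UNIV"
proof -
  have "(\<lambda>p. weight3 q p) summable_on UNIV"
    using moments_summable3[of 1 1 1 q] assms by (auto simp: moments_summable_def dest!: spec[of _ 0] cong: prod.case_cong)
  then have "(weight3 q) summable_on range (\<lambda>mn. sublattice_index (0, mn))"
    using summable_on_subset_banach by blast
  then have "(weight3 q \<circ> (\<lambda>mn. sublattice_index (0, mn))) summable_on UNIV"
    by (subst (asm) summable_on_reindex) (auto simp: inj_on_def sublattice_index_def)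
  moreover have "weight3 q \<circ> (\<lambda>mn. sublattice_index (0, mn)) = (\<lambda>(m, n). q ^ nat (hex_form m n))"
    by (auto simp: fun_eq_iff weight3_sublattice theta_weight_def)
  ultimately show ?thesis
    by simp
qed

text \<open>The sum factors because \<open>shift3\<close> depends on s alone, and
  \<open>weight3\<close> splits into a part in s and a part in (m, n). The unimodular weight c is 1
  for \<open>cubic_theta_identity\<close> and a power of \<omega> for
  \<open>hesse_theta_identity\<close>.\<close>

lemma infsum_sublattice:
  assumes q: "norm q < 1" and c: "\<And>m n. norm (c m n) = 1"
    and s: "(\<lambda>p. weight3 q p * shift3 p ^ r) summable_on UNIV"
  shows "((\<lambda>(s, m, n). weight3 q (sublattice_index (s, m, n)) * shift3 (sublattice_index (s, m, n)) ^ r * c m n)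
     has_sum (3 ^ r * theta_mom r 1 (q ^ 3) * (\<Sum>\<^sub>\<infinity>(m, n). c m n * q ^ nat (hex_form m n)))) UNIV"
proof -
  have q3: "norm (q ^ 3) < 1"
    using q by (simp add: norm_power power_less_one_iff)
  note hex = hex_summable[OF q]
  have hexc: "(\<lambda>(m, n). c m n * q ^ nat (hex_form m n)) summable_on UNIV"
    using hex c unfolding summable_on_iff_abs_summable_on_complex
    by (simp add: split_beta norm_mult)
  have th: "(\<lambda>s. 3 ^ r * (theta_weight 1 (q ^ 3) s * half_shift s ^ r)) summable_on UNIV"
    using theta_summable[of 1 "q ^ 3"] q3 by (intro summable_on_cmult_right) (simp add: moments_summable_def)
  have eq: "(\<lambda>(s, mn). 3 ^ r * (theta_weight 1 (q ^ 3) s * half_shift s ^ r) * (case mn of (m, n) \<Rightarrow> c m n * q ^ nat (hex_form m n))) =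
     (\<lambda>(s, m, n). weight3 q (sublattice_index (s, m, n)) * shift3 (sublattice_index (s, m, n)) ^ r * c m n)"
    by (auto simp: fun_eq_iff weight3_sublattice shift3_sublattice power_mult_distrib)
  have "(\<lambda>(s, mn). 3 ^ r * (theta_weight 1 (q ^ 3) s * half_shift s ^ r) * (case mn of (m, n) \<Rightarrow> c m n * q ^ nat (hex_form m n)))
     summable_on UNIV \<times> UNIV"
    by (rule summable_on_times_complex[OF th hexc])
  moreover have "(\<Sum>\<^sub>\<infinity>(s, mn)\<in>UNIV \<times> UNIV. 3 ^ r * (theta_weight 1 (q ^ 3) s * half_shift s ^ r) * (case mn of (m, n) \<Rightarrow> c m n * q ^ nat (hex_form m n)))
     = 3 ^ r * theta_mom r 1 (q ^ 3) * (\<Sum>\<^sub>\<infinity>(m, n). c m n * q ^ nat (hex_form m n))"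
    using infsum_times_complex[OF th hexc] by (simp add: infsum_cmult_right' theta_mom_def)
  ultimately show ?thesis
    unfolding eq by (simp add: has_sum_iff)
qed

text \<open>This is h(q), the Borwein function b(q). Its value is never computed:
  \<open>theta_mom_3_ratio\<close> compares two coefficients in which it is a common factor.\<close>

definition hesse_const :: "complex \<Rightarrow> complex" where
  "hesse_const q = (\<Sum>\<^sub>\<infinity>(m, n). omega powi (m - n) * q ^ nat (hex_form m n))"

lemma omega_powi_3: "omega powi (3 * n) = 1"
  by (simp add: power_int_mult omega_cubed)

lemma omega_powi_mod: "omega powi n = omega ^ nat (n mod 3)"
proof -
  have "omega \<noteq> 0" using norm_omega by auto
  then have "omega powi n = omega powi (3 * (n div 3)) * omega powi (n mod 3)"
    by (subst power_int_add[symmetric]) auto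
  also have "\<dots> = omega ^ nat (n mod 3)"
    unfolding omega_powi_3 by (simp add: power_int_def)
  finally show ?thesis .
qed

lemma sum_cube_roots_powi:
  "1 powi n + omega powi n + (omega\<^sup>2) powi n = (if 3 dvd n then 3 else 0)"
proof -
  have w2: "(omega\<^sup>2) powi n = (omega powi n)\<^sup>2"
    by (simp add: power2_eq_square power_int_mult_distrib)
  have "omega ^ 4 = omega ^ 3 * omega"
    by (simp add: eval_nat_numeral)
  then have w4: "omega ^ 4 = omega"
    by (simp add: omega_cubed)
  consider "n mod 3 = 0" | "n mod 3 = 1" | "n mod 3 = 2"
    by linarith
  then show ?thesis
  proof cases
    case 3
    then show ?thesis
      unfolding w2 omega_powi_mod using omega_sum by (simp add: dvd_eq_mod_eq_0 w4 add_ac)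
  qed (use omega_sum in \<open>simp_all add: w2 omega_powi_mod dvd_eq_mod_eq_0\<close>)
qed

lemma has_sum_sublattice_iff:
  "((\<lambda>(s, m, n). f (sublattice_index (s, m, n))) has_sum S) UNIV \<longleftrightarrow>
     ((\<lambda>p. if (case p of (i, j, k) \<Rightarrow> 3 dvd i + j + k) then f p else 0) has_sum S) UNIV"
proof -
  have "((\<lambda>(s, m, n). f (sublattice_index (s, m, n))) has_sum S) UNIV \<longleftrightarrow>
      (f has_sum S) {(i, j, k). 3 dvd i + j + k}"
    using has_sum_reindex_bij_betw[OF bij_sublattice_index, of f S]
    by (simp add: case_prod_unfold)
  also have "\<dots> \<longleftrightarrow> ((\<lambda>p. if (case p of (i, j, k) \<Rightarrow> 3 dvd i + j + k) then f p else 0) has_sum S) UNIV"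
    by (rule has_sum_cong_neutral) auto
  finally show ?thesis .
qed

text \<open>Expanding the cubes weights a triple by 1 + \<omega>^N + \<omega>^(2N) with N = i + j +
  k, a filter for 3 | N. The factor 3^r reflects that x^3 = exp(3u) on the right-hand side.\<close>

lemma cubic_theta_identity:
  assumes q: "norm q < 1"
  shows "(theta_fps 1 q ^ 3 + theta_fps omega q ^ 3 + theta_fps (omega\<^sup>2) q ^ 3) $ r =
    3 * theta_a q * 3 ^ r * theta_fps 1 (q ^ 3) $ r"
proof -
  let ?N = "\<lambda>p :: int3. case p of (i, j, k) \<Rightarrow> i + j + k"
  let ?D = "\<lambda>p :: int3. case p of (i, j, k) \<Rightarrow> 3 dvd i + j + k"
  let ?g = "\<lambda>p. weight3 q p * shift3 p ^ r"
  have n2: "norm (omega\<^sup>2) = 1"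
    by (simp add: norm_power norm_omega)
  have cube: "((\<lambda>p. z powi ?N p * ?g p) has_sum
      fact r * (theta_fps z q ^ 3) $ r) UNIV" if z: "norm z = 1" for z
  proof -
    have "z \<noteq> 0" using z by auto
    then have e: "(\<lambda>(i, j, k). z powi i * z powi j * z powi k * weight3 q (i, j, k)) =
        (\<lambda>p. z powi ?N p * weight3 q p)"
      by (auto simp: fun_eq_iff power_int_add)
    have "theta_fps z q ^ 3 = moment_fps (\<lambda>p. z powi ?N p * weight3 q p) shift3"
      using theta_fps_mult3[OF z z z q] unfolding e by (simp add: power3_eq_cube mult.assoc)
    moreover have "moments_summable (\<lambda>p. z powi ?N p * weight3 q p) shift3"
      using moments_summable3[OF z z z q] unfolding e .
    ultimately show ?thesis
      by (auto simp: moment_fps_def moments_summable_def mult.assoc)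
  qed
  have s: "(\<lambda>p. ?g p) summable_on UNIV"
    using has_sum_imp_summable[OF cube[of 1]] by simp
  have lhs: "((\<lambda>p. 1 powi ?N p * ?g p +
      omega powi ?N p * ?g p +
      (omega\<^sup>2) powi ?N p * ?g p) has_sum
      (fact r * (theta_fps 1 q ^ 3) $ r + fact r * (theta_fps omega q ^ 3) $ r +
        fact r * (theta_fps (omega\<^sup>2) q ^ 3) $ r)) UNIV"
    by (intro has_sum_add cube norm_omega n2 norm_one)
  have eq: "(\<lambda>p. 1 powi ?N p * ?g p +
      omega powi ?N p * ?g p +
      (omega\<^sup>2) powi ?N p * ?g p) =
      (\<lambda>p. 3 * (if ?D p then ?g p else 0))"
    unfolding distrib_right[symmetric] sum_cube_roots_powi by (auto simp: fun_eq_iff)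
  have rhs: "((\<lambda>p. 3 * (if ?D p then ?g p else 0)) has_sum
      3 * (3 ^ r * theta_mom r 1 (q ^ 3) * theta_a q)) UNIV"
    using infsum_sublattice[OF q _ s, of "\<lambda>_ _. 1"]
    by (intro has_sum_cmult_right) (simp add: theta_a_eq flip: has_sum_sublattice_iff)
  have "fact r * (theta_fps 1 q ^ 3) $ r + fact r * (theta_fps omega q ^ 3) $ r +
        fact r * (theta_fps (omega\<^sup>2) q ^ 3) $ r = 3 * (3 ^ r * theta_mom r 1 (q ^ 3) * theta_a q)"
    using has_sum_unique[OF lhs[unfolded eq] rhs] .
  then show ?thesis
    by (simp add: theta_fps_nth field_simps)
qed

text \<open>Cyclic rotation preserves each residue class of i + j + k modulo 3. On the class r = 1
  or 2 it multiplies the sum by \<omega>^(2r), which is not 1, so the sum vanishes.\<close>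

lemma cyclic_has_sum_0:
  assumes s: "f summable_on (UNIV :: int3 set)"
    and eq: "\<And>i j k. \<not> 3 dvd i + j + k \<Longrightarrow> f (j, k, i) = omega powi (2 * (i + j + k)) * f (i, j, k)"
  shows "((\<lambda>p. if (case p of (i, j, k) \<Rightarrow> 3 dvd i + j + k) then 0 else f p) has_sum 0) UNIV"
proof -
  have part: "(f has_sum 0) {p. (case p of (i, j, k) \<Rightarrow> (i + j + k) mod 3 = r)}" (is "(f has_sum 0) ?A")
    if r: "r = 1 \<or> r = 2" for r
  proof -
    have sA: "f summable_on ?A"
      using s summable_on_subset_banach by blast
    have "bij_betw (\<lambda>(i, j, k). (j, k, i)) ?A ?A"
      by (rule bij_betw_byWitness[where f' = "\<lambda>(i, j, k). (k, i, j)"]) (auto simp: add_ac)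
    then have "infsum f ?A = infsum (\<lambda>p. f (case p of (i, j, k) \<Rightarrow> (j, k, i))) ?A"
      by (rule infsum_reindex_bij_betw[symmetric])
    also have "\<dots> = infsum (\<lambda>p. omega powi (2 * r) * f p) ?A"
    proof (intro infsum_cong)
      fix p assume "p \<in> ?A"
      then obtain i j k where p: "p = (i, j, k)" "(i + j + k) mod 3 = r"
        by auto
      then have "\<not> 3 dvd i + j + k"
        using r by presburger
      moreover have "2 * (i + j + k) mod 3 = 2 * r mod 3"
        using p(2) by (metis mod_mult_right_eq)
      ultimately show "f (case p of (i, j, k) \<Rightarrow> (j, k, i)) = omega powi (2 * r) * f p"
        unfolding p(1) prod.case eq[OF \<open>\<not> 3 dvd i + j + k\<close>] by (simp only: omega_powi_mod)
    qed
    also have "\<dots> = omega powi (2 * r) * infsum f ?A"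
      by (rule infsum_cmult_right')
    finally have "(1 - omega powi (2 * r)) * infsum f ?A = 0"
      by (simp add: algebra_simps)
    moreover have "omega powi (2 * r) \<noteq> 1"
      using r unfolding omega_powi_mod by (auto simp: omega_def complex_eq_iff power2_eq_square)
    ultimately show ?thesis
      using sA by (simp add: has_sum_iff)
  qed
  have "(f has_sum 0 + 0) ({p. (case p of (i, j, k) \<Rightarrow> (i + j + k) mod 3 = 1)} \<union>
      {p. (case p of (i, j, k) \<Rightarrow> (i + j + k) mod 3 = 2)})"
    by (intro has_sum_Un_disjoint part) auto
  moreover have "{p. (case p of (i, j, k) \<Rightarrow> (i + j + k) mod 3 = 1)} \<union>
      {p. (case p of (i, j, k) \<Rightarrow> (i + j + k) mod 3 = 2)} = {p :: int3. (case p of (i, j, k) \<Rightarrow> \<not> 3 dvd i + j + k)}"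
  proof -
    have "N mod 3 = 1 \<or> N mod 3 = 2 \<longleftrightarrow> \<not> 3 dvd N" for N :: int
      by presburger
    then show ?thesis
      by (auto simp: set_eq_iff)
  qed
  ultimately have "(f has_sum 0) {p. (case p of (i, j, k) \<Rightarrow> \<not> 3 dvd i + j + k)}"
    by simp
  moreover have "(f has_sum 0) {p. (case p of (i, j, k) \<Rightarrow> \<not> 3 dvd i + j + k)} \<longleftrightarrow>
      ((\<lambda>p. if (case p of (i, j, k) \<Rightarrow> 3 dvd i + j + k) then 0 else f p) has_sum 0) UNIV"
    by (rule has_sum_cong_neutral) auto
  ultimately show ?thesis by blast
qed

text \<open>A single product offers no sum over characters that filters the sublattice. The triples
  outside it cancel along cyclic orbits instead, because the weight \<omega>^(j + 2k) changes by a
  cube root of unity under rotation.\<close>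

lemma hesse_theta_identity:
  assumes q: "norm q < 1"
  shows "(theta_fps 1 q * (theta_fps omega q * theta_fps (omega\<^sup>2) q)) $ r =
    hesse_const q * 3 ^ r * theta_fps 1 (q ^ 3) $ r"
proof -
  let ?D = "\<lambda>p :: int3. case p of (i, j, k) \<Rightarrow> 3 dvd i + j + k"
  let ?w = "\<lambda>l m n. weight3 q (sublattice_index (l, m, n)) * shift3 (sublattice_index (l, m, n)) ^ r"
  let ?T = "theta_fps 1 q * (theta_fps omega q * theta_fps (omega\<^sup>2) q)"
  have w: "omega \<noteq> 0" using norm_omega by auto
  have n2: "norm (omega\<^sup>2) = 1"
    by (simp add: norm_power norm_omega)
  define c :: "int3 \<Rightarrow> complex" where "c = (\<lambda>(i, j, k). omega powi (j + 2 * k))"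
  define f where "f p = c p * (weight3 q p * shift3 p ^ r)" for p
  have e: "(\<lambda>(i, j, k). 1 powi i * omega powi j * (omega\<^sup>2) powi k * weight3 q (i, j, k)) = (\<lambda>p. c p * weight3 q p)"
    using w by (auto simp: fun_eq_iff c_def power_int_add power_int_mult)
  have "moments_summable (\<lambda>p. c p * weight3 q p) shift3"
    using moments_summable3[OF norm_one norm_omega n2 q] unfolding e .
  then have fs: "f summable_on UNIV"
    unfolding moments_summable_def f_def by (simp add: mult.assoc)
  have "?T = moment_fps (\<lambda>p. c p * weight3 q p) shift3"
    using theta_fps_mult3[OF norm_one norm_omega n2 q] unfolding e .
  then have "infsum f UNIV = fact r * ?T $ r"
    by (simp add: moment_fps_def f_def[abs_def] mult.assoc)
  with fs have f: "(f has_sum fact r * ?T $ r) UNIV"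
    by (simp add: has_sum_iff)
  have s: "(\<lambda>p. weight3 q p * shift3 p ^ r) summable_on UNIV"
    using moments_summable3[of 1 1 1 q] q by (auto simp: moments_summable_def)
  have "((\<lambda>p. if ?D p then 0 else f p) has_sum 0) UNIV"
  proof (rule cyclic_has_sum_0[OF fs])
    fix i j k :: int
    have "weight3 q (j, k, i) = weight3 q (i, j, k)" "shift3 (j, k, i) = shift3 (i, j, k)"
      by (simp_all add: weight3_def shift3_def)
    moreover have "c (j, k, i) = omega powi (2 * (i + j + k)) * c (i, j, k)"
    proof -
      have "(k + 2 * i) mod 3 = (2 * (i + j + k) + (j + 2 * k)) mod 3"
        by presburger
      then have "omega powi (k + 2 * i) = omega powi (2 * (i + j + k) + (j + 2 * k))"
        by (simp only: omega_powi_mod)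
      also have "\<dots> = omega powi (2 * (i + j + k)) * omega powi (j + 2 * k)"
        by (rule power_int_add) (use w in simp)
      finally show ?thesis
        by (simp only: c_def prod.case)
    qed
    ultimately show "f (j, k, i) = omega powi (2 * (i + j + k)) * f (i, j, k)"
      by (simp add: f_def)
  qed
  moreover have "((\<lambda>p. if ?D p then f p else 0) has_sum
      3 ^ r * theta_mom r 1 (q ^ 3) * hesse_const q) UNIV"
  proof -
    have "c (sublattice_index (l, m, n)) = omega powi (m - n)" for l m n
    proof -
      have "(l + n + 2 * (l - m - n)) mod 3 = (m - n) mod 3"
        by presburger
      then show ?thesis
        by (simp add: c_def sublattice_index_def omega_powi_mod)
    qed
    then have "(\<lambda>(l, m, n). f (sublattice_index (l, m, n))) =
        (\<lambda>(l, m, n). ?w l m n * omega powi (m - n))"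
      by (auto simp: fun_eq_iff f_def mult_ac)
    then show ?thesis
      using infsum_sublattice[OF q _ s, of "\<lambda>m n. omega powi (m - n)"]
      unfolding has_sum_sublattice_iff[symmetric] hesse_const_def by (simp add: norm_power_int norm_omega)
  qed
  ultimately have "((\<lambda>p. (if ?D p then 0 else f p) +
      (if ?D p then f p else 0)) has_sum
      0 + 3 ^ r * theta_mom r 1 (q ^ 3) * hesse_const q) UNIV"
    by (rule has_sum_add)
  moreover have "(\<lambda>p. (if ?D p then 0 else f p) +
      (if ?D p then f p else 0)) = f"
    by auto
  ultimately have "(f has_sum 3 ^ r * theta_mom r 1 (q ^ 3) * hesse_const q) UNIV"
    by simp
  from has_sum_unique[OF f this] show ?thesis
    by (simp add: theta_fps_nth field_simps)
qed

section \<open>Differential equations\<close>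

text \<open>\<open>T\<close> is the value of \<open>q df/dq\<close>.\<close>

definition has_qderiv :: "(complex \<Rightarrow> complex) \<Rightarrow> complex \<Rightarrow> complex \<Rightarrow> bool" where
  "has_qderiv f T q \<longleftrightarrow> (\<exists>D. (f has_field_derivative D) (at q) \<and> T = q * D)"

lemma has_qderivI: "(f has_field_derivative D) (at q) \<Longrightarrow> T = q * D \<Longrightarrow> has_qderiv f T q"
  by (auto simp: has_qderiv_def)

lemma has_qderiv_unique:
  assumes "has_qderiv f T q" "has_qderiv g S q" "norm q < 1" "\<And>x. norm x < 1 \<Longrightarrow> f x = g x"
  shows "T = S"
proof -
  obtain D D' where D: "(f has_field_derivative D) (at q)" "T = q * D"
    and D': "(g has_field_derivative D') (at q)" "S = q * D'"
    using assms(1,2) by (auto simp: has_qderiv_def)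
  have "(g has_field_derivative D) (at q)"
    by (rule has_field_derivative_transform_within_open[OF D(1), of "ball 0 1"]) (use assms(3,4) in auto)
  then have "D = D'" using D'(1) DERIV_unique by blast
  then show ?thesis using D(2) D'(2) by simp
qed

lemma has_qderiv_const: "has_qderiv (\<lambda>_. c) 0 q"
  by (rule has_qderivI[of _ 0]) auto

lemma has_qderiv_add: "has_qderiv f T q \<Longrightarrow> has_qderiv g S q \<Longrightarrow> has_qderiv (\<lambda>x. f x + g x) (T + S) q"
  unfolding has_qderiv_def by (metis DERIV_add distrib_left)

lemma has_qderiv_diff: "has_qderiv f T q \<Longrightarrow> has_qderiv g S q \<Longrightarrow> has_qderiv (\<lambda>x. f x - g x) (T - S) q"
  unfolding has_qderiv_def by (metis DERIV_diff right_diff_distrib)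

lemma has_qderiv_mult:
  assumes "has_qderiv f T q" "has_qderiv g S q"
  shows "has_qderiv (\<lambda>x. f x * g x) (T * g q + f q * S) q"
proof -
  obtain D D' where D: "(f has_field_derivative D) (at q)" "T = q * D"
    and D': "(g has_field_derivative D') (at q)" "S = q * D'"
    using assms(1,2) by (auto simp: has_qderiv_def)
  show ?thesis
    by (rule has_qderivI[OF DERIV_mult[OF D(1) D'(1)]]) (simp add: D(2) D'(2) algebra_simps)
qed

lemma has_qderiv_cmult: "has_qderiv f T q \<Longrightarrow> has_qderiv (\<lambda>x. c * f x) (c * T) q"
  using has_qderiv_mult[OF has_qderiv_const[of c]] by fastforce

lemma has_qderiv_power:
  assumes "has_qderiv f T q"
  shows "has_qderiv (\<lambda>x. f x ^ n) (of_nat n * f q ^ (n - 1) * T) q"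
proof -
  obtain D where D: "(f has_field_derivative D) (at q)" "T = q * D"
    using assms by (auto simp: has_qderiv_def)
  show ?thesis
    by (rule has_qderivI[OF DERIV_power[OF D(1)]]) (simp add: D(2) algebra_simps)
qed

lemma has_qderiv_divide:
  assumes "has_qderiv f T q" "has_qderiv g S q" "g q \<noteq> 0"
  shows "has_qderiv (\<lambda>x. f x / g x) ((T * g q - f q * S) / (g q * g q)) q"
proof -
  obtain D D' where D: "(f has_field_derivative D) (at q)" "T = q * D"
    and D': "(g has_field_derivative D') (at q)" "S = q * D'"
    using assms(1,2) by (auto simp: has_qderiv_def)
  show ?thesis
    by (rule has_qderivI[OF DERIV_divide[OF D(1) D'(1) assms(3)]]) (simp add: D(2) D'(2) algebra_simps)
qed

lemma has_qderiv_cube_arg: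
  assumes "has_qderiv f T (q ^ 3)"
  shows "has_qderiv (\<lambda>x. f (x ^ 3)) (3 * T) q"
proof -
  obtain D where D: "(f has_field_derivative D) (at (q ^ 3))" "T = q ^ 3 * D"
    using assms by (auto simp: has_qderiv_def)
  have "((\<lambda>x. x ^ 3) has_field_derivative 3 * q\<^sup>2) (at q)"
    by (auto intro!: derivative_eq_intros)
  from has_qderivI[OF DERIV_chain2[OF D(1) this]] show ?thesis
    by (simp add: D(2) power2_eq_square power3_eq_cube mult_ac)
qed

lemma has_qderiv_theta_mom:
  assumes "norm z = 1" "norm q < 1"
  shows "has_qderiv (theta_mom k z) ((theta_mom (k + 2) z q - theta_mom k z q / 4) / 2) q"
  using theta_mom_deriv[OF assms] has_qderivI by metis

lemma norm_cube_less_1: "norm q < 1 \<Longrightarrow> norm (q ^ 3 :: complex) < 1"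
  by (simp add: norm_power power_less_one_iff)

section \<open>Parity in u and values at the cube roots of unity\<close>

lemma theta_mom_reflect:
  assumes "norm z = 1"
  shows "theta_mom k (inverse z) q = - ((-1) ^ k * inverse z * theta_mom k z q)"
proof -
  have z: "z \<noteq> 0" using assms by auto
  have "bij_betw (\<lambda>n :: int. 1 - n) UNIV UNIV"
    by (rule bij_betw_byWitness[where f' = "\<lambda>n. 1 - n"]) auto
  then have "theta_mom k (inverse z) q =
      (\<Sum>\<^sub>\<infinity>n. theta_weight (inverse z) q (1 - n) * half_shift (1 - n) ^ k)"
    unfolding theta_mom_def by (rule infsum_reindex_bij_betw[symmetric])
  also have "\<dots> = (\<Sum>\<^sub>\<infinity>n. (- ((-1) ^ k * inverse z)) * (theta_weight z q n * half_shift n ^ k))"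
  proof (intro infsum_cong)
    fix n :: int
    have "half_shift (1 - n) = - half_shift n"
      by (simp add: half_shift_def)
    then have "half_shift (1 - n) ^ k = (-1) ^ k * half_shift n ^ k"
      by (metis power_minus)
    moreover have "(- inverse z) powi (1 - n) = - inverse z * (- z) powi n"
      using z by (simp add: power_int_diff power_int_inverse power_int_minus_left field_simps)
    ultimately show "theta_weight (inverse z) q (1 - n) * half_shift (1 - n) ^ k =
        (- ((-1) ^ k * inverse z)) * (theta_weight z q n * half_shift n ^ k)"
      by (simp add: theta_weight_def triangle_reflect)
  qed
  finally show ?thesis
    by (simp only: infsum_cmult_right' theta_mom_def) simp
qed

lemma theta_mom_1_even: "even k \<Longrightarrow> theta_mom k 1 q = 0"
  using theta_mom_reflect[of 1 k q] by (auto simp: eq_neg_iff_add_eq_0)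

lemma inverse_omega: "inverse omega = omega\<^sup>2"
  using omega_cubed by (intro inverse_unique) (simp add: power2_eq_square power3_eq_cube mult_ac)

lemma theta_fps_omega2: "theta_fps (omega\<^sup>2) q $ k = - ((-1) ^ k * omega\<^sup>2 * theta_fps omega q $ k)"
  using theta_mom_reflect[OF norm_omega, of k q] by (simp add: theta_fps_nth inverse_omega)

lemma fps_cube_nth:
  fixes A :: "'a :: comm_ring_1 fps"
  shows "(A ^ 3) $ 1 = 3 * (A $ 0)\<^sup>2 * A $ 1"
    "(A ^ 3) $ 3 = 3 * (A $ 0)\<^sup>2 * A $ 3 + 6 * A $ 0 * A $ 1 * A $ 2 + (A $ 1) ^ 3"
    "(A ^ 3) $ 5 = 3 * (A $ 0)\<^sup>2 * A $ 5 + 6 * A $ 0 * A $ 1 * A $ 4 + 6 * A $ 0 * A $ 2 * A $ 3 +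
       3 * (A $ 1)\<^sup>2 * A $ 3 + 3 * A $ 1 * (A $ 2)\<^sup>2"
  by (simp_all add: power3_eq_cube power2_eq_square fps_mult_nth eval_nat_numeral algebra_simps)

text \<open>Here B(u) = - c A(-u), so B^3(u) = - c^3 A^3(-u), which has the odd coefficients of A^3.
  Thus the cubes at \<omega> and \<omega>^2 contribute equally.\<close>

lemma fps_cube_odd_twist:
  fixes A B :: "'a :: comm_ring_1 fps"
  assumes c: "c ^ 3 = 1" and B: "\<And>k. B $ k = - ((-1) ^ k * c * A $ k)"
  shows "(B ^ 3) $ 1 = (A ^ 3) $ 1" "(B ^ 3) $ 3 = (A ^ 3) $ 3" "(B ^ 3) $ 5 = (A ^ 3) $ 5"
proof -
  have "(B ^ 3) $ 1 = c ^ 3 * (A ^ 3) $ 1" "(B ^ 3) $ 3 = c ^ 3 * (A ^ 3) $ 3" "(B ^ 3) $ 5 = c ^ 3 * (A ^ 3) $ 5"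
    unfolding fps_cube_nth B by (simp_all add: power3_eq_cube power2_eq_square algebra_simps)
  then show "(B ^ 3) $ 1 = (A ^ 3) $ 1" "(B ^ 3) $ 3 = (A ^ 3) $ 3" "(B ^ 3) $ 5 = (A ^ 3) $ 5"
    by (simp_all only: c mult_1_left)
qed

lemma fps_mult3_odd_nth:
  fixes A B C :: "'a :: comm_ring_1 fps"
  assumes "A $ 0 = 0" "A $ 2 = 0"
  shows "(A * (B * C)) $ 1 = A $ 1 * (B $ 0 * C $ 0)"
    "(A * (B * C)) $ 3 = A $ 1 * (B $ 0 * C $ 2 + B $ 1 * C $ 1 + B $ 2 * C $ 0) + A $ 3 * (B $ 0 * C $ 0)"
  using assms by (simp_all add: fps_mult_nth eval_nat_numeral algebra_simps)

lemma theta_mom_1_nonzero: "norm q < 1 \<Longrightarrow> theta_mom 1 1 q \<noteq> 0"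
  using theta_mom_jacobi euler_prod_nonzero by simp

lemma omega_neq_1: "omega \<noteq> 1"
  by (simp add: omega_def complex_eq_iff)

lemma theta_mom_omega_nonzero: "norm q < 1 \<Longrightarrow> theta_mom 0 omega q \<noteq> 0"
  using theta_mom_omega euler_prod_nonzero[OF norm_cube_less_1] omega_neq_1 by simp

lemma one_minus_omega_cubed: "(1 - omega) ^ 3 = - (3 * \<i> * sqrt 3)"
proof -
  have "sqrt 3 * sqrt 3 = 3" by simp
  then show ?thesis
    by (simp add: omega_def complex_eq_iff power3_eq_cube algebra_simps)
qed

text \<open>Both sides are multiples of the cube of the Euler product at q^3. This relation replaces
  the moments at q^3 in the cubic identities by moments at \<omega>.\<close>

lemma theta_mom_omega_cubed:
  assumes "norm q < 1"
  shows "theta_mom 0 omega q ^ 3 = 3 * \<i> * sqrt 3 * theta_mom 1 1 (q ^ 3)"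
  using theta_mom_omega[OF assms] theta_mom_jacobi[OF norm_cube_less_1[OF assms]]
  by (simp add: power_mult_distrib one_minus_omega_cubed)

section \<open>The differential system for x1, x2 and K\<close>

text \<open>Below, x1, x2, ... denote \<open>log_mom 1 q\<close>, \<open>log_mom 2 q\<close>, ...
  and K denotes \<open>theta_ratio q\<close>. Dividing by the zeroth moment removes the constant 1/4
  from the heat equation.\<close>

definition log_mom :: "nat \<Rightarrow> complex \<Rightarrow> complex" where
  "log_mom k q = theta_mom k omega q / theta_mom 0 omega q"

definition theta_ratio :: "complex \<Rightarrow> complex" where
  "theta_ratio q = theta_mom 1 1 q ^ 3 / theta_mom 0 omega q ^ 3"

lemma has_qderiv_log_mom:
  assumes "norm q < 1"
  shows "has_qderiv (log_mom k) ((log_mom (k + 2) q - log_mom k q * log_mom 2 q) / 2) q"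
proof -
  have eq: "((a - b / 4) / 2 * d - b * ((c - d / 4) / 2)) / (d * d) = (a / d - b / d * (c / d)) / 2"
    if "d \<noteq> 0" for a b c d :: complex
    using that by (simp add: divide_simps) (simp add: algebra_simps)
  have "has_qderiv (\<lambda>q. theta_mom k omega q / theta_mom 0 omega q)
    (((theta_mom (k + 2) omega q - theta_mom k omega q / 4) / 2 * theta_mom 0 omega q -
     theta_mom k omega q * ((theta_mom (0 + 2) omega q - theta_mom 0 omega q / 4) / 2)) /
     (theta_mom 0 omega q * theta_mom 0 omega q)) q"
    by (intro has_qderiv_divide has_qderiv_theta_mom norm_omega assms theta_mom_omega_nonzero)
  then show ?thesis
    unfolding eq[OF theta_mom_omega_nonzero[OF assms]] by (simp add: log_mom_def[abs_def] numeral_2_eq_2)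
qed

lemmas theta_a_moments = cubic_theta_identity[unfolded fps_add_nth]

lemma omega2_cubed: "(omega\<^sup>2) ^ 3 = 1"
  by (metis omega_cubed power_mult mult.commute power_one)

text \<open>The coefficient of u in the cubic identity: up to a constant, a is a logarithmic
  u-derivative of theta at \<omega>.\<close>

lemma theta_a_log_mom:
  assumes q: "norm q < 1"
  shows "theta_a q = 2 * \<i> * sqrt 3 * log_mom 1 q"
proof -
  have c: "theta_fps 1 q $ 0 = 0"
    by (simp add: theta_fps_nth theta_mom_1_even)
  have "2 * (3 * (theta_fps omega q $ 0)\<^sup>2 * theta_fps omega q $ 1) =
      9 * theta_a q * theta_fps 1 (q ^ 3) $ 1"
    using theta_a_moments[OF q, of 1]
    unfolding fps_cube_odd_twist(1)[OF omega2_cubed theta_fps_omega2]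
    unfolding fps_cube_nth c by simp
  then have "2 * theta_mom 0 omega q ^ 2 * theta_mom 1 omega q * (\<i> * sqrt 3) =
      theta_a q * theta_mom 0 omega q ^ 3"
    unfolding theta_mom_omega_cubed[OF q] by (simp add: theta_fps_nth algebra_simps)
  then show ?thesis
    using theta_mom_omega_nonzero[OF q]
    by (simp add: log_mom_def field_simps power2_eq_square power3_eq_cube)
qed

text \<open>Apply q d/dq to \<open>theta_mom_omega_cubed\<close> and replace q-derivatives by higher
  moments through the heat equation.\<close>

lemma theta_mom_cube_ratio:
  assumes q: "norm q < 1"
  shows "theta_mom 2 omega q * theta_mom 1 1 (q ^ 3) = theta_mom 0 omega q * theta_mom 3 1 (q ^ 3)"
    (is "?f2 * ?r1 = ?f0 * ?r3")
proof -
  note q3 = norm_cube_less_1[OF q]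
  have "3 * ?f0\<^sup>2 * ((?f2 - ?f0 / 4) / 2) = 3 * \<i> * sqrt 3 * (3 * ((?r3 - ?r1 / 4) / 2))"
  proof (rule has_qderiv_unique[OF _ _ q theta_mom_omega_cubed])
    show "has_qderiv (\<lambda>q. theta_mom 0 omega q ^ 3) (3 * ?f0\<^sup>2 * ((?f2 - ?f0 / 4) / 2)) q"
      using has_qderiv_power[OF has_qderiv_theta_mom[OF norm_omega q, of 0], of 3] by (simp add: numeral_2_eq_2)
    show "has_qderiv (\<lambda>q. 3 * \<i> * sqrt 3 * theta_mom 1 1 (q ^ 3)) (3 * \<i> * sqrt 3 * (3 * ((?r3 - ?r1 / 4) / 2))) q"
      using has_qderiv_cmult[OF has_qderiv_cube_arg[OF has_qderiv_theta_mom[OF norm_one q3, of 1]]]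
      by (simp add: numeral_3_eq_3)
  qed
  then have "?f0\<^sup>2 * (?f2 - ?f0 / 4) = (3 * \<i> * sqrt 3) * (?r3 - ?r1 / 4)"
    by simp
  then have "?f0 ^ 3 * (?f2 - ?f0 / 4) = (3 * \<i> * sqrt 3) * (?f0 * (?r3 - ?r1 / 4))"
    by (simp only: power3_eq_cube power2_eq_square mult_ac)
  then have "(3 * \<i> * sqrt 3) * (?r1 * (?f2 - ?f0 / 4)) = (3 * \<i> * sqrt 3) * (?f0 * (?r3 - ?r1 / 4))"
    unfolding theta_mom_omega_cubed[OF q] by (simp only: mult_ac)
  then have "?r1 * (?f2 - ?f0 / 4) = ?f0 * (?r3 - ?r1 / 4)"
    by simp
  then show ?thesis
    by (simp add: algebra_simps)
qed

text \<open>The q-derivative of \<open>theta_mom_cube_ratio\<close>, treated in the same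
  way.\<close>

lemma theta_mom_cube_ratio':
  assumes q: "norm q < 1"
  shows "theta_mom 4 omega q * theta_mom 1 1 (q ^ 3) + 2 * theta_mom 2 omega q * theta_mom 3 1 (q ^ 3) =
    3 * theta_mom 0 omega q * theta_mom 5 1 (q ^ 3)"
    (is "?f4 * ?r1 + 2 * ?f2 * ?r3 = 3 * ?f0 * ?r5")
proof -
  note q3 = norm_cube_less_1[OF q]
  have "(?f4 - ?f2 / 4) / 2 * ?r1 + ?f2 * (3 * ((?r3 - ?r1 / 4) / 2)) =
    (?f2 - ?f0 / 4) / 2 * ?r3 + ?f0 * (3 * ((?r5 - ?r3 / 4) / 2))"
  proof (rule has_qderiv_unique[OF _ _ q theta_mom_cube_ratio])
    show "has_qderiv (\<lambda>q. theta_mom 2 omega q * theta_mom 1 1 (q ^ 3))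
        ((?f4 - ?f2 / 4) / 2 * ?r1 + ?f2 * (3 * ((?r3 - ?r1 / 4) / 2))) q"
      using has_qderiv_mult[OF has_qderiv_theta_mom[OF norm_omega q, of 2]
        has_qderiv_cube_arg[OF has_qderiv_theta_mom[OF norm_one q3, of 1]]] by (simp add: eval_nat_numeral)
    show "has_qderiv (\<lambda>q. theta_mom 0 omega q * theta_mom 3 1 (q ^ 3))
        ((?f2 - ?f0 / 4) / 2 * ?r3 + ?f0 * (3 * ((?r5 - ?r3 / 4) / 2))) q"
      using has_qderiv_mult[OF has_qderiv_theta_mom[OF norm_omega q, of 0]
        has_qderiv_cube_arg[OF has_qderiv_theta_mom[OF norm_one q3, of 3]]] by (simp add: eval_nat_numeral)
  qed
  \<comment> \<open>Doubling the equation gives f4 r1 + 2 f2 r3 - 3 f0 r5 = f2 r1 - f0 r3, and the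
    right side vanishes by \<open>theta_mom_cube_ratio\<close>. The factor 2048 absorbs the
    denominators cleared by \<open>field_simps\<close>.\<close>
  then have "2048 * (?f4 * ?r1 + 2 * ?f2 * ?r3 - 3 * ?f0 * ?r5) = 2048 * (?f2 * ?r1 - ?f0 * ?r3)"
    by (simp add: field_simps)
  then have "2048 * (?f4 * ?r1 + 2 * ?f2 * ?r3 - 3 * ?f0 * ?r5) = 0"
    using theta_mom_cube_ratio[OF q] by (simp only: right_minus_eq mult_zero_right diff_self)
  then have "?f4 * ?r1 + 2 * ?f2 * ?r3 - 3 * ?f0 * ?r5 = 0"
    by (rule disjE[OF iffD1[OF mult_eq_0_iff]]) simp_all
  then show ?thesis
    by (rule iffD1[OF right_minus_eq])
qed

lemma
  assumes q: "norm q < 1"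
  shows theta_mom_cube_3: "theta_mom 3 1 (q ^ 3) = log_mom 2 q * theta_mom 1 1 (q ^ 3)"
    and theta_mom_cube_5: "3 * theta_mom 5 1 (q ^ 3) = (log_mom 4 q + 2 * (log_mom 2 q)\<^sup>2) * theta_mom 1 1 (q ^ 3)"
proof -
  show 1: "theta_mom 3 1 (q ^ 3) = log_mom 2 q * theta_mom 1 1 (q ^ 3)"
    using theta_mom_cube_ratio[OF q] theta_mom_omega_nonzero[OF q] by (simp add: log_mom_def field_simps)
  show "3 * theta_mom 5 1 (q ^ 3) = (log_mom 4 q + 2 * (log_mom 2 q)\<^sup>2) * theta_mom 1 1 (q ^ 3)"
    using theta_mom_cube_ratio'[OF q] theta_mom_omega_nonzero[OF q] unfolding 1
    by (simp add: log_mom_def field_simps power2_eq_square)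
qed

text \<open>The coefficients of u and u^3 in the product identity both carry
  \<open>hesse_const\<close>; eliminating it leaves a relation between moments at 1 and at
  \<omega>.\<close>

lemma theta_mom_3_ratio:
  assumes q: "norm q < 1"
  shows "theta_mom 3 1 q = (3 * log_mom 2 q + 6 * (log_mom 1 q)\<^sup>2) * theta_mom 1 1 q"
proof -
  let ?F = "theta_fps omega q" and ?P = "theta_fps 1 q" and ?R = "theta_fps 1 (q ^ 3)"
  have c: "?P $ 0 = 0" "?P $ 2 = 0"
    by (simp_all add: theta_fps_nth theta_mom_1_even)
  have w: "omega \<noteq> 0" using norm_omega by auto
  have h1: "?P $ 1 * (- (omega\<^sup>2) * (?F $ 0)\<^sup>2) = 3 * hesse_const q * ?R $ 1"
    using hesse_theta_identity[OF q, of 1] unfolding fps_mult3_odd_nth[OF c] theta_fps_omega2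
    by (simp add: power2_eq_square mult_ac)
  have h3: "?P $ 1 * (- (omega\<^sup>2) * (2 * ?F $ 0 * ?F $ 2 - (?F $ 1)\<^sup>2)) + ?P $ 3 * (- (omega\<^sup>2) * (?F $ 0)\<^sup>2) =
      27 * hesse_const q * ?R $ 3"
    using hesse_theta_identity[OF q, of 3] unfolding fps_mult3_odd_nth[OF c] theta_fps_omega2
    by (simp add: power2_eq_square algebra_simps)
  have r: "?R $ 3 = log_mom 2 q * ?R $ 1 / 6"
    using theta_mom_cube_3[OF q] by (simp add: theta_fps_nth fact_numeral)
  have F: "?F $ k = log_mom k q * theta_mom 0 omega q / fact k" for k
    using theta_mom_omega_nonzero[OF q] by (simp add: theta_fps_nth log_mom_def)
  have l0: "log_mom 0 q = 1"
    using theta_mom_omega_nonzero[OF q] by (simp add: log_mom_def)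
  have "27 * hesse_const q * ?R $ 3 = (3 / 2) * log_mom 2 q * (3 * hesse_const q * ?R $ 1)"
    by (simp add: r)
  then have "?P $ 1 * (- (omega\<^sup>2) * (2 * ?F $ 0 * ?F $ 2 - (?F $ 1)\<^sup>2)) + ?P $ 3 * (- (omega\<^sup>2) * (?F $ 0)\<^sup>2) =
      (3 / 2) * log_mom 2 q * (?P $ 1 * (- (omega\<^sup>2) * (?F $ 0)\<^sup>2))"
    unfolding h1 h3 .
  moreover have "?F $ 0 = theta_mom 0 omega q" "?F $ 1 = log_mom 1 q * theta_mom 0 omega q"
    "?F $ 2 = log_mom 2 q / 2 * theta_mom 0 omega q"
    by (simp_all add: F l0 fact_numeral)
  ultimately have "?P $ 1 * (- (omega\<^sup>2) * (2 * theta_mom 0 omega q * (log_mom 2 q / 2 * theta_mom 0 omega q) -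
      (log_mom 1 q * theta_mom 0 omega q)\<^sup>2)) + ?P $ 3 * (- (omega\<^sup>2) * (theta_mom 0 omega q)\<^sup>2) =
      (3 / 2) * log_mom 2 q * (?P $ 1 * (- (omega\<^sup>2) * (theta_mom 0 omega q)\<^sup>2))"
    by (simp only:)
  then have "(omega\<^sup>2 * (theta_mom 0 omega q)\<^sup>2) * (?P $ 1 * (log_mom 2 q - (log_mom 1 q)\<^sup>2) + ?P $ 3) =
      (omega\<^sup>2 * (theta_mom 0 omega q)\<^sup>2) * ((3 / 2) * log_mom 2 q * ?P $ 1)"
    by (simp add: power2_eq_square field_simps)
  then have "?P $ 1 * (log_mom 2 q - (log_mom 1 q)\<^sup>2) + ?P $ 3 = (3 / 2) * log_mom 2 q * ?P $ 1"
    using w theta_mom_omega_nonzero[OF q] by simp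
  then have "6 * (?P $ 1 * (log_mom 2 q - (log_mom 1 q)\<^sup>2) + ?P $ 3) = 6 * ((3 / 2) * log_mom 2 q * ?P $ 1)"
    by (simp only:)
  then show ?thesis
    by (simp add: theta_fps_nth fact_numeral algebra_simps)
qed

lemma has_qderiv_theta_ratio:
  assumes q: "norm q < 1"
  shows "has_qderiv theta_ratio (theta_ratio q * (3 * log_mom 2 q + 9 * (log_mom 1 q)\<^sup>2)) q"
proof -
  have eq: "(3 * p\<^sup>2 * (((3 * x2 + 6 * x1\<^sup>2) * p - p / 4) / 2) * d ^ 3 - p ^ 3 * (3 * d\<^sup>2 * ((x2 * d - d / 4) / 2))) / (d ^ 3 * d ^ 3) =
      p ^ 3 / d ^ 3 * (3 * x2 + 9 * x1\<^sup>2)" if "d \<noteq> 0" for p d x1 x2 :: complex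
  proof -
    have "3 * p\<^sup>2 * (((3 * x2 + 6 * x1\<^sup>2) * p - p / 4) / 2) * d ^ 3 - p ^ 3 * (3 * d\<^sup>2 * ((x2 * d - d / 4) / 2)) =
        d ^ 3 * (p ^ 3 * (3 * x2 + 9 * x1\<^sup>2))"
      by (simp add: field_simps power2_eq_square power3_eq_cube)
    then show ?thesis
      using that mult_divide_mult_cancel_left[of "d ^ 3" "p ^ 3 * (3 * x2 + 9 * x1\<^sup>2)" "d ^ 3"]
      by (simp only: power_eq_0_iff times_divide_eq_left) simp
  qed
  have 1: "has_qderiv (\<lambda>q. theta_mom 1 1 q ^ 3) (3 * (theta_mom 1 1 q)\<^sup>2 * ((theta_mom 3 1 q - theta_mom 1 1 q / 4) / 2)) q"
    using has_qderiv_power[OF has_qderiv_theta_mom[OF norm_one q, of 1], of 3] by (simp add: eval_nat_numeral)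
  have 2: "has_qderiv (\<lambda>q. theta_mom 0 omega q ^ 3) (3 * (theta_mom 0 omega q)\<^sup>2 * ((theta_mom 2 omega q - theta_mom 0 omega q / 4) / 2)) q"
    using has_qderiv_power[OF has_qderiv_theta_mom[OF norm_omega q, of 0], of 3] by (simp add: eval_nat_numeral)
  have f2: "theta_mom 2 omega q = log_mom 2 q * theta_mom 0 omega q"
    using theta_mom_omega_nonzero[OF q] by (simp add: log_mom_def)
  show ?thesis
    using has_qderiv_divide[OF 1 2] theta_mom_omega_nonzero[OF q]
    unfolding theta_mom_3_ratio[OF q] f2 eq[OF theta_mom_omega_nonzero[OF q]]
    by (simp add: theta_ratio_def[abs_def])
qed

lemma
  assumes q: "norm q < 1"
  shows theta_a_cube_3: "(theta_fps 1 q ^ 3) $ 3 + 2 * (theta_fps omega q ^ 3) $ 3 = 81 * theta_a q * theta_fps 1 (q ^ 3) $ 3"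
    and theta_a_cube_5: "(theta_fps 1 q ^ 3) $ 5 + 2 * (theta_fps omega q ^ 3) $ 5 = 729 * theta_a q * theta_fps 1 (q ^ 3) $ 5"
  using theta_a_moments[OF q, of 3] theta_a_moments[OF q, of 5]
  unfolding fps_cube_odd_twist[OF omega2_cubed theta_fps_omega2] by (simp_all add: algebra_simps)

lemma theta_a_theta_mom:
  assumes q: "norm q < 1"
  shows "3 * theta_a q * theta_mom 1 1 (q ^ 3) = 2 * log_mom 1 q * theta_mom 0 omega q ^ 3"
proof -
  have "complex_of_real (sqrt 3) * complex_of_real (sqrt 3) = 3"
    by (simp flip: of_real_mult)
  then have "(\<i> * sqrt 3) * (\<i> * sqrt 3) = (-3 :: complex)"
    by (simp add: mult_ac)
  then show ?thesis
    unfolding theta_a_log_mom[OF q] theta_mom_omega_cubed[OF q] by (simp add: mult_ac)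
qed

text \<open>The coefficient of u^3 in the cubic identity, divided by the cube of the zeroth moment
  at \<omega>; K enters through theta(1)^3, whose lowest term is cubic in u.\<close>

lemma log_mom_3:
  assumes q: "norm q < 1"
  shows "log_mom 3 q = 3 * log_mom 1 q * log_mom 2 q - 2 * log_mom 1 q ^ 3 - theta_ratio q"
proof -
  let ?F = "theta_fps omega q" and ?P = "theta_fps 1 q" and ?d = "theta_mom 0 omega q"
  have d: "?d \<noteq> 0" by (rule theta_mom_omega_nonzero[OF q])
  have F: "?F $ k = log_mom k q * ?d / fact k" for k
    using d by (simp add: theta_fps_nth log_mom_def)
  have l0: "log_mom 0 q = 1"
    using d by (simp add: log_mom_def)
  have c: "?P $ 0 = 0"
    by (simp add: theta_fps_nth theta_mom_1_even)
  have P: "(?P $ 1) ^ 3 = theta_ratio q * ?d ^ 3"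
    using d by (simp add: theta_fps_nth theta_ratio_def)
  have "81 * theta_a q * theta_fps 1 (q ^ 3) $ 3 = (9 / 2) * log_mom 2 q * (3 * theta_a q * theta_mom 1 1 (q ^ 3))"
    by (simp add: theta_fps_nth theta_mom_cube_3[OF q] fact_numeral)
  also have "\<dots> = 9 * log_mom 1 q * log_mom 2 q * ?d ^ 3"
    unfolding theta_a_theta_mom[OF q] by simp
  finally have "theta_ratio q * ?d ^ 3 + 2 * (?F ^ 3) $ 3 = 9 * log_mom 1 q * log_mom 2 q * ?d ^ 3"
    using theta_a_cube_3[OF q] P by (simp add: fps_cube_nth(2)[of ?P] c)
  moreover have "2 * (?F ^ 3) $ 3 = (log_mom 3 q + 6 * log_mom 1 q * log_mom 2 q + 2 * log_mom 1 q ^ 3) * ?d ^ 3"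
    unfolding fps_cube_nth F l0 by (simp add: fact_numeral power2_eq_square power3_eq_cube field_simps)
  ultimately have "?d ^ 3 * (theta_ratio q + (log_mom 3 q + 6 * log_mom 1 q * log_mom 2 q + 2 * log_mom 1 q ^ 3)) =
      ?d ^ 3 * (9 * log_mom 1 q * log_mom 2 q)"
    by (simp add: algebra_simps)
  then have "theta_ratio q + (log_mom 3 q + 6 * log_mom 1 q * log_mom 2 q + 2 * log_mom 1 q ^ 3) =
      9 * log_mom 1 q * log_mom 2 q"
    using d by simp
  then show ?thesis by (simp add: algebra_simps)
qed

text \<open>
  Comparing the coefficients of \<open>u\<^sup>5\<close> brings in \<open>log_mom 5\<close>, which is eliminated by differentiating
  \<open>log_mom_3\<close>. The resulting linear equation for \<open>log_mom 4\<close> has the leading coefficient \<open>14 log_mom 1\<close>.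
\<close>

lemma log_mom_4:
  assumes q: "norm q < 1" and nz: "log_mom 1 q \<noteq> 0"
  shows "log_mom 4 q = 3 * (log_mom 2 q)\<^sup>2 - 2 * log_mom 1 q ^ 4 + 2 * log_mom 1 q * theta_ratio q"
proof -
  let ?F = "theta_fps omega q" and ?P = "theta_fps 1 q" and ?d = "theta_mom 0 omega q"
  define x1 x2 x3 x4 x5 K where x: "x1 = log_mom 1 q" "x2 = log_mom 2 q" "x3 = log_mom 3 q" "x4 = log_mom 4 q"
    "x5 = log_mom 5 q" "K = theta_ratio q"
  have d: "?d \<noteq> 0" by (rule theta_mom_omega_nonzero[OF q])
  have F: "?F $ k = log_mom k q * ?d / fact k" for k
    using d by (simp add: theta_fps_nth log_mom_def)
  have l0: "log_mom 0 q = 1"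
    using d by (simp add: log_mom_def)
  have c: "?P $ 0 = 0" "?P $ 2 = 0"
    by (simp_all add: theta_fps_nth theta_mom_1_even)
  have x3: "x3 = 3 * x1 * x2 - 2 * x1 ^ 3 - K"
    unfolding x by (rule log_mom_3[OF q])
  have d1: "has_qderiv (\<lambda>q. 3 * log_mom 1 q * log_mom 2 q - 2 * log_mom 1 q ^ 3 - theta_ratio q)
     (3 * ((x3 - x1 * x2) / 2) * x2 + 3 * x1 * ((x4 - x2 * x2) / 2) -
      2 * (3 * x1\<^sup>2 * ((x3 - x1 * x2) / 2)) - K * (3 * x2 + 9 * x1\<^sup>2)) q"
    using has_qderiv_diff[OF has_qderiv_diff[OF has_qderiv_mult[OF has_qderiv_cmult[OF has_qderiv_log_mom[OF q, of 1], of 3]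
      has_qderiv_log_mom[OF q, of 2]] has_qderiv_cmult[OF has_qderiv_power[OF has_qderiv_log_mom[OF q, of 1], of 3], of 2]]
      has_qderiv_theta_ratio[OF q]]
    by (simp add: x eval_nat_numeral)
  have d3: "has_qderiv (log_mom 3) ((x5 - x3 * x2) / 2) q"
    using has_qderiv_log_mom[OF q, of 3] by (simp add: x eval_nat_numeral)
  have x5: "(x5 - x3 * x2) / 2 = 3 * ((x3 - x1 * x2) / 2) * x2 + 3 * x1 * ((x4 - x2 * x2) / 2) -
      2 * (3 * x1\<^sup>2 * ((x3 - x1 * x2) / 2)) - K * (3 * x2 + 9 * x1\<^sup>2)"
    by (rule has_qderiv_unique[OF d3 d1 q]) (rule log_mom_3)
  have "(?P ^ 3) $ 5 = 3 * (?P $ 1)\<^sup>2 * ?P $ 3"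
    unfolding fps_cube_nth c by simp
  also have "\<dots> = (1 / 2) * (3 * x2 + 6 * x1\<^sup>2) * (K * ?d ^ 3)"
    using d by (simp add: theta_fps_nth theta_mom_3_ratio[OF q] theta_ratio_def x fact_numeral power2_eq_square power3_eq_cube)
  finally have 1: "(?P ^ 3) $ 5 = (1 / 2) * (3 * x2 + 6 * x1\<^sup>2) * (K * ?d ^ 3)" .
  define Y where "Y k = log_mom k q / fact k" for k
  have FY: "?F $ k = Y k * ?d" for k
    by (simp add: F Y_def)
  have Y: "Y 0 = 1" "Y 1 = x1" "Y 2 = x2 / 2" "Y 3 = x3 / 6" "Y 4 = x4 / 24" "Y 5 = x5 / 120"
    by (simp_all add: Y_def x l0 fact_numeral)
  have "2 * (?F ^ 3) $ 5 = (6 * (Y 0)\<^sup>2 * Y 5 + 12 * Y 0 * Y 1 * Y 4 + 12 * Y 0 * Y 2 * Y 3 +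
      6 * (Y 1)\<^sup>2 * Y 3 + 6 * Y 1 * (Y 2)\<^sup>2) * ?d ^ 3"
    unfolding fps_cube_nth FY by (simp add: power2_eq_square power3_eq_cube algebra_simps)
  also have "\<dots> = (x5 / 20 + x1 * x4 / 2 + x2 * x3 + x1\<^sup>2 * x3 + 3 / 2 * x1 * x2\<^sup>2) * ?d ^ 3"
    unfolding Y by (simp add: power_divide)
  finally have 2: "2 * (?F ^ 3) $ 5 = (x5 / 20 + x1 * x4 / 2 + x2 * x3 + x1\<^sup>2 * x3 + 3 / 2 * x1 * x2\<^sup>2) * ?d ^ 3" .
  have "theta_mom 5 1 (q ^ 3) = (3 * theta_mom 5 1 (q ^ 3)) / 3"
    by simp
  also have "\<dots> = (x4 + 2 * x2\<^sup>2) * theta_mom 1 1 (q ^ 3) / 3"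
    unfolding theta_mom_cube_5[OF q] x ..
  finally have t5: "theta_mom 5 1 (q ^ 3) = (x4 + 2 * x2\<^sup>2) * theta_mom 1 1 (q ^ 3) / 3" .
  have r5: "theta_fps 1 (q ^ 3) $ 5 = (x4 + 2 * x2\<^sup>2) * theta_mom 1 1 (q ^ 3) / 360"
    unfolding theta_fps_nth t5 by (simp add: fact_numeral)
  have "729 * theta_a q * theta_fps 1 (q ^ 3) $ 5 = 27 / 40 * (x4 + 2 * x2\<^sup>2) * (3 * theta_a q * theta_mom 1 1 (q ^ 3))"
    unfolding r5 by simp
  also have "\<dots> = 27 / 20 * x1 * (x4 + 2 * x2\<^sup>2) * ?d ^ 3"
    unfolding theta_a_theta_mom[OF q] by (simp add: x)
  finally have "?d ^ 3 * ((1 / 2) * (3 * x2 + 6 * x1\<^sup>2) * K + (x5 / 20 + x1 * x4 / 2 + x2 * x3 + x1\<^sup>2 * x3 + 3 / 2 * x1 * x2\<^sup>2)) =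
      ?d ^ 3 * (27 / 20 * x1 * (x4 + 2 * x2\<^sup>2))"
    using theta_a_cube_5[OF q] unfolding 1 2 by (simp only: mult.commute[of "?d ^ 3"] distrib_right mult.assoc)
  then have e: "(1 / 2) * (3 * x2 + 6 * x1\<^sup>2) * K + (x5 / 20 + x1 * x4 / 2 + x2 * x3 + x1\<^sup>2 * x3 + 3 / 2 * x1 * x2\<^sup>2) =
      27 / 20 * x1 * (x4 + 2 * x2\<^sup>2)"
    using d by (simp only: mult_cancel_left power_eq_0_iff) simp
  have "10 * (3 * x2 + 6 * x1\<^sup>2) * K + x5 + 10 * x1 * x4 + 20 * x2 * x3 + 20 * x1\<^sup>2 * x3 + 30 * x1 * x2\<^sup>2 =
      20 * ((1 / 2) * (3 * x2 + 6 * x1\<^sup>2) * K + (x5 / 20 + x1 * x4 / 2 + x2 * x3 + x1\<^sup>2 * x3 + 3 / 2 * x1 * x2\<^sup>2))"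
    by (simp add: algebra_simps)
  also have "\<dots> = 27 * x1 * (x4 + 2 * x2\<^sup>2)"
    unfolding e by simp
  finally have e5: "10 * (3 * x2 + 6 * x1\<^sup>2) * K + x5 + 10 * x1 * x4 + 20 * x2 * x3 + 20 * x1\<^sup>2 * x3 + 30 * x1 * x2\<^sup>2 =
      27 * x1 * (x4 + 2 * x2\<^sup>2)" .
  have "x5 = x3 * x2 + 2 * ((x5 - x3 * x2) / 2)"
    by (simp add: field_simps)
  also have "\<dots> = x3 * x2 + 3 * (x3 - x1 * x2) * x2 + 3 * x1 * (x4 - x2 * x2) -
      6 * x1\<^sup>2 * (x3 - x1 * x2) - 2 * K * (3 * x2 + 9 * x1\<^sup>2)"
    unfolding x5 by (simp add: field_simps)
  finally have x5': "x5 = x3 * x2 + 3 * (x3 - x1 * x2) * x2 + 3 * x1 * (x4 - x2 * x2) -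
      6 * x1\<^sup>2 * (x3 - x1 * x2) - 2 * K * (3 * x2 + 9 * x1\<^sup>2)" .
  \<comment> \<open>The coefficient of x1 x4 is 27 - 10 - 3 = 14, where 3 comes from the expression
    for x5.\<close>
  have "14 * (x1 * (x4 - (3 * x2\<^sup>2 - 2 * x1 ^ 4 + 2 * x1 * K))) = 27 * x1 * (x4 + 2 * x2\<^sup>2) -
      (10 * (3 * x2 + 6 * x1\<^sup>2) * K + x5 + 10 * x1 * x4 + 20 * x2 * x3 + 20 * x1\<^sup>2 * x3 + 30 * x1 * x2\<^sup>2)"
    unfolding x5' x3 by (simp add: algebra_simps power2_eq_square power3_eq_cube power4_eq_xxxx)
  also have "\<dots> = 0"
    unfolding e5 by simp
  finally show ?thesis
    using nz by (simp add: x)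
qed

lemma theta_a_squared: "norm q < 1 \<Longrightarrow> (theta_a q)\<^sup>2 = - 12 * (log_mom 1 q)\<^sup>2"
proof -
  assume "norm q < 1"
  moreover have "(complex_of_real (sqrt 3))\<^sup>2 = 3"
    by (simp flip: of_real_power)
  ultimately show ?thesis
    by (simp add: theta_a_log_mom power_mult_distrib)
qed

definition theta_a_qderiv :: "complex \<Rightarrow> complex" where
  "theta_a_qderiv q = 2 * \<i> * sqrt 3 * (log_mom 1 q * log_mom 2 q - log_mom 1 q ^ 3 - theta_ratio q / 2)"

lemma has_qderiv_transfer:
  assumes "has_qderiv f T q" "norm q < 1" "\<And>x. norm x < 1 \<Longrightarrow> f x = g x"
  shows "has_qderiv g T q"
proof -
  obtain D where D: "(f has_field_derivative D) (at q)" "T = q * D"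
    using assms(1) by (auto simp: has_qderiv_def)
  have "(g has_field_derivative D) (at q)"
    by (rule has_field_derivative_transform_within_open[OF D(1), of "ball 0 1"]) (use assms(2,3) in auto)
  then show ?thesis using D(2) has_qderivI by blast
qed

lemma nat_1_add_2: "1 + 2 = (3 :: nat)"
  by simp

lemma has_qderiv_log_mom_1:
  assumes q: "norm q < 1"
  shows "has_qderiv (log_mom 1) (log_mom 1 q * log_mom 2 q - log_mom 1 q ^ 3 - theta_ratio q / 2) q"
proof -
  have "(log_mom (1 + 2) q - log_mom 1 q * log_mom 2 q) / 2 =
      log_mom 1 q * log_mom 2 q - log_mom 1 q ^ 3 - theta_ratio q / 2"
    unfolding nat_1_add_2 log_mom_3[OF q] by (simp add: field_simps)
  then show ?thesis
    using has_qderiv_log_mom[OF q, of 1] by (simp only:)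
qed

lemma has_qderiv_theta_a:
  assumes q: "norm q < 1"
  shows "has_qderiv theta_a (theta_a_qderiv q) q"
  unfolding theta_a_qderiv_def
  by (rule has_qderiv_transfer[OF has_qderiv_cmult[OF has_qderiv_log_mom_1[OF q]] q])
    (rule theta_a_log_mom[symmetric])

section \<open>The cubic modulus as a theta quotient and as an eta quotient\<close>

text \<open>In the notation of the Borweins this is \<open>c\<^sup>3/b\<^sup>3 = \<alpha>/(1 - \<alpha>)\<close>.\<close>

definition cubic_ratio :: "complex \<Rightarrow> complex" where
  "cubic_ratio q = - 1 - 8 * (theta_mom 1 omega q / theta_mom 1 1 q) ^ 3"

lemma cubic_ratio_eq:
  "norm q < 1 \<Longrightarrow> 1 + cubic_ratio q = - 8 * log_mom 1 q ^ 3 / theta_ratio q"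
  using theta_mom_omega_nonzero[of q] theta_mom_1_nonzero[of q]
  by (simp add: cubic_ratio_def log_mom_def theta_ratio_def field_simps)

lemma theta_ratio_nonzero: "norm q < 1 \<Longrightarrow> theta_ratio q \<noteq> 0"
  using theta_mom_omega_nonzero[of q] theta_mom_1_nonzero[of q]
  by (simp add: theta_ratio_def)

text \<open>In the derivative of x1^3 / K the terms with x2 cancel, and the remaining coefficient
  -12 x1^2 is a^2.\<close>

lemma has_qderiv_cubic_ratio:
  assumes q: "norm q < 1"
  shows "has_qderiv cubic_ratio ((theta_a q)\<^sup>2 * cubic_ratio q) q"
proof -
  note K = theta_ratio_nonzero[OF q]
  have 1: "has_qderiv (\<lambda>q. (- 8) * (log_mom 1 q ^ 3 / theta_ratio q) - 1)
    ((- 8) * ((of_nat 3 * log_mom 1 q ^ (3 - 1) * (log_mom 1 q * log_mom 2 q - log_mom 1 q ^ 3 - theta_ratio q / 2) * theta_ratio q -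
      log_mom 1 q ^ 3 * (theta_ratio q * (3 * log_mom 2 q + 9 * (log_mom 1 q)\<^sup>2))) / (theta_ratio q * theta_ratio q)) - 0) q"
    by (intro has_qderiv_diff has_qderiv_cmult has_qderiv_divide has_qderiv_power has_qderiv_log_mom_1 has_qderiv_theta_ratio
        has_qderiv_const q K)
  have c: "cubic_ratio q = - 8 * log_mom 1 q ^ 3 / theta_ratio q - 1"
    using cubic_ratio_eq[OF q] by (simp add: algebra_simps)
  have "(- 8) * ((3 * x1\<^sup>2 * (x1 * x2 - x1 ^ 3 - K / 2) * K - x1 ^ 3 * (K * (3 * x2 + 9 * x1\<^sup>2))) / (K * K)) - 0 =
      - 12 * x1\<^sup>2 * (- 8 * x1 ^ 3 / K - 1)" if "K \<noteq> 0" for x1 x2 K :: complex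
    using that by (simp add: field_simps power2_eq_square power3_eq_cube)
  note eq = this[OF K]
  have "has_qderiv (\<lambda>q. (- 8) * (log_mom 1 q ^ 3 / theta_ratio q) - 1) ((theta_a q)\<^sup>2 * cubic_ratio q) q"
    using 1 eq[of "log_mom 1 q" "log_mom 2 q"] unfolding theta_a_squared[OF q] c by simp
  then show ?thesis
  proof (rule has_qderiv_transfer[OF _ q])
    fix x :: complex assume "norm x < 1"
    then show "(- 8) * (log_mom 1 x ^ 3 / theta_ratio x) - 1 = cubic_ratio x"
      using cubic_ratio_eq[of x] by (simp add: algebra_simps)
  qed
qed

lemma theta_coeff_values:
  "theta_coeff 1 1 0 = - 1" "theta_coeff 1 1 1 = 3"
  "theta_coeff 1 omega 0 = omega\<^sup>2 / 2" "theta_coeff 1 omega 1 = 3 * omega\<^sup>2"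
proof -
  show "theta_coeff 1 1 0 = - 1" "theta_coeff 1 1 1 = 3"
    by (simp_all add: theta_coeff_def half_shift_def power_int_minus_left)
  have w2: "omega\<^sup>2 = - 1 - omega"
    using omega_sum by (simp add: algebra_simps eq_neg_iff_add_eq_0)
  show "theta_coeff 1 omega 0 = omega\<^sup>2 / 2"
    unfolding w2 by (simp add: theta_coeff_def half_shift_def field_simps)
  have "(- omega) powi (- 1) = - (omega\<^sup>2)"
    by (simp add: power_int_minus inverse_omega)
  moreover have "(- omega) powi 2 = omega\<^sup>2"
    by (simp add: power_int_def)
  ultimately show "theta_coeff 1 omega 1 = 3 * omega\<^sup>2"
    by (simp add: theta_coeff_def half_shift_def)
qed

lemma theta_mom_deriv_0:
  assumes "norm z = 1"
  shows "(theta_mom k z has_field_derivative theta_coeff k z 1) (at 0)"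
  using theta_mom_deriv[OF assms, of 0 k] by (metis norm_zero zero_less_one)

text \<open>The slope 27 determines the constant of integration in
  \<open>cubic_ratio_eta\<close>.\<close>

lemma cubic_ratio_0:
  "cubic_ratio 0 = 0" "(cubic_ratio has_field_derivative 27) (at 0)"
proof -
  have w6: "omega ^ 6 = 1"
    using power_mult[of omega 3 2] by (simp add: omega_cubed)
  have v: "theta_mom 1 omega 0 = omega\<^sup>2 / 2" "theta_mom 1 1 0 = - 1"
    using theta_mom_0[OF norm_omega, of 1] theta_mom_0[of 1 1] theta_coeff_values by simp_all
  show "cubic_ratio 0 = 0"
    unfolding cubic_ratio_def v by (simp add: power_divide power_mult_distrib w6 flip: power_mult)
  have "((\<lambda>q. - 1 - 8 * (theta_mom 1 omega q / theta_mom 1 1 q) ^ 3) has_field_derivative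
     (- (8 * (3 * (omega\<^sup>2 / 2 / - 1)\<^sup>2 * ((3 * omega\<^sup>2 * (- 1) - omega\<^sup>2 / 2 * 3) / ((- 1) * (- 1))))))) (at 0)"
    using theta_mom_deriv_0[OF norm_omega, of 1] theta_mom_deriv_0[of 1 1] unfolding theta_coeff_values
    by (auto intro!: derivative_eq_intros simp: v[unfolded One_nat_def])
  also have "- (8 * (3 * (omega\<^sup>2 / 2 / - 1)\<^sup>2 * ((3 * omega\<^sup>2 * (- 1) - omega\<^sup>2 / 2 * 3) / ((- 1) * (- 1))))) = 27 * omega ^ 6"
    by (simp add: power_divide eval_nat_numeral)
  finally show "(cubic_ratio has_field_derivative 27) (at 0)"
    by (simp add: w6 cubic_ratio_def[abs_def])
qed

text \<open>By Jacobi's identity (p/r)^4 is the quotient of the twelfth powers of the Euler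
  products. Then f = \<open>cubic_ratio\<close> * (p/r)^4 satisfies q f' = f, so f/q is constant on
  the punctured disc, with value f'(0) = 27.\<close>

lemma cubic_ratio_eta:
  assumes q: "norm q < 1"
  shows "cubic_ratio q = 27 * q * euler_prod (q ^ 3) ^ 12 / euler_prod q ^ 12"
proof -
  let ?p = "theta_mom 1 1"
  let ?r = "\<lambda>q :: complex. theta_mom 1 1 (q ^ 3)"
  let ?x1 = "log_mom 1"
  let ?x2 = "log_mom 2"
  define f where "f q = cubic_ratio q * (?p q ^ 4 / ?r q ^ 4)" for q
  have f: "has_qderiv f (f q) q" if q: "norm q < 1" for q
  proof -
    note q3 = norm_cube_less_1[OF q]
    have p0: "?p q \<noteq> 0" "?r q \<noteq> 0"
      using theta_mom_1_nonzero q q3 by auto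
    have p: "has_qderiv (theta_mom 1 1) (?p q * (3 * ?x2 q + 6 * (?x1 q)\<^sup>2 - 1 / 4) / 2) q"
    proof -
      have "(theta_mom (1 + 2) 1 q - ?p q / 4) / 2 = ?p q * (3 * ?x2 q + 6 * (?x1 q)\<^sup>2 - 1 / 4) / 2"
        unfolding nat_1_add_2 theta_mom_3_ratio[OF q] by (simp add: field_simps)
      then show ?thesis using has_qderiv_theta_mom[OF norm_one q, of 1] by (simp only:)
    qed
    have r: "has_qderiv (\<lambda>q. ?r q) (3 * (?r q * (?x2 q - 1 / 4) / 2)) q"
    proof -
      have "(theta_mom (1 + 2) 1 (q ^ 3) - ?r q / 4) / 2 = ?r q * (?x2 q - 1 / 4) / 2"
        unfolding nat_1_add_2 theta_mom_cube_3[OF q] by (simp add: field_simps)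
      then show ?thesis using has_qderiv_cube_arg[OF has_qderiv_theta_mom[OF norm_one q3, of 1]] by (simp only:)
    qed
    have "has_qderiv f ((theta_a q)\<^sup>2 * cubic_ratio q * (?p q ^ 4 / ?r q ^ 4) +
      cubic_ratio q * ((of_nat 4 * ?p q ^ (4 - 1) * (?p q * (3 * ?x2 q + 6 * (?x1 q)\<^sup>2 - 1 / 4) / 2) * ?r q ^ 4 -
        ?p q ^ 4 * (of_nat 4 * ?r q ^ (4 - 1) * (3 * (?r q * (?x2 q - 1 / 4) / 2)))) /
        (?r q ^ 4 * ?r q ^ 4))) q" (is "has_qderiv f ?T q")
      unfolding f_def
      by (intro has_qderiv_mult has_qderiv_divide has_qderiv_power has_qderiv_cubic_ratio p r q) (use p0 in simp)
    also have "?T = f q"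
    proof -
      have "- 12 * x1\<^sup>2 * c * (p ^ 4 / r ^ 4) + c * ((of_nat 4 * p ^ (4 - 1) * (p * (3 * x2 + 6 * x1\<^sup>2 - 1 / 4) / 2) * r ^ 4 -
         p ^ 4 * (of_nat 4 * r ^ (4 - 1) * (3 * (r * (x2 - 1 / 4) / 2)))) / (r ^ 4 * r ^ 4)) = c * (p ^ 4 / r ^ 4)"
        if "r \<noteq> 0" for x1 x2 c p r :: complex
      proof -
        have e1: "of_nat 4 * p ^ (4 - 1) * (p * (3 * x2 + 6 * x1\<^sup>2 - 1 / 4) / 2) * r ^ 4 - p ^ 4 * (of_nat 4 * r ^ (4 - 1) * (3 * (r * (x2 - 1 / 4) / 2))) =
            r ^ 4 * (p ^ 4 * (1 + 12 * x1\<^sup>2))"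
          by (simp add: field_simps power2_eq_square power3_eq_cube power4_eq_xxxx)
        have e2: "r ^ 4 * (p ^ 4 * (1 + 12 * x1\<^sup>2)) / (r ^ 4 * r ^ 4) = p ^ 4 * (1 + 12 * x1\<^sup>2) / r ^ 4"
          using that by (intro mult_divide_mult_cancel_left) simp
        show ?thesis
          unfolding e1 e2 by (simp add: add_divide_distrib algebra_simps)
      qed
      then show ?thesis
        unfolding f_def theta_a_squared[OF q] using p0(2) by blast
    qed
    finally show ?thesis .
  qed
  have f_div: "((\<lambda>x. f x / x) has_field_derivative 0) (at q)" if "q \<in> ball 0 1 - {0}" for q
  proof -
    have "norm q < 1"
      using that by simp
    from f[OF this] obtain D where "(f has_field_derivative D) (at q)" "f q = q * D"
      unfolding has_qderiv_def by auto
    then show ?thesis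
      using that by (auto intro!: derivative_eq_intros)
  qed
  have "connected (ball 0 1 - {0 :: complex})"
    by (rule connected_punctured_ball) simp
  then obtain c where c: "\<And>x. x \<in> ball 0 1 - {0} \<Longrightarrow> f x / x = c"
    using has_field_derivative_0_imp_constant_on[OF f_div] unfolding constant_on_def by (metis open_ball open_delete)
  have "f 0 = 0"
    by (simp add: f_def cubic_ratio_0)
  have p1: "?p 0 = - 1"
    using theta_mom_0[of 1 1] theta_coeff_values by simp
  have z3: "(0 :: complex) ^ 3 = 0"
    by simp
  have "(f has_field_derivative 27) (at 0)"
  proof -
    have p: "(?p has_field_derivative 3) (at (0 ^ 3))"
      using theta_mom_deriv_0[of 1 1] theta_coeff_values by simp
    have "((\<lambda>q. q ^ 3) has_field_derivative 0) (at (0 :: complex))"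
      by (auto intro!: derivative_eq_intros)
    from DERIV_chain2[OF p this]
    have r: "((\<lambda>q. ?r q) has_field_derivative 3 * 0) (at 0)" .
    have "?p (0 ^ 3) ^ 4 \<noteq> 0"
      using p1 by simp
    note DERIV_divide[OF DERIV_power[OF p[unfolded z3], of 4] DERIV_power[OF r, of 4] this]
    from DERIV_mult[OF cubic_ratio_0(2) this] show ?thesis
      by (simp add: f_def[abs_def] cubic_ratio_0(1) p1[unfolded One_nat_def])
  qed
  then have "((\<lambda>x. f x / x) \<longlongrightarrow> 27) (at 0)"
    using \<open>f 0 = 0\<close> by (simp add: DERIV_def)
  moreover have "((\<lambda>x. f x / x) \<longlongrightarrow> c) (at 0)"
  proof (rule Lim_transform_eventually[OF tendsto_const])
    show "\<forall>\<^sub>F x in at 0. c = f x / x"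
      unfolding eventually_at using c by (intro exI[of _ 1]) (auto simp: dist_norm)
  qed
  ultimately have "c = 27"
    using tendsto_unique trivial_limit_at by blast
  then have "f q = 27 * q"
    using c[of q] \<open>f 0 = 0\<close> q by (cases "q = 0") (auto simp: field_simps)
  moreover have "f q = cubic_ratio q * (euler_prod q ^ 12 / euler_prod (q ^ 3) ^ 12)"
    by (simp add: f_def theta_mom_jacobi[unfolded One_nat_def] q norm_cube_less_1[OF q] flip: power_mult)
  ultimately show ?thesis
    using euler_prod_nonzero[OF q] euler_prod_nonzero[OF norm_cube_less_1[OF q]] by (simp add: field_simps)
qed

text \<open>In the quotient of the twelfth eta powers the exponential prefactors leave 1/q, so a
  27th of the quotient is the reciprocal of \<open>cubic_ratio q\<close>.\<close>

lemma alpha_dagger_cubic_ratio: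
  assumes q: "norm q < 1" "q \<noteq> 0"
  shows "alpha_dagger q = cubic_ratio q / (1 + cubic_ratio q)"
proof -
  define \<tau> where "\<tau> = Ln q / (2 * of_real pi * \<i>)"
  have t: "2 * of_real pi * \<i> * \<tau> = Ln q"
    by (simp add: \<tau>_def)
  have q_eq: "exp (2 * of_real pi * \<i> * \<tau>) = q"
    unfolding t using q by simp
  have power: "exp (2 * of_real pi * \<i> * of_nat n * (of_nat k * \<tau>)) = (q ^ k) ^ n" for n k
  proof -
    have "2 * of_real pi * \<i> * of_nat n * (of_nat k * \<tau>) = of_nat (k * n) * (2 * of_real pi * \<i> * \<tau>)"
      by (simp add: algebra_simps)
    then show ?thesis
      unfolding t by (simp only: exp_of_nat_mult exp_Ln[OF q(2)] power_mult)
  qed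
  have eta: "dedekind_eta (of_nat k * \<tau>) ^ 12 = exp (of_real pi * \<i> * (of_nat k * \<tau>)) * euler_prod (q ^ k) ^ 12" for k
    unfolding dedekind_eta_def power euler_prod_def
    by (simp add: power_mult_distrib flip: exp_of_nat_mult)
  have e1: "dedekind_eta \<tau> ^ 12 = exp (of_real pi * \<i> * \<tau>) * euler_prod q ^ 12"
    using eta[of 1] by simp
  have e3: "dedekind_eta (3 * \<tau>) ^ 12 = exp (of_real pi * \<i> * \<tau>) * q * euler_prod (q ^ 3) ^ 12"
  proof -
    have "exp (of_real pi * \<i> * (3 * \<tau>)) = exp (of_real pi * \<i> * \<tau>) * exp (2 * of_real pi * \<i> * \<tau>)"
      by (simp add: exp_add[symmetric] algebra_simps)
    then show ?thesis
      using eta[of 3] by (simp add: q_eq)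
  qed
  have "1 / 27 * (dedekind_eta \<tau> ^ 12 / dedekind_eta (3 * \<tau>) ^ 12) = 1 / cubic_ratio q"
    unfolding e1 e3 cubic_ratio_eta[OF q(1)] by simp
  then have "alpha_dagger q = 1 / (1 + 1 / cubic_ratio q)"
    unfolding alpha_dagger_def Let_def \<tau>_def[symmetric] by simp
  moreover have "cubic_ratio q \<noteq> 0"
    using euler_prod_nonzero[OF q(1)] euler_prod_nonzero[OF norm_cube_less_1[OF q(1)]] q(2)
    by (simp add: cubic_ratio_eta[OF q(1)])
  moreover from this have "1 + 1 / cubic_ratio q = (1 + cubic_ratio q) / cubic_ratio q"
    by (simp add: field_simps)
  ultimately show ?thesis
    by simp
qed

definition cubic_alpha :: "complex \<Rightarrow> complex" where
  "cubic_alpha q = cubic_ratio q / (1 + cubic_ratio q)"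

text \<open>Both quantities are nonzero multiples of powers of x1, so \<open>cubic_alpha\<close> can
  be differentiated wherever a does not vanish.\<close>

lemma theta_a_eq_0_iff: "norm q < 1 \<Longrightarrow> theta_a q = 0 \<longleftrightarrow> 1 + cubic_ratio q = 0"
  by (simp add: theta_a_log_mom cubic_ratio_eq theta_ratio_nonzero)

lemma has_qderiv_cubic_alpha:
  assumes q: "norm q < 1" "theta_a q \<noteq> 0"
  shows "has_qderiv cubic_alpha ((theta_a q)\<^sup>2 * (cubic_alpha q * (1 - cubic_alpha q))) q"
proof -
  have nz: "1 + cubic_ratio q \<noteq> 0"
    using theta_a_eq_0_iff q by blast
  have "has_qderiv (\<lambda>q. cubic_ratio q / (1 + cubic_ratio q))
    (((theta_a q)\<^sup>2 * cubic_ratio q * (1 + cubic_ratio q) - cubic_ratio q * (0 + (theta_a q)\<^sup>2 * cubic_ratio q)) /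
      ((1 + cubic_ratio q) * (1 + cubic_ratio q))) q"
    by (intro has_qderiv_divide has_qderiv_add has_qderiv_const has_qderiv_cubic_ratio q nz)
  moreover have "((theta_a q)\<^sup>2 * cubic_ratio q * (1 + cubic_ratio q) - cubic_ratio q * (0 + (theta_a q)\<^sup>2 * cubic_ratio q)) /
      ((1 + cubic_ratio q) * (1 + cubic_ratio q)) = (theta_a q)\<^sup>2 * (cubic_alpha q * (1 - cubic_alpha q))"
    using nz by (simp add: cubic_alpha_def divide_simps) (simp add: algebra_simps)
  ultimately show ?thesis
    unfolding cubic_alpha_def[abs_def] by simp
qed

text \<open>The hypergeometric equation of \<open>\<^sub>2F\<^sub>1(1/3, 2/3; 1; \<alpha>)\<close>, with \<open>a\<^sup>2 \<alpha> (1 - \<alpha>) d/d\<alpha> = q d/dq\<close>.\<close>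

lemma has_qderiv_theta_a_ode:
  assumes q: "norm q < 1" "theta_a q \<noteq> 0"
  shows "has_qderiv (\<lambda>q. theta_a_qderiv q / (theta_a q)\<^sup>2)
    (2 / 9 * theta_a q ^ 3 * (cubic_alpha q * (1 - cubic_alpha q))) q"
proof -
  define x1 x2 K where x: "x1 = log_mom 1 q" "x2 = log_mom 2 q" "K = theta_ratio q"
  let ?d = "x1 * x2 - x1 ^ 3 - K / 2"
  define s :: complex where "s = 2 * \<i> * sqrt 3"
  have s2: "s\<^sup>2 = - 12"
    using theta_a_squared theta_a_log_mom
    by (simp add: s_def power_mult_distrib flip: of_real_power)
  have s0: "s \<noteq> 0" by (simp add: s_def)
  have x1: "x1 \<noteq> 0"
    using q theta_a_log_mom[OF q(1)] by (auto simp: x)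
  have K: "K \<noteq> 0"
    unfolding x by (rule theta_ratio_nonzero[OF q(1)])
  have x2': "has_qderiv (log_mom 2) (x2\<^sup>2 - x1 ^ 4 + x1 * K) q"
  proof -
    have "(log_mom (2 + 2) q - log_mom 2 q * log_mom 2 q) / 2 = x2\<^sup>2 - x1 ^ 4 + x1 * K"
      using log_mom_4[OF q(1)] x1 unfolding x by (simp add: power2_eq_square diff_divide_distrib add_divide_distrib)
    then show ?thesis
      using has_qderiv_log_mom[OF q(1), of 2] by (simp only:)
  qed
  note d1 = has_qderiv_log_mom_1[OF q(1), folded x]
  note dK = has_qderiv_theta_ratio[OF q(1), folded x]
  have "has_qderiv (\<lambda>q. s * (log_mom 1 q * log_mom 2 q - log_mom 1 q ^ 3 - 1 / 2 * theta_ratio q) / (s * log_mom 1 q)\<^sup>2)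
     ((s * (?d * log_mom 2 q + log_mom 1 q * (x2\<^sup>2 - x1 ^ 4 + x1 * K) -
        of_nat 3 * log_mom 1 q ^ (3 - 1) * ?d - 1 / 2 * (K * (3 * x2 + 9 * x1\<^sup>2))) * (s * log_mom 1 q)\<^sup>2 -
      s * (log_mom 1 q * log_mom 2 q - log_mom 1 q ^ 3 - 1 / 2 * theta_ratio q) *
        (of_nat 2 * (s * log_mom 1 q) ^ (2 - 1) * (s * ?d))) / ((s * log_mom 1 q)\<^sup>2 * (s * log_mom 1 q)\<^sup>2)) q"
    (is "has_qderiv ?f ?T q")
    by (intro has_qderiv_divide has_qderiv_cmult has_qderiv_diff has_qderiv_mult has_qderiv_power d1 x2' dK)
      (use s0 x1 x in auto)
  \<comment> \<open>Here x2 drops out, leaving an expression in x1 and K, that is, in a and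
    \<alpha>.\<close>
  also have "?T = (- 4 * K - K\<^sup>2 / (2 * x1 ^ 3)) / s"
  proof -
    have "?T = (s ^ 3 * x1 * (x1 * (?d * x2 + x1 * (x2\<^sup>2 - x1 ^ 4 + x1 * K) - 3 * x1\<^sup>2 * ?d - 1 / 2 * (K * (3 * x2 + 9 * x1\<^sup>2))) - 2 * ?d * ?d)) / (s ^ 3 * x1 * (s * x1 ^ 3))"
      unfolding x[symmetric] by (rule arg_cong2[of _ _ _ _ "(/)"])
        (simp_all add: power2_eq_square power3_eq_cube power4_eq_xxxx algebra_simps)
    also have "\<dots> = (x1 * (?d * x2 + x1 * (x2\<^sup>2 - x1 ^ 4 + x1 * K) - 3 * x1\<^sup>2 * ?d - 1 / 2 * (K * (3 * x2 + 9 * x1\<^sup>2))) - 2 * ?d * ?d) / (s * x1 ^ 3)"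
      using s0 x1 by (intro mult_divide_mult_cancel_left) simp
    also have "x1 * (?d * x2 + x1 * (x2\<^sup>2 - x1 ^ 4 + x1 * K) - 3 * x1\<^sup>2 * ?d - 1 / 2 * (K * (3 * x2 + 9 * x1\<^sup>2))) - 2 * ?d * ?d =
        - 4 * K * x1 ^ 3 - K\<^sup>2 / 2"
      by (simp add: field_simps power2_eq_square power3_eq_cube power4_eq_xxxx)
    also have "(- 4 * K * x1 ^ 3 - K\<^sup>2 / 2) / (s * x1 ^ 3) = (- 4 * K - K\<^sup>2 / (2 * x1 ^ 3)) / s"
      using s0 x1 by (simp add: field_simps)
    finally show ?thesis .
  qed
  also have "\<dots> = 2 / 9 * theta_a q ^ 3 * (cubic_alpha q * (1 - cubic_alpha q))"
  proof -
    have c: "cubic_ratio q = - 8 * x1 ^ 3 / K - 1"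
      using cubic_ratio_eq[OF q(1)] by (simp add: x algebra_simps)
    have "cubic_alpha q = 1 + K / (8 * x1 ^ 3)"
      unfolding cubic_alpha_def c using K x1 by (simp add: field_simps)
    then have al: "cubic_alpha q * (1 - cubic_alpha q) = - (1 + K / (8 * x1 ^ 3)) * (K / (8 * x1 ^ 3))"
      by (simp add: algebra_simps)
    have a3: "theta_a q ^ 3 = s\<^sup>2 * s\<^sup>2 * x1 ^ 3 / s"
      using theta_a_log_mom[OF q(1)] s0 by (simp add: s_def[symmetric] x power_mult_distrib power2_eq_square power3_eq_cube)
    show ?thesis
      unfolding al a3 s2 using s0 x1 by (simp add: field_simps power2_eq_square power3_eq_cube)
  qed
  finally show ?thesis
  proof (rule has_qderiv_transfer[OF _ q(1)])
    fix x :: complex assume "norm x < 1"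
    then show "?f x = theta_a_qderiv x / (theta_a x)\<^sup>2"
      by (simp add: theta_a_qderiv_def theta_a_log_mom s_def)
  qed
qed

section \<open>Clausen's formula\<close>

definition fps_theta :: "'a :: comm_ring_1 fps \<Rightarrow> 'a fps" where
  "fps_theta f = fps_X * fps_deriv f"

lemma fps_theta_nth: "fps_theta f $ n = of_nat n * f $ n"
  by (cases n) (simp_all add: fps_theta_def)

lemma fps_theta_add: "fps_theta (f + g) = fps_theta f + fps_theta g"
  and fps_theta_mult: "fps_theta (f * g) = fps_theta f * g + f * fps_theta g"
  and fps_theta_const: "fps_theta (fps_const c) = 0"
  and fps_theta_numeral: "fps_theta (numeral w) = 0"
  and fps_theta_X: "fps_theta fps_X = fps_X"
  by (simp_all add: fps_theta_def algebra_simps numeral_fps_const)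

text \<open>The series 2F1(1/6, 1/3; 1; x): the quadratic substitution x = 4 \<alpha> (1 - \<alpha>)
  halves the parameters of 2F1(1/3, 2/3; 1; \<alpha>).\<close>

definition hyp_2F1 :: "complex fps" where
  "hyp_2F1 = Abs_fps (\<lambda>n. pochhammer (1/6) n * pochhammer (1/3) n / fact n ^ 2)"

definition hyp_3F2 :: "complex fps" where
  "hyp_3F2 = Abs_fps (\<lambda>n. pochhammer (1/2) n * pochhammer (1/3) n * pochhammer (2/3) n / fact n ^ 3)"

lemma hyp_2F1_Suc:
  "of_nat (Suc n) ^ 2 * hyp_2F1 $ Suc n = (of_nat n + 1/6) * (of_nat n + 1/3) * hyp_2F1 $ n"
proof -
  have "(of_nat (Suc n) :: complex) \<noteq> 0" by (simp only: of_nat_eq_0_iff)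
  then show ?thesis
    by (simp add: hyp_2F1_def pochhammer_Suc power2_eq_square divide_simps del: of_nat_Suc) (simp add: algebra_simps)
qed

lemma hyp_3F2_Suc:
  "of_nat (Suc n) ^ 3 * hyp_3F2 $ Suc n = (of_nat n + 1/2) * (of_nat n + 1/3) * (of_nat n + 2/3) * hyp_3F2 $ n"
proof -
  have "(of_nat (Suc n) :: complex) \<noteq> 0" by (simp only: of_nat_eq_0_iff)
  then show ?thesis
    by (simp add: hyp_3F2_def pochhammer_Suc power3_eq_cube divide_simps del: of_nat_Suc) (simp add: algebra_simps)
qed

lemma hyp_2F1_ode:
  defines "y \<equiv> hyp_2F1"
  defines "y1 \<equiv> fps_theta y"
  defines "y2 \<equiv> fps_theta y1"
  shows "y2 = fps_X * (y2 + fps_const (1/2) * y1 + fps_const (1/18) * y)"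
proof (rule fps_ext)
  fix n
  show "y2 $ n = (fps_X * (y2 + fps_const (1/2) * y1 + fps_const (1/18) * y)) $ n"
  proof (cases n)
    case (Suc m)
    have "y2 $ n = of_nat (Suc m) ^ 2 * hyp_2F1 $ Suc m"
      by (simp add: Suc y2_def y1_def y_def fps_theta_nth power2_eq_square)
    also have "\<dots> = of_nat m * (of_nat m * hyp_2F1 $ m) + 1/2 * (of_nat m * hyp_2F1 $ m) + 1/18 * hyp_2F1 $ m"
      unfolding hyp_2F1_Suc by (simp add: field_simps)
    finally show ?thesis
      by (simp add: Suc y2_def y1_def y_def fps_theta_nth)
  qed (simp add: y2_def fps_theta_nth)
qed

text \<open>The coefficients of both sides satisfy the same first-order recurrence.\<close>

lemma clausen: "hyp_3F2 = hyp_2F1 ^ 2"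
proof (rule fps_ext)
  define y where "y = hyp_2F1"
  define y1 where "y1 = fps_theta y"
  define y2 where "y2 = fps_theta y1"
  define y3 where "y3 = fps_theta y2"
  define z where "z = y ^ 2"
  define z1 where "z1 = fps_theta z"
  define z2 where "z2 = fps_theta z1"
  define z3 where "z3 = fps_theta z2"
  let ?X = "fps_X :: complex fps"
  let ?c = "fps_const :: complex \<Rightarrow> _"
  have y2: "y2 = ?X * (y2 + ?c (1/2) * y1 + ?c (1/18) * y)"
    using hyp_2F1_ode by (simp add: y2_def y1_def y_def)
  have "y3 = fps_theta (?X * (y2 + ?c (1/2) * y1 + ?c (1/18) * y))"
    unfolding y3_def using y2 by (rule arg_cong)
  also have "\<dots> = ?X * (y2 + ?c (1/2) * y1 + ?c (1/18) * y) + ?X * (y3 + ?c (1/2) * y2 + ?c (1/18) * y1)"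
    by (simp add: fps_theta_mult fps_theta_add fps_theta_const fps_theta_X y3_def[symmetric] y2_def[symmetric] y1_def[symmetric])
  finally have y3: "y3 = ?X * (y2 + ?c (1/2) * y1 + ?c (1/18) * y) + ?X * (y3 + ?c (1/2) * y2 + ?c (1/18) * y1)" .
  have z1: "z1 = 2 * y * y1"
    by (simp add: z1_def z_def power2_eq_square fps_theta_mult fps_theta_numeral y1_def algebra_simps)
  have z2: "z2 = 2 * (y1 * y1 + y * y2)"
    unfolding z2_def z1 by (simp add: fps_theta_mult y1_def y2_def fps_theta_numeral fps_theta_add algebra_simps)
  have z3: "z3 = 2 * (3 * (y1 * y2) + y * y3)"
    unfolding z3_def z2 by (simp add: fps_theta_mult y3_def y2_def[symmetric] y1_def[symmetric] fps_theta_numeral fps_theta_add algebra_simps)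
  have z3_ode: "z3 = ?X * (z3 + ?c (3/2) * z2 + ?c (13/18) * z1 + ?c (1/9) * z)"
  proof -
    have c: "?c (3/2) = 27 * ?c (1/18)" "?c (13/18) = 13 * ?c (1/18)" "?c (1/9) = 2 * ?c (1/18)" "?c (1/2) = 9 * ?c (1/18)"
      by (simp_all add: numeral_fps_const)
    \<comment> \<open>With 1/18 kept as a symbol, the products of series combine by pure ring
      algebra up to a multiple of 1 - 18 k, which is 0.\<close>
    define k where "k = ?c (1/18)"
    have k: "18 * k = 1" by (simp add: k_def numeral_fps_const)
    have "z3 - ?X * z3 = 6 * y1 * (y2 - ?X * y2) + 2 * y * (y3 - ?X * y3)"
      unfolding z3 by (simp add: algebra_simps)
    also have "y2 - ?X * y2 = ?X * (9 * k * y1 + k * y)"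
      using y2 unfolding c k_def[symmetric] by (simp add: algebra_simps)
    also have "y3 - ?X * y3 = ?X * (y2 + 9 * k * y1 + k * y) + ?X * (9 * k * y2 + k * y1)"
      using y3 unfolding c k_def[symmetric] by (simp add: algebra_simps)
    also have "6 * y1 * (?X * (9 * k * y1 + k * y)) + 2 * y * (?X * (y2 + 9 * k * y1 + k * y) + ?X * (9 * k * y2 + k * y1)) =
      ?X * (27 * k * z2 + 13 * k * z1 + 2 * k * z) + 2 * ?X * (1 - 18 * k) * (y * y2)"
      unfolding z2 z1 z_def by (simp add: algebra_simps power2_eq_square)
    finally show ?thesis
      unfolding c k_def[symmetric] k by (simp add: algebra_simps)
  qed
  have rec: "of_nat (Suc n) ^ 3 * z $ Suc n = (of_nat n + 1/2) * (of_nat n + 1/3) * (of_nat n + 2/3) * z $ n" for n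
  proof -
    have "of_nat (Suc n) ^ 3 * z $ Suc n = z3 $ Suc n"
      by (simp add: z3_def z2_def z1_def fps_theta_nth power3_eq_cube)
    also have "\<dots> = (?X * (z3 + ?c (3/2) * z2 + ?c (13/18) * z1 + ?c (1/9) * z)) $ Suc n"
      using z3_ode by (rule arg_cong)
    also have "\<dots> = of_nat n ^ 3 * z $ n + 3/2 * (of_nat n ^ 2 * z $ n) + 13/18 * (of_nat n * z $ n) + 1/9 * z $ n"
      by (simp add: z3_def z2_def z1_def fps_theta_nth power3_eq_cube power2_eq_square)
    also have "\<dots> = (of_nat n + 1/2) * (of_nat n + 1/3) * (of_nat n + 2/3) * z $ n"
      by (simp add: field_simps power3_eq_cube power2_eq_square)
    finally show ?thesis .
  qed
  fix n show "hyp_3F2 $ n = (hyp_2F1 ^ 2) $ n"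
    unfolding y_def[symmetric] z_def[symmetric]
  proof (induction n)
    case 0
    show ?case by (simp add: z_def y_def power2_eq_square hyp_2F1_def hyp_3F2_def)
  next
    case (Suc n)
    have "(of_nat (Suc n) :: complex) ^ 3 \<noteq> 0"
      by (simp only: power_eq_0_iff of_nat_eq_0_iff) simp
    moreover have "of_nat (Suc n) ^ 3 * hyp_3F2 $ Suc n = of_nat (Suc n) ^ 3 * z $ Suc n"
      unfolding hyp_3F2_Suc rec Suc ..
    ultimately show ?case by (simp only: mult_cancel_left) simp
  qed
qed

section \<open>Evaluation of the hypergeometric series in the unit disc\<close>

lemma conv_radius_bounded_coeffs:
  fixes f :: "complex fps"
  assumes "\<And>n. norm (f $ n) \<le> 1"
  shows "1 \<le> fps_conv_radius f"
  unfolding fps_conv_radius_def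
proof (rule conv_radius_geI_ex)
  fix r :: real assume r: "0 < r" "ereal r < 1"
  have "summable (\<lambda>n. f $ n * of_real r ^ n)"
  proof (rule summable_comparison_test')
    show "summable (\<lambda>n. r ^ n)" using r by (simp add: summable_geometric)
    show "norm (f $ n * of_real r ^ n) \<le> r ^ n" for n
      using assms[of n] r by (simp add: norm_mult norm_power mult_left_le_one_le)
  qed
  then show "\<exists>z. norm z = r \<and> summable (\<lambda>n. f $ n * z ^ n)"
    using r by (intro exI[of _ "of_real r"]) auto
qed

lemma norm_pochhammer_le:
  fixes c :: real
  assumes "0 \<le> c" "c \<le> 1"
  shows "norm (pochhammer (of_real c :: complex) n) \<le> fact n"
proof -
  have "norm (pochhammer (of_real c :: complex) n) = \<bar>pochhammer c n\<bar>"
    by (metis norm_of_real pochhammer_of_real real_norm_def)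
  also have "\<bar>pochhammer c n\<bar> \<le> fact n"
  proof (induction n)
    case (Suc n)
    have "\<bar>pochhammer c (Suc n)\<bar> = \<bar>pochhammer c n\<bar> * (c + real n)"
      using assms by (simp add: pochhammer_Suc abs_mult)
    also have "\<dots> \<le> fact n * (1 + real n)"
      using Suc assms by (intro mult_mono) auto
    finally show ?case by (simp add: mult.commute)
  qed simp
  finally show ?thesis .
qed

lemma hyp_conv_radius: "1 \<le> fps_conv_radius hyp_2F1" "1 \<le> fps_conv_radius hyp_3F2"
proof -
  have p: "norm (pochhammer (1/6 :: complex) n) \<le> fact n" "norm (pochhammer (1/3 :: complex) n) \<le> fact n"
    "norm (pochhammer (1/2 :: complex) n) \<le> fact n" "norm (pochhammer (2/3 :: complex) n) \<le> fact n" for n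
    using norm_pochhammer_le[of "1/6" n] norm_pochhammer_le[of "1/3" n] norm_pochhammer_le[of "1/2" n] norm_pochhammer_le[of "2/3" n]
    by simp_all
  show "1 \<le> fps_conv_radius hyp_2F1"
  proof (rule conv_radius_bounded_coeffs)
    fix n
    have "norm (pochhammer (1/6 :: complex) n) * norm (pochhammer (1/3 :: complex) n) \<le> fact n * fact n"
      by (intro mult_mono p) auto
    then show "norm (hyp_2F1 $ n) \<le> 1"
      by (simp add: hyp_2F1_def norm_mult norm_divide norm_power power2_eq_square)
  qed
  show "1 \<le> fps_conv_radius hyp_3F2"
  proof (rule conv_radius_bounded_coeffs)
    fix n
    have "norm (pochhammer (1/2 :: complex) n) * norm (pochhammer (1/3 :: complex) n) * norm (pochhammer (2/3 :: complex) n) \<le> fact n * fact n * fact n"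
      by (intro mult_mono p mult_nonneg_nonneg) auto
    then show "norm (hyp_3F2 $ n) \<le> 1"
      by (simp add: hyp_3F2_def norm_mult norm_divide norm_power power3_eq_cube)
  qed
qed

lemma fps_conv_radius_theta:
  fixes f :: "complex fps"
  assumes "1 \<le> fps_conv_radius f"
  shows "1 \<le> fps_conv_radius (fps_theta f)"
proof -
  have "1 \<le> min (fps_conv_radius (fps_X :: complex fps)) (fps_conv_radius (fps_deriv f))"
    using assms fps_conv_radius_deriv[of f] by (simp add: order_trans)
  also have "\<dots> \<le> fps_conv_radius (fps_theta f)"
    unfolding fps_theta_def by (rule fps_conv_radius_mult)
  finally show ?thesis .
qed

lemma norm_less_conv_radius:
  fixes f :: "complex fps"
  shows "1 \<le> fps_conv_radius f \<Longrightarrow> norm z < 1 \<Longrightarrow> ereal (norm z) < fps_conv_radius f"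
  by (metis ereal_less(3) less_le_trans)

lemma
  fixes f :: "complex fps"
  assumes "1 \<le> fps_conv_radius f" "norm z < 1"
  shows eval_fps_has_deriv: "(eval_fps f has_field_derivative eval_fps (fps_deriv f) z) (at z)"
    and eval_fps_theta: "eval_fps (fps_theta f) z = z * eval_fps (fps_deriv f) z"
proof -
  have r: "ereal (norm z) < fps_conv_radius f" "ereal (norm z) < fps_conv_radius (fps_deriv f)"
    using norm_less_conv_radius assms fps_conv_radius_deriv[of f] order_trans by blast+
  show "(eval_fps f has_field_derivative eval_fps (fps_deriv f) z) (at z)"
    by (rule has_field_derivative_eval_fps[OF r(1)])
  show "eval_fps (fps_theta f) z = z * eval_fps (fps_deriv f) z"
    unfolding fps_theta_def using r(2) by (subst eval_fps_mult) auto
qed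

definition Y0 :: "complex \<Rightarrow> complex" where "Y0 = eval_fps hyp_2F1"
definition Y1 :: "complex \<Rightarrow> complex" where "Y1 = eval_fps (fps_theta hyp_2F1)"
definition Y2 :: "complex \<Rightarrow> complex" where "Y2 = eval_fps (fps_theta (fps_theta hyp_2F1))"

lemma
  assumes "norm z < 1"
  shows Y0_deriv: "\<exists>D. (Y0 has_field_derivative D) (at z) \<and> z * D = Y1 z"
    and Y1_deriv: "\<exists>D. (Y1 has_field_derivative D) (at z) \<and> z * D = Y2 z"
    and Y_ode: "(1 - z) * Y2 z = z * (Y1 z / 2 + Y0 z / 18)"
proof -
  note r0 = hyp_conv_radius(1)
  note r1 = fps_conv_radius_theta[OF r0]
  note r2 = fps_conv_radius_theta[OF r1]
  note n = norm_less_conv_radius[OF _ assms]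
  show "\<exists>D. (Y0 has_field_derivative D) (at z) \<and> z * D = Y1 z"
    using eval_fps_has_deriv[OF r0 assms] eval_fps_theta[OF r0 assms] unfolding Y0_def Y1_def by auto
  show "\<exists>D. (Y1 has_field_derivative D) (at z) \<and> z * D = Y2 z"
    using eval_fps_has_deriv[OF r1 assms] eval_fps_theta[OF r1 assms] unfolding Y1_def Y2_def by auto
  let ?g = "\<lambda>c f. fps_const c * f :: complex fps"
  have c: "1 \<le> fps_conv_radius (?g c f)" if "1 \<le> fps_conv_radius f" for c f
    using that by (rule order_trans[OF _ order_trans[OF _ fps_conv_radius_mult]]) simp
  have s: "1 \<le> fps_conv_radius (f + g)" if "1 \<le> fps_conv_radius f" "1 \<le> fps_conv_radius g" for f g :: "complex fps"
    using that by (intro order_trans[OF _ fps_conv_radius_add]) simp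
  have "Y2 z = eval_fps (fps_X * (fps_theta (fps_theta hyp_2F1) + fps_const (1/2) * fps_theta hyp_2F1 + fps_const (1/18) * hyp_2F1)) z"
    unfolding Y2_def using hyp_2F1_ode by (rule arg_cong)
  also have "\<dots> = z * (Y2 z + 1 / 2 * Y1 z + 1 / 18 * Y0 z)"
    unfolding Y2_def Y1_def Y0_def
    by (simp add: eval_fps_mult eval_fps_add n c s r0 r1 r2)
  finally show "(1 - z) * Y2 z = z * (Y1 z / 2 + Y0 z / 18)"
    by (simp add: algebra_simps)
qed

text \<open>The factor k is the Euler operator x d/dx, and applied to the square of Y0 it gives 2 Y0
  Y1.\<close>

lemma hyp_3F2_sums:
  assumes "norm z < 1"
  shows "(\<lambda>k. hyp_3F2 $ k * (b * of_nat k + a) * z ^ k) sums (b * (2 * Y0 z * Y1 z) + a * (Y0 z)\<^sup>2)"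
proof -
  note r0 = hyp_conv_radius(1)
  note n = norm_less_conv_radius[OF _ assms]
  have F: "eval_fps hyp_3F2 z = (Y0 z)\<^sup>2"
    unfolding clausen power2_eq_square Y0_def by (simp add: eval_fps_mult n r0)
  have "fps_theta hyp_3F2 = fps_const 2 * (hyp_2F1 * fps_theta hyp_2F1)"
    unfolding clausen power2_eq_square by (simp add: fps_theta_mult mult.commute numeral_fps_const[symmetric])
  then have T: "eval_fps (fps_theta hyp_3F2) z = 2 * Y0 z * Y1 z"
    unfolding Y0_def Y1_def using r0 fps_conv_radius_theta[OF r0]
    by (simp add: eval_fps_mult n order_trans[OF _ fps_conv_radius_mult])
  have "(\<lambda>k. b * (fps_theta hyp_3F2 $ k * z ^ k) + a * (hyp_3F2 $ k * z ^ k)) sums (b * (2 * Y0 z * Y1 z) + a * (Y0 z)\<^sup>2)"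
    unfolding F[symmetric] T[symmetric]
    by (intro sums_add sums_mult sums_eval_fps n hyp_conv_radius fps_conv_radius_theta)
  then show ?thesis
    by (simp add: fps_theta_nth algebra_simps)
qed

section \<open>Theta inversion\<close>

text \<open>The scaling c = sqrt(2 s) reduces the integral to the characteristic function of the
  standard normal distribution.\<close>

lemma gaussian_fourier:
  fixes s u :: real
  assumes "s > 0"
  shows "integrable lborel (\<lambda>x. of_real (exp (- s * x\<^sup>2)) * exp (\<i> * of_real (u * x)) :: complex)"
    and "(LINT x|lborel. of_real (exp (- s * x\<^sup>2)) * exp (\<i> * of_real (u * x)) :: complex) =
      of_real (sqrt (pi / s) * exp (- u\<^sup>2 / (4 * s)))"
proof -
  define c where "c = sqrt (2 * s)"
  have c: "c > 0" "c\<^sup>2 = 2 * s" using assms by (auto simp: c_def)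
  define g :: "real \<Rightarrow> complex" where "g x = of_real (std_normal_density x) * exp (\<i> * of_real (u / c * x))" for x
  have g_int: "integrable lborel g"
  proof (rule Bochner_Integration.integrable_bound[of lborel std_normal_density])
    show "integrable lborel std_normal_density"
      using integrable_normal_density[of 1 0] by simp
    show "g \<in> borel_measurable lborel"
      unfolding g_def by measurable
    show "AE x in lborel. norm (g x) \<le> norm (std_normal_density x)"
      unfolding g_def by (auto simp: norm_mult)
  qed
  have g_val: "(LINT x|lborel. g x) = of_real (exp (- ((u / c)\<^sup>2) / 2))"
  proof -
    have "char std_normal_distribution (u / c) = (LINT x|lborel. g x)"
      unfolding char_def g_def
      by (subst integral_density) (auto simp: scaleR_conv_of_real mult_ac normal_density_nonneg)
    then show ?thesis
      by (simp add: char_std_normal_distribution)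
  qed
  have eq: "g (0 + c * x) = of_real (exp (- s * x\<^sup>2)) * exp (\<i> * of_real (u * x)) / of_real (sqrt (2 * pi))" for x
  proof -
    have "- ((c * x)\<^sup>2) / 2 = - s * x\<^sup>2"
      using c(2) by (simp add: power_mult_distrib)
    then have "std_normal_density (c * x) = exp (- s * x\<^sup>2) / sqrt (2 * pi)"
      by (simp add: std_normal_density_def)
    then show ?thesis
      using c(1) by (simp add: g_def)
  qed
  have i: "integrable lborel (\<lambda>x. g (0 + c * x))"
    using lborel_integrable_real_affine[OF g_int, of c 0] c(1) by simp
  then have "integrable lborel (\<lambda>x. of_real (sqrt (2 * pi)) * g (0 + c * x))"
    by (rule integrable_mult_right)
  then show "integrable lborel (\<lambda>x. of_real (exp (- s * x\<^sup>2)) * exp (\<i> * of_real (u * x)) :: complex)"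
    unfolding eq by simp
  have "(LINT x|lborel. g x) = \<bar>c\<bar> *\<^sub>R (LINT x|lborel. g (0 + c * x))"
    using lborel_integral_real_affine[of c g 0] c(1) by simp
  also have "\<dots> = of_real (c / sqrt (2 * pi)) * (LINT x|lborel. of_real (exp (- s * x\<^sup>2)) * exp (\<i> * of_real (u * x)))"
    unfolding eq using c(1) by (simp add: scaleR_conv_of_real)
  finally have "(LINT x|lborel. of_real (exp (- s * x\<^sup>2)) * exp (\<i> * of_real (u * x))) =
      of_real (sqrt (2 * pi) / c) * (of_real (exp (- ((u / c)\<^sup>2) / 2)) :: complex)"
    unfolding g_val using c(1) by (simp add: field_simps)
  also have "sqrt (2 * pi) / c = sqrt (pi / s)"
    using assms by (simp add: c_def real_sqrt_mult real_sqrt_divide)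
  also have "- ((u / c)\<^sup>2) / 2 = - u\<^sup>2 / (4 * s)"
    by (simp add: power_divide c(2))
  finally show "(LINT x|lborel. of_real (exp (- s * x\<^sup>2)) * exp (\<i> * of_real (u * x)) :: complex) =
      of_real (sqrt (pi / s) * exp (- u\<^sup>2 / (4 * s)))"
    by simp
qed

section \<open>Uniqueness of Fourier coefficients at one point\<close>

definition char01 :: "int \<Rightarrow> real \<Rightarrow> complex" where
  "char01 k x = cis (2 * pi * of_int k * x)"

lemma char01_add: "char01 (k + m) x = char01 k x * char01 m x"
  by (simp add: char01_def cis_mult algebra_simps)

lemma char01_0 [simp]: "char01 0 x = 1"
  by (simp add: char01_def)

lemma norm_char01 [simp]: "norm (char01 k x) = 1"
  by (simp add: char01_def)

lemma continuous_on_char01 [continuous_intros]: "continuous_on A (char01 k)"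
  unfolding char01_def by (intro continuous_intros)

lemma char01_periodic: "char01 k (x + of_int m) = char01 k x"
proof -
  have "2 * pi * of_int k * (x + of_int m) = 2 * pi * of_int k * x + 2 * pi * of_int (k * m)"
    by (simp add: algebra_simps)
  then show ?thesis
    by (simp add: char01_def cis_mult[symmetric])
qed

text \<open>
  If all Fourier coefficients vanish, so do the integrals against the powers of the trigonometric
  polynomial \<open>1 - cos (2\<pi>d) - cos (2\<pi>x)\<close>, which concentrate at \<open>1/2\<close>.
\<close>

lemma fourier_uniqueness_half:
  fixes h :: "real \<Rightarrow> complex"
  assumes cont: "continuous_on {0..1} h"
    and zero: "\<And>k. integral {0..1} (\<lambda>x. h x * char01 k x) = 0"
  shows "h (1 / 2) = 0"
proof (rule ccontr)
  assume nz: "h (1 / 2) \<noteq> 0"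
  \<comment> \<open>Rotating h by the conjugate of its value at 1/2 makes g real and positive near
    1/2, so a contradiction can come from signs.\<close>
  define g where "g x = Re (cnj (h (1 / 2)) * h x)" for x
  define e where "e = (norm (h (1 / 2)))\<^sup>2"
  have e: "e > 0" using nz by (simp add: e_def)
  have g_half: "g (1 / 2) = e"
    unfolding g_def e_def cmod_power2 by (simp add: power2_eq_square)
  have g_cont: "continuous_on {0..1} g"
    unfolding g_def by (intro continuous_intros cont)
  obtain d0 where d0: "d0 > 0" "\<And>x. x \<in> {0..1} \<Longrightarrow> dist x (1 / 2) < d0 \<Longrightarrow> dist (g x) (g (1 / 2)) < e / 2"
    using g_cont e unfolding continuous_on_iff by (metis atLeastAtMost_iff half_gt_zero less_eq_real_def zero_le_divide_1_iff zero_le_numeral divide_le_eq_1_pos one_le_numeral zero_less_numeral)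
  define d where "d = min (d0 / 2) (1 / 4)"
  have d: "0 < d" "d \<le> 1 / 4" "d < d0" using d0 by (auto simp: d_def)
  have g_in: "g x \<ge> e / 2" if "\<bar>x - 1 / 2\<bar> \<le> d" for x
  proof -
    have "x \<in> {0..1}" "dist x (1 / 2) < d0"
      using that d by (auto simp: dist_real_def abs_le_iff)
    then show ?thesis
      using d0(2)[of x] unfolding dist_real_def g_half by linarith
  qed
  \<comment> \<open>On the unit interval K is at least \<rho> > 1 within d/2 of 1/2, at least 1
    within d, and between -1 and 1 elsewhere. Hence the powers of K grow near 1/2, where g is
    positive, and stay bounded away from it.\<close>
  define K where "K x = 1 - cos (2 * pi * d) - cos (2 * pi * x)" for x
  define \<rho> where "\<rho> = 1 - cos (2 * pi * d) + cos (pi * d)"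
  have shift: "- cos (2 * pi * x) = cos (2 * pi * \<bar>x - 1 / 2\<bar>)" for x
  proof -
    have "cos (2 * pi * \<bar>x - 1 / 2\<bar>) = cos \<bar>2 * pi * (x - 1 / 2)\<bar>"
      by (simp add: abs_mult)
    also have "\<dots> = cos (2 * pi * x - pi)"
      by (simp add: algebra_simps)
    finally show ?thesis by simp
  qed
  have mono: "cos b \<le> cos a" if "0 \<le> a" "a \<le> b" "b \<le> pi" for a b
    using that by (subst cos_mono_le_eq) auto
  have cosd: "0 \<le> cos (2 * pi * d)"
  proof (rule cos_ge_zero)
    show "2 * pi * d \<le> pi / 2"
      using mult_left_mono[OF d(2), of "2 * pi"] by simp
  qed (use d in \<open>auto intro: order_trans[of _ 0]\<close>)
  have rho: "\<rho> > 1"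
  proof -
    have "pi * d \<le> pi * 1"
      using d by (intro mult_left_mono) auto
    then have "cos (2 * pi * d) < cos (pi * d)"
      using d mult_left_mono[OF d(2), of "2 * pi"] by (intro cos_monotone_0_pi) auto
    then show ?thesis by (simp add: \<rho>_def)
  qed
  have K_mid: "K x \<ge> \<rho>" if "\<bar>x - 1 / 2\<bar> \<le> d / 2" for x
  proof -
    have "2 * pi * \<bar>x - 1 / 2\<bar> \<le> 2 * pi * (d / 2)"
      using that by (intro mult_left_mono) auto
    moreover have "pi * d \<le> pi"
      using d by (simp add: mult_left_le)
    ultimately have "cos (pi * d) \<le> cos (2 * pi * \<bar>x - 1 / 2\<bar>)"
      by (intro mono) auto
    then show ?thesis by (simp add: K_def \<rho>_def shift[symmetric])
  qed
  have K_in: "K x \<ge> 1" if "\<bar>x - 1 / 2\<bar> \<le> d" for x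
  proof -
    have "2 * pi * \<bar>x - 1 / 2\<bar> \<le> 2 * pi * d"
      using that by (intro mult_left_mono) auto
    moreover have "2 * pi * d \<le> pi"
      using d mult_left_mono[OF d(2), of "2 * pi"] by simp
    ultimately have "cos (2 * pi * d) \<le> cos (2 * pi * \<bar>x - 1 / 2\<bar>)"
      by (intro mono) auto
    then show ?thesis by (simp add: K_def shift[symmetric])
  qed
  have K_out: "\<bar>K x\<bar> \<le> 1" if "x \<in> {0..1}" "\<not> \<bar>x - 1 / 2\<bar> \<le> d" for x
  proof -
    have "\<bar>x - 1 / 2\<bar> \<le> 1 / 2" using that(1) unfolding atLeastAtMost_iff by linarith
    then have "2 * pi * \<bar>x - 1 / 2\<bar> \<le> pi"
      using mult_left_mono[of "\<bar>x - 1 / 2\<bar>" "1 / 2" "2 * pi"] by simp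
    then have "cos (2 * pi * \<bar>x - 1 / 2\<bar>) \<le> cos (2 * pi * d)"
      using that d by (intro mono) auto
    then have "K x \<le> 1" by (simp add: K_def shift[symmetric])
    moreover have "- 1 \<le> K x"
      using cos_le_one[of "2 * pi * d"] cos_le_one[of "2 * pi * x"] unfolding K_def by linarith
    ultimately show ?thesis by linarith
  qed
  have K_cont: "continuous_on A K" for A
    unfolding K_def by (intro continuous_intros)
  have int0: "integral {0..1} (\<lambda>x. h x * of_real (K x ^ n) * char01 k x) = 0" for n k
  proof (induction n arbitrary: k)
    case 0
    show ?case using zero by simp
  next
    case (Suc n)
    define F where "F k x = h x * of_real (K x ^ n) * char01 k x" for k x
    have F: "F k integrable_on {0..1}" for k
      unfolding F_def by (intro integrable_continuous_interval continuous_intros cont K_cont)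
    have Kc: "complex_of_real (K x) = of_real (1 - cos (2 * pi * d)) - (char01 1 x + char01 (- 1) x) / 2" for x
      by (simp add: K_def char01_def complex_eq_iff)
    have "h x * of_real (K x ^ Suc n) * char01 k x =
        of_real (1 - cos (2 * pi * d)) * F k x - (1 / 2) * F (1 + k) x - (1 / 2) * F (- 1 + k) x" for x
      by (simp only: power_Suc of_real_mult Kc F_def char01_add) (simp only: algebra_simps add_divide_distrib times_divide_eq_right times_divide_eq_left mult_1_left)
    then have "integral {0..1} (\<lambda>x. h x * of_real (K x ^ Suc n) * char01 k x) =
        integral {0..1} (\<lambda>x. of_real (1 - cos (2 * pi * d)) * F k x - (1 / 2) * F (1 + k) x - (1 / 2) * F (- 1 + k) x)"
      by simp
    also have "\<dots> = of_real (1 - cos (2 * pi * d)) * integral {0..1} (F k) -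
        (1 / 2) * integral {0..1} (F (1 + k)) - (1 / 2) * integral {0..1} (F (- 1 + k))"
      by (subst Henstock_Kurzweil_Integration.integral_diff Henstock_Kurzweil_Integration.integral_mult_right;
          (intro integrable_diff integrable_on_mult_right F)?)+ simp
    also have "\<dots> = 0"
      using Suc unfolding F_def by simp
    finally show ?case .
  qed
  have gK: "integral {0..1} (\<lambda>x. g x * K x ^ n) = 0" for n
  proof -
    have i: "(\<lambda>x. h x * of_real (K x ^ n)) integrable_on {0..1}"
      by (intro integrable_continuous_interval continuous_intros cont K_cont)
    have "((\<lambda>x. h x * of_real (K x ^ n)) has_integral 0) {0..1}"
      using integrable_integral[OF i] int0[of n 0] by simp
    then have "((\<lambda>x. Re (cnj (h (1 / 2)) * (h x * of_real (K x ^ n)))) has_integral Re (cnj (h (1 / 2)) * 0)) {0..1}"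
      by (intro has_integral_Re has_integral_mult_right)
    then show ?thesis
      by (intro integral_unique) (simp add: g_def algebra_simps)
  qed
  have "bounded (g ` {0..1})"
    by (intro compact_imp_bounded compact_continuous_image g_cont compact_Icc)
  then obtain M where M: "M > 0" "\<And>x. x \<in> {0..1} \<Longrightarrow> \<bar>g x\<bar> \<le> M"
    unfolding bounded_pos by auto
  \<comment> \<open>The integral of g K^n is 0, yet it is at least e/2 * \<rho>^n times the length d
    of I, minus M.\<close>
  have bound: "(e / 2) * \<rho> ^ n * d \<le> M" for n
  proof -
    define I where "I = {1 / 2 - d / 2..1 / 2 + d / 2}"
    have I: "I \<subseteq> {0..1}" using d by (auto simp: I_def)
    have low: "(if x \<in> I then (e / 2) * \<rho> ^ n else 0) - M \<le> g x * K x ^ n" if x: "x \<in> {0..1}" for x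
    proof (cases "\<bar>x - 1 / 2\<bar> \<le> d")
      case True
      show ?thesis
      proof (cases "x \<in> I")
        case I: True
        then have "\<bar>x - 1 / 2\<bar> \<le> d / 2"
          unfolding I_def atLeastAtMost_iff by linarith
        then have "(e / 2) * \<rho> ^ n \<le> g x * K x ^ n"
          using g_in[OF True] K_mid[of x] e rho by (intro mult_mono power_mono) auto
        then show ?thesis using I M by simp
      next
        case False
        have "0 \<le> g x * K x ^ n"
          using g_in[OF True] K_in[OF True] e by (intro mult_nonneg_nonneg) auto
        then show ?thesis using False M by simp
      qed
    next
      case False
      then have "x \<notin> I"
        using d unfolding I_def atLeastAtMost_iff by linarith
      moreover have "\<bar>g x * K x ^ n\<bar> \<le> M * 1"
        unfolding abs_mult power_abs using M(2)[OF x] K_out[OF x False] M(1)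
        by (intro mult_mono power_le_one) auto
      ultimately show ?thesis by (auto simp: abs_le_iff)
    qed
    have "((\<lambda>x. (e / 2) * \<rho> ^ n) has_integral (e / 2) * \<rho> ^ n * d) I"
      using has_integral_const_real[of "(e / 2) * \<rho> ^ n" "1 / 2 - d / 2" "1 / 2 + d / 2"] d
      by (simp add: I_def mult.commute)
    then have "((\<lambda>x. if x \<in> I then (e / 2) * \<rho> ^ n else 0) has_integral (e / 2) * \<rho> ^ n * d) {0..1}"
      using has_integral_restrict[OF I] by fastforce
    then have "((\<lambda>x. (if x \<in> I then (e / 2) * \<rho> ^ n else 0) - M) has_integral (e / 2) * \<rho> ^ n * d - M) {0..1}"
      using has_integral_const_real[of M 0 1] by (intro has_integral_diff) auto
    moreover have "(\<lambda>x. g x * K x ^ n) integrable_on {0..1}"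
      by (intro integrable_continuous_interval continuous_intros g_cont K_cont)
    from integrable_integral[OF this] have "((\<lambda>x. g x * K x ^ n) has_integral 0) {0..1}"
      unfolding gK .
    ultimately have "(e / 2) * \<rho> ^ n * d - M \<le> 0"
      using low by (rule has_integral_le)
    then show ?thesis by simp
  qed
  obtain n where "\<rho> ^ n > M / (e / 2 * d)"
    using real_arch_pow[OF rho] by blast
  then have "M < e / 2 * d * \<rho> ^ n"
    using e d by (simp add: divide_less_eq mult_ac)
  with bound[of n] show False by (simp add: mult_ac)
qed

section \<open>Poisson summation for the Gaussian\<close>

lemma gauss_summable:
  fixes t x :: real
  assumes "t > 0"
  shows "(\<lambda>n. exp (- pi * t * (of_int n + x)\<^sup>2)) summable_on (UNIV :: int set)"
proof -
  define f :: "int \<Rightarrow> complex" where "f n = of_real (exp (- pi * t * (of_int n + x)\<^sup>2))" for n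
  define r where "r = exp (- pi * t)"
  have r: "0 < r" "r < 1" using assms by (auto simp: r_def)
  have le: "exp (- pi * t * y\<^sup>2) \<le> exp (pi * t * (x\<^sup>2 + \<bar>x\<bar> + 2)) * r ^ j"
    if "y = of_int n + x" "n = 1 + int j \<or> n = - int j" for y n j
  proof -
    have "real j \<le> \<bar>y\<bar> + \<bar>x\<bar> + 1"
      using that by auto
    moreover have "\<bar>y\<bar> \<le> y\<^sup>2 + 1"
      using sum_power2_ge_zero[of "\<bar>y\<bar> - 1 / 2" 0] by (simp add: power2_eq_square algebra_simps abs_if split: if_splits)
    ultimately have "real j - y\<^sup>2 \<le> x\<^sup>2 + \<bar>x\<bar> + 2"
      using zero_le_power2[of x] by linarith
    then have "pi * t * (real j - y\<^sup>2) \<le> pi * t * (x\<^sup>2 + \<bar>x\<bar> + 2)"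
      using assms by (intro mult_left_mono) auto
    then have "- pi * t * y\<^sup>2 \<le> pi * t * (x\<^sup>2 + \<bar>x\<bar> + 2) + real j * (- pi * t)"
      by (simp add: algebra_simps)
    then show ?thesis
      unfolding r_def exp_of_nat_mult[symmetric] exp_add[symmetric] by simp
  qed
  have s: "summable (\<lambda>j. exp (pi * t * (x\<^sup>2 + \<bar>x\<bar> + 2)) * r ^ j)"
    using r by (intro summable_mult summable_geometric) auto
  have "f summable_on UNIV"
  proof (intro summable_on_int_halves norm_summable_imp_summable_on)
    show "summable (\<lambda>j. norm (f (1 + int j)))"
      by (rule summable_comparison_test'[OF s, of 0]) (use le[OF refl, of "1 + int j" j for j] in \<open>simp add: f_def\<close>)
    show "summable (\<lambda>j. norm (f (- int j)))"
      by (rule summable_comparison_test'[OF s, of 0]) (use le[OF refl, of "- int j" j for j] in \<open>simp add: f_def\<close>)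
  qed
  from summable_on_Re[OF this] show ?thesis
    by (simp add: f_def)
qed

text \<open>The Jacobi theta constants \<open>\<theta>\<^sub>2\<close> and \<open>\<theta>\<^sub>4\<close> at the nome \<open>e\<^bsup>-\<pi>t\<^esup>\<close>.\<close>

definition gauss_theta2 :: "real \<Rightarrow> real" where
  "gauss_theta2 t = (\<Sum>\<^sub>\<infinity>n::int. exp (- pi * t * (of_int n + 1 / 2)\<^sup>2))"

definition gauss_theta4 :: "real \<Rightarrow> real" where
  "gauss_theta4 t = (\<Sum>\<^sub>\<infinity>n::int. (-1) powi n * exp (- pi * t * (of_int n)\<^sup>2))"

lemma has_integral_char01:
  "((\<lambda>x. char01 k x) has_integral (if k = 0 then 1 else 0)) {0..1}"
proof (cases "k = 0")
  case True
  then show ?thesis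
    using has_integral_const_real[of "1 :: complex" 0 1] by simp
next
  case False
  define c where "c = 2 * pi * \<i> * of_int k"
  have c: "c \<noteq> 0" using False by (simp add: c_def)
  have e: "char01 k x = exp (c * of_real x)" for x
    by (simp add: char01_def c_def cis_conv_exp mult_ac)
  have "((\<lambda>x. exp (c * of_real x)) has_integral exp (c * of_real 1) / c - exp (c * of_real 0) / c) {0..1}"
  proof (rule fundamental_theorem_of_calculus)
    fix x :: real
    have "((\<lambda>z. exp (c * z) / c) has_field_derivative exp (c * of_real x)) (at (of_real x))"
      using c by (auto intro!: derivative_eq_intros)
    then show "((\<lambda>x. exp (c * of_real x) / c) has_vector_derivative exp (c * of_real x)) (at x within {0..1})"
      by (rule has_vector_derivative_real_field)
  qed simp
  moreover have "exp (c * of_real 1) = 1"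
    using e[of 1] char01_periodic[of k 0 1] by (simp add: char01_def)
  ultimately show ?thesis
    using False by (simp add: e)
qed

text \<open>Poisson summation for the Gaussian: both sides are continuous in \<open>x\<close> with equal Fourier coefficients.\<close>

lemma gauss_theta_inversion:
  assumes t: "t > 0"
  shows "gauss_theta2 t = gauss_theta4 (1 / t) / sqrt t"
proof -
  define f :: "real \<Rightarrow> complex" where "f x = of_real (exp (- pi * t * x\<^sup>2))" for x
  define c :: "int \<Rightarrow> complex" where "c k = of_real (exp (- pi / t * (of_int k)\<^sup>2) / sqrt t)" for k
  let ?h = "\<lambda>k x. f x * char01 k x"
  let ?d = "\<lambda>k j. c (1 + int j) * (if 1 + int j + k = 0 then 1 else 0) + c (- int j) * (if - int j + k = 0 then 1 else 0)"
  define p where "p j x = f (x + of_int (1 + int j)) + f (x + of_int (- int j))" for j x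
  define u where "u j x = c (1 + int j) * char01 (1 + int j) x + c (- int j) * char01 (- int j) x" for j x
  define r where "r = exp (- pi * t)"
  have r: "0 < r" "r < 1" using t by (auto simp: r_def)
  define r' where "r' = exp (- pi / t)"
  have r': "0 < r'" "r' < 1" using t by (auto simp: r'_def)
  have fc: "continuous_on A f" for A
    unfolding f_def by (intro continuous_intros)
  have f_int: "integrable lborel (?h k)"
    and f_val: "(LINT x|lborel. ?h k x) = c k" for k
  proof -
    have s: "pi * t > 0" using t by simp
    have e: "?h k x = of_real (exp (- (pi * t) * x\<^sup>2)) * exp (\<i> * of_real ((2 * pi * of_int k) * x))" for x
      by (simp add: f_def char01_def cis_conv_exp)
    have v: "sqrt (pi / (pi * t)) * exp (- (2 * pi * of_int k)\<^sup>2 / (4 * (pi * t))) = exp (- pi / t * (of_int k)\<^sup>2) / sqrt t"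
    proof -
      have "(2 * pi * of_int k)\<^sup>2 / (4 * (pi * t)) = pi / t * (of_int k :: real)\<^sup>2"
        using t by (simp add: power2_eq_square field_simps)
      moreover have "sqrt (pi / (pi * t)) = 1 / sqrt t"
        using t by (simp add: real_sqrt_divide)
      ultimately show ?thesis by simp
    qed
    show "integrable lborel (?h k)"
      unfolding e by (rule gaussian_fourier(1)[OF s])
    show "(LINT x|lborel. ?h k x) = c k"
      unfolding e gaussian_fourier(2)[OF s] v c_def ..
  qed
  have fI: "(?h k) integrable_on {a..b}" for k a b
    by (intro integrable_continuous_interval continuous_intros fc)
  \<comment> \<open>The translates by 1-J..J fill one interval: since \<open>char01 k\<close> has
    period 1, the coefficient of the partial sum unfolds to an integral of the Gaussian over
    it.\<close>
  have p_coeff: "integral {0..1} (\<lambda>x. (\<Sum>j<J. p j x) * char01 k x) =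
      integral {1 - real J..real J + 1} (?h k)" for J k
  proof (induction J)
    case 0
    show ?case by simp
  next
    case (Suc J)
    have sh: "((\<lambda>x. f (x + of_int m) * char01 k x) has_integral
        integral {of_int m..of_int m + 1} (?h k)) {0..1}" for m
    proof -
      have "((?h k) has_integral integral {of_int m..of_int m + 1} (?h k)) {0 + of_int m..1 + of_int m}"
        using integrable_integral[OF fI] by (simp add: add.commute)
      then have "((?h k) \<circ> (+) (of_int m) has_integral integral {of_int m..of_int m + 1} (?h k)) {0..1}"
        unfolding has_integral_shift_Icc_real .
      then show ?thesis
        using char01_periodic[of k _ m] by (simp add: o_def add.commute)
    qed
    have i1: "(\<lambda>x. (\<Sum>j<J. p j x) * char01 k x) integrable_on {0..1}"
      unfolding p_def
      by (intro integrable_continuous_interval continuous_intros continuous_on_compose2[OF fc[of UNIV]]) auto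
    have "integral {0..1} (\<lambda>x. (\<Sum>j<Suc J. p j x) * char01 k x) =
        integral {0..1} (\<lambda>x. (\<Sum>j<J. p j x) * char01 k x +
          (f (x + of_int (1 + int J)) * char01 k x + f (x + of_int (- int J)) * char01 k x))"
      by (simp add: p_def algebra_simps)
    also have "\<dots> = integral {1 - real J..real J + 1} (?h k) +
        (integral {of_int (1 + int J)..of_int (1 + int J) + 1} (?h k) +
         integral {of_int (- int J)..of_int (- int J) + 1} (?h k))"
      unfolding Suc.IH[symmetric] by (intro integral_unique has_integral_add integrable_integral i1 sh)
    also have "\<dots> = integral {- real J..1 - real J} (?h k) +
        integral {1 - real J..real J + 1} (?h k) +
        integral {real J + 1..real J + 2} (?h k)"
      by (simp add: algebra_simps)
    also have "\<dots> = integral {- real J..real J + 2} (?h k)"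
      using Henstock_Kurzweil_Integration.integral_combine[OF _ _ fI, of "- real J" "1 - real J" "real J + 1" k]
        Henstock_Kurzweil_Integration.integral_combine[OF _ _ fI, of "- real J" "real J + 1" "real J + 2" k]
      by simp
    finally show ?case by (simp add: algebra_simps)
  qed
  have p_bound: "norm (p j x) \<le> 2 * exp (pi * t) * r ^ j" if "x \<in> {0..1}" for j x
  proof -
    have le: "norm (f y) \<le> exp (pi * t) * r ^ j" if "y\<^sup>2 \<ge> real j - 1" for y
    proof -
      have "pi * t * (real j - 1) \<le> pi * t * y\<^sup>2"
        using that t by (intro mult_left_mono) auto
      then have "- pi * t * y\<^sup>2 \<le> pi * t + real j * (- pi * t)"
        by (simp add: algebra_simps)
      then show ?thesis
        unfolding r_def exp_of_nat_mult[symmetric] exp_add[symmetric] f_def by simp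
    qed
    have sq: "y\<^sup>2 \<ge> real j - 1" if "\<bar>y\<bar> \<ge> real j - 1" for y
    proof (cases "j \<le> 1")
      case True
      then have "real j - 1 \<le> 0" by simp
      then show ?thesis using zero_le_power2[of y] by linarith
    next
      case False
      then have "(real j - 1) * 1 \<le> (real j - 1) * (real j - 1)"
        by (intro mult_left_mono) auto
      also have "\<dots> \<le> \<bar>y\<bar> * \<bar>y\<bar>"
        using that False by (intro mult_mono) auto
      finally show ?thesis by (simp add: power2_eq_square)
    qed
    have x: "0 \<le> x" "x \<le> 1"
      using that by auto
    have "real j - 1 \<le> \<bar>x + of_int (1 + int j)\<bar>"
      unfolding of_int_add of_int_of_nat_eq of_int_1 using x by linarith
    from le[OF sq[OF this]] have "norm (f (x + of_int (1 + int j))) \<le> exp (pi * t) * r ^ j" .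
    moreover have "real j - 1 \<le> \<bar>x + of_int (- int j)\<bar>"
      unfolding of_int_minus of_int_of_nat_eq using x by linarith
    from le[OF sq[OF this]] have "norm (f (x + of_int (- int j))) \<le> exp (pi * t) * r ^ j" .
    ultimately show ?thesis
      unfolding p_def by (intro order_trans[OF norm_triangle_ineq]) simp
  qed
  have u_bound: "norm (u j x) \<le> 2 / sqrt t * r' ^ j" for j x
  proof -
    have le: "norm (c k) \<le> 1 / sqrt t * r' ^ j" if "k = 1 + int j \<or> k = - int j" for k
    proof -
      have "int j \<le> k\<^sup>2"
      proof -
        have "int j * 1 \<le> (1 + int j) * (1 + int j)" by (intro mult_mono) auto
        moreover have "int j \<le> int j * int j"
          by (cases "j = 0") auto
        ultimately show ?thesis
          using that by (auto simp: power2_eq_square)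
      qed
      then have "real j \<le> (of_int k)\<^sup>2"
        by (metis of_int_le_iff of_int_of_nat_eq of_int_power)
      then have "pi / t * real j \<le> pi / t * (of_int k)\<^sup>2"
        using t by (intro mult_left_mono) auto
      then have "exp (- pi / t * (of_int k)\<^sup>2) \<le> r' ^ j"
        unfolding r'_def exp_of_nat_mult[symmetric] by (simp add: mult.commute)
      then show ?thesis
        using t by (simp add: c_def norm_divide divide_right_mono)
    qed
    show ?thesis
      unfolding u_def using le[of "1 + int j"] le[of "- int j"]
      by (intro order_trans[OF norm_triangle_ineq]) (simp add: norm_mult)
  qed
  define P where "P x = (\<Sum>j. p j x)" for x
  define U where "U x = (\<Sum>j. u j x)" for x
  have P: "uniform_limit {0..1} (\<lambda>J x. \<Sum>j<J. p j x) P sequentially"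
    unfolding P_def by (rule Weierstrass_m_test[where M = "\<lambda>j. 2 * exp (pi * t) * r ^ j"])
      (use p_bound r in \<open>auto intro!: summable_mult summable_geometric\<close>)
  have U: "uniform_limit {0..1} (\<lambda>J x. \<Sum>j<J. u j x) U sequentially"
    unfolding U_def by (rule Weierstrass_m_test[where M = "\<lambda>j. 2 / sqrt t * r' ^ j"])
      (use u_bound r' in \<open>auto intro!: summable_mult summable_geometric\<close>)
  have pc: "continuous_on {0..1} (\<lambda>x. \<Sum>j<J. p j x)" for J
    unfolding p_def by (intro continuous_intros continuous_on_compose2[OF fc[of UNIV]]) auto
  have uc: "continuous_on {0..1} (\<lambda>x. \<Sum>j<J. u j x)" for J
    unfolding u_def by (intro continuous_intros)
  have Pc: "continuous_on {0..1} P" and Uc: "continuous_on {0..1} U"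
    using uniform_limit_theorem[OF always_eventually P] uniform_limit_theorem[OF always_eventually U] pc uc by auto
  have mult_lim: "uniform_limit {0..1} (\<lambda>J x. g J x * char01 k x) (\<lambda>x. G x * char01 k x) sequentially"
    if "uniform_limit {0..1} g G sequentially" for g G k
  proof -
    have "dist (a * char01 k x) (b * char01 k x) = dist a b" for a b x
      unfolding dist_norm left_diff_distrib[symmetric] norm_mult by simp
    then show ?thesis
      using that unfolding uniform_limit_iff by (simp only:)
  qed
  have coeff_lim: "(\<lambda>x. G x * char01 k x) integrable_on {0..1} \<and>
      (\<lambda>J. integral {0..1} (\<lambda>x. g J x * char01 k x)) \<longlonglongrightarrow> integral {0..1} (\<lambda>x. G x * char01 k x)"
    if g: "uniform_limit {0..1} g G sequentially" "\<And>J. continuous_on {0..1} (g J)" for g G k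
  proof -
    have gc: "continuous_on {0..1} (\<lambda>x. g J x * char01 k x)" for J
      by (intro continuous_intros g(2))
    obtain I L where "\<And>n. ((\<lambda>x. g n x * char01 k x) has_integral I n) {0..1}"
      "((\<lambda>x. G x * char01 k x) has_integral L) {0..1}" "I \<longlonglongrightarrow> L"
      by (rule uniform_limit_integral[OF mult_lim[OF g(1)] gc]) auto
    note IL = this
    have "integral {0..1} (\<lambda>x. g n x * char01 k x) = I n" for n
      by (rule integral_unique) (rule IL(1))
    moreover have "integral {0..1} (\<lambda>x. G x * char01 k x) = L"
      by (rule integral_unique) (rule IL(2))
    ultimately show ?thesis
      using IL by (auto intro: has_integral_integrable)
  qed
  have P_coeff: "integral {0..1} (\<lambda>x. P x * char01 k x) = c k" for k
  proof -
    have "(\<lambda>J. integral {1 - real J..real J + 1} (?h k)) \<longlonglongrightarrow> integral {0..1} (\<lambda>x. P x * char01 k x)"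
      using coeff_lim[OF P pc, of k] unfolding p_coeff by blast
    moreover have "(\<lambda>J. integral {1 - real J..real J + 1} (?h k)) \<longlonglongrightarrow> c k"
    proof -
      have U: "(\<Union>J. {1 - real J..real J + 1}) = UNIV"
      proof -
        have "\<exists>J. 1 - real J \<le> x \<and> x \<le> real J + 1" for x :: real
        proof -
          obtain n where "\<bar>x\<bar> + 1 \<le> real n"
            using real_arch_simple by blast
          then have "1 - real n \<le> x \<and> x \<le> real n + 1"
            by linarith
          then show ?thesis by blast
        qed
        then show ?thesis by auto
      qed
      have si: "set_integrable lborel A (?h k)" if "A \<in> sets borel" for A
        unfolding set_integrable_def using f_int[of k] that by (intro integrable_mult_indicator) auto
      have "(\<lambda>J. LINT x:{1 - real J..real J + 1}|lborel. ?h k x) \<longlonglongrightarrow>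
          (LINT x:(\<Union>J. {1 - real J..real J + 1})|lborel. ?h k x)"
        by (rule set_integral_cont_up) (auto simp: incseq_def U intro: si)
      then show ?thesis
        unfolding U using f_val[of k] set_borel_integral_eq_integral(2)[OF si[of "{a..b}" for a b]]
        by (simp add: set_lebesgue_integral_def)
    qed
    ultimately show ?thesis by (rule LIMSEQ_unique)
  qed
  have U_coeff: "integral {0..1} (\<lambda>x. U x * char01 k x) = c k" for k
  proof -
    have "integral {0..1} (\<lambda>x. (\<Sum>j<J. u j x) * char01 k x) =
        (\<Sum>j<J. ?d k j)" for J
    proof (rule integral_unique)
      have "((\<lambda>x. \<Sum>j<J. c (1 + int j) * char01 (1 + int j + k) x + c (- int j) * char01 (- int j + k) x) has_integral
        (\<Sum>j<J. ?d k j)) {0..1}"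
        by (intro has_integral_sum has_integral_add has_integral_mult_right has_integral_char01) auto
      then show "((\<lambda>x. (\<Sum>j<J. u j x) * char01 k x) has_integral
        (\<Sum>j<J. ?d k j)) {0..1}"
        unfolding u_def sum_distrib_right char01_add by (simp add: algebra_simps)
    qed
    moreover have "(\<lambda>J. \<Sum>j<J. ?d k j)
        \<longlonglongrightarrow> c k"
    proof -
      have hs: "((\<lambda>n. c n * (if n + k = 0 then 1 else 0)) has_sum c k) UNIV"
      proof -
        have "c (- k) = c k" by (simp add: c_def)
        then have "((\<lambda>n. c n * (if n + k = 0 then 1 else 0)) has_sum c k) {- k}"
          using has_sum_finite[of "{- k}" "\<lambda>n. c n * (if n + k = 0 then 1 else 0)"] by simp
        then show ?thesis
          by (rule iffD1[OF has_sum_cong_neutral, rotated -1]) auto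
      qed
      show ?thesis
        using sums_int_halves[OF has_sum_imp_summable[OF hs]] infsumI[OF hs] by (simp add: sums_def)
    qed
    ultimately have "(\<lambda>J. integral {0..1} (\<lambda>x. (\<Sum>j<J. u j x) * char01 k x)) \<longlonglongrightarrow> c k"
      by simp
    then show ?thesis
      using coeff_lim[OF U uc, of k] LIMSEQ_unique by blast
  qed
  \<comment> \<open>The point 1/2 is chosen because there the translates have half-integer
    arguments, as in \<theta>2, and the characters equal (-1)^n, as in \<theta>4.\<close>
  have "P (1 / 2) - U (1 / 2) = 0"
  proof (rule fourier_uniqueness_half[of "\<lambda>x. P x - U x"])
    show "continuous_on {0..1} (\<lambda>x. P x - U x)"
      by (intro continuous_intros Pc Uc)
    fix k
    have "integral {0..1} (\<lambda>x. (P x - U x) * char01 k x) =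
        integral {0..1} (\<lambda>x. P x * char01 k x) - integral {0..1} (\<lambda>x. U x * char01 k x)"
      unfolding left_diff_distrib
      by (intro Henstock_Kurzweil_Integration.integral_diff) (use coeff_lim[OF P pc] coeff_lim[OF U uc] in blast)+
    then show "integral {0..1} (\<lambda>x. (P x - U x) * char01 k x) = 0"
      by (simp add: P_coeff U_coeff)
  qed
  moreover have "P (1 / 2) = of_real (gauss_theta2 t)"
  proof -
    have s: "(\<lambda>n. f (1 / 2 + of_int n)) summable_on UNIV"
      using summable_on_of_real[OF gauss_summable[OF t, of "1 / 2"], where 'a = complex]
      by (simp add: f_def add.commute)
    have "P (1 / 2) = (\<Sum>\<^sub>\<infinity>n::int. f (1 / 2 + of_int n))"
      using sums_int_halves[OF s] unfolding P_def p_def by (simp add: sums_iff)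
    also have "\<dots> = of_real (gauss_theta2 t)"
      using has_sum_of_real[OF has_sum_infsum[OF gauss_summable[OF t, of "1 / 2"]], where 'a = complex]
      unfolding gauss_theta2_def f_def by (intro infsumI) (simp add: add.commute)
    finally show ?thesis .
  qed
  moreover have "U (1 / 2) = of_real (gauss_theta4 (1 / t) / sqrt t)"
  proof -
    have s: "(\<lambda>n::int. (-1) powi n * exp (- pi * (1 / t) * (of_int n)\<^sup>2)) summable_on UNIV"
    proof -
      have "(\<lambda>n::int. norm ((-1) powi n * exp (- pi * (1 / t) * (of_int n)\<^sup>2))) summable_on UNIV"
        using gauss_summable[of "1 / t" 0] t by (simp add: norm_mult norm_power_int abs_mult)
      then show ?thesis by (rule Infinite_Sum.abs_summable_summable)
    qed
    have ch: "char01 n (1 / 2) = of_real ((-1) powi n)" for n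
    proof -
      have "char01 n (1 / 2) = cis (of_int n * pi)" by (simp add: char01_def mult_ac)
      also have "\<dots> = cis pi powi n" by (rule cis_power_int[symmetric])
      finally show ?thesis by simp
    qed
    have hs: "((\<lambda>n. c n * char01 n (1 / 2)) has_sum of_real (gauss_theta4 (1 / t) * (1 / sqrt t))) UNIV"
      using has_sum_of_real[OF has_sum_cmult_left[OF has_sum_infsum[OF s], of "1 / sqrt t"], where 'a = complex]
      unfolding gauss_theta4_def ch c_def by (simp add: mult_ac)
    have "U (1 / 2) = (\<Sum>\<^sub>\<infinity>n. c n * char01 n (1 / 2))"
      using sums_int_halves[OF has_sum_imp_summable[OF hs]] unfolding U_def u_def by (simp add: sums_iff)
    then show ?thesis
      using infsumI[OF hs] by simp
  qed
  ultimately show ?thesis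
    by (metis eq_iff_diff_eq_0 of_real_eq_iff)
qed

lemma gauss_theta2_has_sum:
  assumes "t > 0"
  shows "((\<lambda>n. complex_of_real (exp (- pi * t * (of_int n + 1 / 2)\<^sup>2))) has_sum of_real (gauss_theta2 t)) UNIV"
  unfolding gauss_theta2_def
  by (rule has_sum_of_real[OF has_sum_infsum[OF gauss_summable[OF assms]]])

lemma gauss_theta4_has_sum:
  assumes "t > 0"
  shows "((\<lambda>n. complex_of_real ((-1) powi n * exp (- pi * t * (of_int n)\<^sup>2))) has_sum of_real (gauss_theta4 t)) UNIV"
proof -
  have "(\<lambda>n::int. norm ((-1) powi n * exp (- pi * t * (of_int n)\<^sup>2))) summable_on UNIV"
    using gauss_summable[OF assms, of 0] by (simp add: abs_mult)
  from has_sum_infsum[OF Infinite_Sum.abs_summable_summable[OF this]] show ?thesis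
    unfolding gauss_theta4_def by (rule has_sum_of_real)
qed

section \<open>The inversion formula for a on the negative real axis\<close>

text \<open>For n = 2l and m = k - l the form is k^2 + 3 l^2, with sign (-1)^(k+l). For n = 2l + 1
  it is (k + 1/2)^2 + 3 (l + 1/2)^2, which is always odd, hence the minus sign of the second
  product.\<close>

lemma theta_a_gauss:
  assumes y: "y > 0"
  shows "theta_a (- of_real (exp (- 2 * pi * y))) =
    of_real (gauss_theta4 (2 * y) * gauss_theta4 (6 * y) - gauss_theta2 (2 * y) * gauss_theta2 (6 * y))"
proof -
  let ?e = "\<lambda>c (x :: real). exp (- pi * (c * y) * x\<^sup>2)"
  define q :: complex where "q = - of_real (exp (- 2 * pi * y))"
  have q: "norm q < 1" using y by (simp add: q_def)
  define f where "f = (\<lambda>(m, n). q ^ nat (hex_form m n))"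
  have f: "f summable_on A" for A
    using hex_summable[OF q] summable_on_subset_banach unfolding f_def by blast
  have q_pow: "q ^ nat N = (if even N then 1 else -1) * of_real (exp (- 2 * pi * y * of_int N))" if "N \<ge> 0" for N
  proof -
    have "q ^ nat N = (- 1) ^ nat N * of_real (exp (- 2 * pi * y) ^ nat N)"
      unfolding q_def power_minus[of "of_real _"] by simp
    also have "exp (- 2 * pi * y) ^ nat N = exp (of_nat (nat N) * (- 2 * pi * y))"
      by (rule exp_of_nat_mult[symmetric])
    finally show ?thesis
      using that by (simp add: even_nat_iff mult_ac)
  qed
  define \<phi>0 where "\<phi>0 = (\<lambda>(k :: int, l :: int). (k - l, 2 * l))"
  define \<phi>1 where "\<phi>1 = (\<lambda>(k :: int, l :: int). (k - l, 2 * l + 1))"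
  have inj: "inj \<phi>0" "inj \<phi>1"
    by (auto simp: inj_on_def \<phi>0_def \<phi>1_def)
  have cover: "UNIV = range \<phi>0 \<union> range \<phi>1"
  proof -
    have "(m, n) \<in> range \<phi>0 \<union> range \<phi>1" for m n
    proof (cases "even n")
      case True
      then have "(m, n) = \<phi>0 (m + n div 2, n div 2)" by (simp add: \<phi>0_def)
      then show ?thesis by blast
    next
      case False
      then have "(m, n) = \<phi>1 (m + n div 2, n div 2)" by (simp add: \<phi>1_def)
      then show ?thesis by blast
    qed
    then show ?thesis by (auto simp: set_eq_iff)
  qed
  have disj: "range \<phi>0 \<inter> range \<phi>1 = {}"
  proof -
    have "2 * l \<noteq> 2 * l' + (1 :: int)" for l l' by presburger
    then show ?thesis by (auto simp: \<phi>0_def \<phi>1_def)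
  qed
  have "theta_a q = infsum f (range \<phi>0 \<union> range \<phi>1)"
    unfolding theta_a_eq f_def cover[symmetric] ..
  also have "\<dots> = infsum f (range \<phi>0) + infsum f (range \<phi>1)"
    by (rule infsum_Un_disjoint[OF f f disj])
  also have "\<dots> = infsum (f \<circ> \<phi>0) UNIV + infsum (f \<circ> \<phi>1) UNIV"
    by (simp only: infsum_reindex[OF inj(1)] infsum_reindex[OF inj(2)])
  finally have split: "theta_a q = infsum (f \<circ> \<phi>0) UNIV + infsum (f \<circ> \<phi>1) UNIV" .
  have f0: "f \<circ> \<phi>0 = (\<lambda>(k, l). of_real ((-1) powi k * ?e 2 (of_int k)) *
      of_real ((-1) powi l * ?e 6 (of_int l)))"
  proof (rule ext, clarify)
    fix k l :: int
    have h: "hex_form (k - l) (2 * l) = k\<^sup>2 + 3 * l\<^sup>2"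
      by (simp add: hex_form_def power2_eq_square algebra_simps)
    have "exp (- 2 * pi * y * of_int (k\<^sup>2 + 3 * l\<^sup>2)) = ?e 2 (of_int k) * ?e 6 (of_int l)"
      by (simp add: exp_add[symmetric] algebra_simps)
    then have "q ^ nat (k\<^sup>2 + 3 * l\<^sup>2) = (if even (k\<^sup>2 + 3 * l\<^sup>2) then 1 else -1) *
        of_real (?e 2 (of_int k) * ?e 6 (of_int l))"
      using q_pow[of "k\<^sup>2 + 3 * l\<^sup>2"] by simp
    moreover have "(if even (k\<^sup>2 + 3 * l\<^sup>2) then 1 else -1) = (of_real ((-1) powi k * (-1) powi l) :: complex)"
      by (simp add: power_int_minus_left)
    ultimately show "(f \<circ> \<phi>0) (k, l) = of_real ((-1) powi k * ?e 2 (of_int k)) *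
      of_real ((-1) powi l * ?e 6 (of_int l))"
      by (simp add: f_def \<phi>0_def h)
  qed
  have f1: "f \<circ> \<phi>1 = (\<lambda>(k, l). - of_real (?e 2 (of_int k + 1 / 2)) *
      of_real (?e 6 (of_int l + 1 / 2)))"
  proof (rule ext, clarify)
    fix k l :: int
    define N where "N = k * (k + 1) + 3 * (l * (l + 1)) + 1"
    have h: "hex_form (k - l) (2 * l + 1) = N"
      by (simp add: N_def hex_form_def power2_eq_square algebra_simps)
    have N: "odd N" "N \<ge> 0"
      using hex_form_nonneg[of "k - l" "2 * l + 1"] h by (simp_all add: N_def)
    have "- 2 * pi * y * of_int N = - pi * (2 * y) * (of_int k + 1 / 2)\<^sup>2 + - pi * (6 * y) * (of_int l + 1 / 2)\<^sup>2"
      by (simp add: N_def power2_eq_square field_simps)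
    then have "exp (- 2 * pi * y * of_int N) = ?e 2 (of_int k + 1 / 2) * ?e 6 (of_int l + 1 / 2)"
      by (simp only: exp_add)
    then show "(f \<circ> \<phi>1) (k, l) = - of_real (?e 2 (of_int k + 1 / 2)) *
      of_real (?e 6 (of_int l + 1 / 2))"
      using q_pow[OF N(2)] N(1) by (simp add: f_def \<phi>1_def h)
  qed
  note s4 = gauss_theta4_has_sum[of "2 * y"] gauss_theta4_has_sum[of "6 * y"]
  note s2 = has_sum_uminusI[OF gauss_theta2_has_sum[of "2 * y"]] gauss_theta2_has_sum[of "6 * y"]
  have "infsum (f \<circ> \<phi>0) UNIV = of_real (gauss_theta4 (2 * y)) * of_real (gauss_theta4 (6 * y))"
    unfolding f0 using infsum_times_complex[OF has_sum_imp_summable[OF s4(1)] has_sum_imp_summable[OF s4(2)]] y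
    by (simp only: infsumI[OF s4(1)] infsumI[OF s4(2)] UNIV_Times_UNIV)
  moreover have "infsum (f \<circ> \<phi>1) UNIV = - of_real (gauss_theta2 (2 * y)) * of_real (gauss_theta2 (6 * y))"
    unfolding f1 using infsum_times_complex[OF has_sum_imp_summable[OF s2(1)] has_sum_imp_summable[OF s2(2)]] y
    by (simp only: infsumI[OF s2(1)] infsumI[OF s2(2)] UNIV_Times_UNIV)
  ultimately show ?thesis
    using split by (simp add: q_def)
qed

text \<open>The map y -> 1/(12y) turns the arguments 2y, 6y into 1/(6y), 1/(2y). Inversion exchanges
  \<theta>2 and \<theta>4, so the two products in \<open>theta_a_gauss\<close> trade places and
  their difference changes sign.\<close>

lemma theta_a_fricke:
  assumes y: "y > 0"
  shows "theta_a (- of_real (exp (- 2 * pi * (1 / (12 * y))))) =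
    - of_real (2 * sqrt 3 * y) * theta_a (- of_real (exp (- 2 * pi * y)))"
proof -
  have inv4: "gauss_theta4 t = gauss_theta2 (1 / t) / sqrt t" if "t > 0" for t
    using gauss_theta_inversion[of "1 / t"] that by (simp add: real_sqrt_divide field_simps)
  have sq: "sqrt (2 * y) * sqrt (6 * y) = 2 * sqrt 3 * y"
  proof -
    have "sqrt (6 * y) = sqrt 3 * sqrt (2 * y)"
      unfolding real_sqrt_mult[symmetric] by simp
    moreover have "sqrt (2 * y) * sqrt (2 * y) = 2 * y"
      using y by simp
    ultimately show ?thesis
      by (simp only: mult_ac)
  qed
  define A4 A2 B4 B2 where "A4 = gauss_theta4 (1 / (2 * y))" "A2 = gauss_theta2 (1 / (2 * y))"
    "B4 = gauss_theta4 (1 / (6 * y))" "B2 = gauss_theta2 (1 / (6 * y))"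
  note defs = this
  have "gauss_theta4 (2 * y) * gauss_theta4 (6 * y) - gauss_theta2 (2 * y) * gauss_theta2 (6 * y) =
      (A2 * B2 - A4 * B4) / (sqrt (2 * y) * sqrt (6 * y))"
    using inv4[of "2 * y"] inv4[of "6 * y"] gauss_theta_inversion[of "2 * y"] gauss_theta_inversion[of "6 * y"] y
    by (simp add: defs diff_divide_distrib)
  then have e0: "theta_a (- of_real (exp (- 2 * pi * y))) * of_real (2 * sqrt 3 * y) = of_real (A2 * B2 - A4 * B4)"
    unfolding theta_a_gauss[OF y] sq of_real_mult[symmetric] using y by simp
  have e1: "theta_a (- of_real (exp (- 2 * pi * (1 / (12 * y))))) = - of_real (A2 * B2 - A4 * B4)"
    using theta_a_gauss[of "1 / (12 * y)"] y by (simp add: defs algebra_simps)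
  show ?thesis
    unfolding e1 e0[symmetric] by simp
qed

lemma has_vector_derivative_theta_a:
  assumes "(r has_real_derivative r') (at y)" "0 \<le> r y" "r y < 1" "r' = r y * c"
  shows "((\<lambda>y. theta_a (- of_real (r y))) has_vector_derivative of_real c * theta_a_qderiv (- of_real (r y))) (at y)"
proof -
  let ?p = "- complex_of_real (r y)"
  have "norm ?p < 1" using assms by simp
  from has_qderiv_theta_a[OF this] obtain D where D: "(theta_a has_field_derivative D) (at ?p)"
    "theta_a_qderiv ?p = ?p * D"
    by (auto simp: has_qderiv_def)
  have "((\<lambda>y. - complex_of_real (r y)) has_vector_derivative - of_real r') (at y)"
    using assms(1) by (intro has_vector_derivative_minus has_vector_derivative_of_real)
      (simp add: has_real_derivative_iff_has_vector_derivative)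
  from field_vector_diff_chain_at[OF this D(1)]
  have "(theta_a \<circ> (\<lambda>y. - complex_of_real (r y)) has_vector_derivative - of_real r' * D) (at y)" .
  then show ?thesis
    unfolding o_def D(2) assms(4) by (simp add: mult_ac)
qed

text \<open>Differentiate \<open>theta_a_fricke\<close> along the real parameter y. The coefficients
  pi/(6 y^2) and - 2 pi are the logarithmic derivatives of the two nomes.\<close>

lemma theta_a_fricke_deriv:
  assumes y: "y > 0"
  shows "of_real (pi / (6 * y\<^sup>2)) * theta_a_qderiv (- of_real (exp (- 2 * pi * (1 / (12 * y))))) =
    - of_real (2 * sqrt 3) * theta_a (- of_real (exp (- 2 * pi * y))) +
    of_real (4 * sqrt 3 * pi * y) * theta_a_qderiv (- of_real (exp (- 2 * pi * y)))"
proof -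
  let ?A = "\<lambda>y. theta_a (- of_real (exp (- 2 * pi * y)))"
  let ?B = "\<lambda>y. theta_a (- of_real (exp (- 2 * pi * (1 / (12 * y)))))"
  let ?T = "theta_a_qderiv (- of_real (exp (- 2 * pi * y)))"
  have 1: "((\<lambda>y. ?B y) has_vector_derivative
      of_real (pi / (6 * y\<^sup>2)) * theta_a_qderiv (- of_real (exp (- 2 * pi * (1 / (12 * y)))))) (at y)"
    using y by (intro has_vector_derivative_theta_a)
      (auto intro!: derivative_eq_intros simp: power2_eq_square field_simps)
  have 2: "((\<lambda>y. ?A y) has_vector_derivative
      of_real (- 2 * pi) * ?T) (at y)"
    using y by (intro has_vector_derivative_theta_a) (auto intro!: derivative_eq_intros)
  have 3: "((\<lambda>y. complex_of_real (- (2 * sqrt 3 * y))) has_vector_derivative complex_of_real (- (2 * sqrt 3))) (at y)"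
    by (intro has_vector_derivative_of_real) (auto intro!: derivative_eq_intros simp flip: has_real_derivative_iff_has_vector_derivative)
  have 4: "((\<lambda>y. complex_of_real (- (2 * sqrt 3 * y)) * ?A y) has_vector_derivative
      complex_of_real (- (2 * sqrt 3 * y)) * (of_real (- 2 * pi) * ?T) +
      complex_of_real (- (2 * sqrt 3)) * ?A y) (at y)"
    by (rule has_vector_derivative_mult[OF 3 2])
  have "((\<lambda>y. ?B y) has_vector_derivative
      complex_of_real (- (2 * sqrt 3 * y)) * (of_real (- 2 * pi) * ?T) +
      complex_of_real (- (2 * sqrt 3)) * ?A y) (at y)"
    by (rule has_vector_derivative_transform_within_open[OF 4, of "{0<..}"])
      (use y theta_a_fricke in auto)
  from vector_derivative_unique_at[OF 1 this] show ?thesis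
    by (simp add: algebra_simps)
qed

section \<open>The series\<close>

lemma has_qderiv_compose:
  assumes "has_qderiv g T q" "(F has_field_derivative D) (at (g q))"
  shows "has_qderiv (\<lambda>x. F (g x)) (D * T) q"
proof -
  obtain E where E: "(g has_field_derivative E) (at q)" "T = q * E"
    using assms(1) by (auto simp: has_qderiv_def)
  show ?thesis
    by (rule has_qderivI[OF DERIV_chain2[OF assms(2) E(1)]]) (simp add: E(2))
qed

text \<open>At t = 0 the hypothesis says nothing about the derivative, so constancy is derived with
  0 as an exceptional point, using continuity there.\<close>

lemma has_qderiv_0_segment:
  assumes w: "\<And>t. 0 \<le> t \<Longrightarrow> t \<le> r \<Longrightarrow> has_qderiv w 0 (- of_real t)" and r: "0 \<le> r"
  shows "w (- of_real r) = w 0"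
proof (rule has_derivative_zero_unique_strong_convex[where f = "\<lambda>t. w (- of_real t)" and S = "{0..r}" and K = "{0}" and c = 0])
  have d: "\<exists>D. ((\<lambda>t. w (- of_real t)) has_vector_derivative D) (at t) \<and> (t \<noteq> 0 \<longrightarrow> D = 0)" if "t \<in> {0..r}" for t
  proof -
    have "has_qderiv w 0 (- of_real t)"
      using w that by auto
    then obtain D where D: "(w has_field_derivative D) (at (- of_real t))" "0 = - of_real t * D"
      unfolding has_qderiv_def by blast
    have "((\<lambda>t. - complex_of_real t) has_vector_derivative - of_real 1) (at t)"
      by (intro has_vector_derivative_minus has_vector_derivative_of_real)
        (auto intro!: derivative_eq_intros simp flip: has_real_derivative_iff_has_vector_derivative)
    from field_vector_diff_chain_at[OF this D(1)] show ?thesis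
      using D(2) by (auto simp: o_def)
  qed
  show "continuous_on {0..r} (\<lambda>t. w (- of_real t))"
    by (intro continuous_at_imp_continuous_on ballI) (use d has_vector_derivative_continuous in blast)
  show "((\<lambda>t. w (- of_real t)) has_derivative (\<lambda>h. 0)) (at t within {0..r})" if "t \<in> {0..r} - {0}" for t
  proof -
    have "((\<lambda>t. w (- of_real t)) has_vector_derivative 0) (at t)"
      using d[of t] that by auto
    then show ?thesis
      unfolding has_vector_derivative_def by (simp add: has_derivative_at_withinI)
  qed
qed (use r in auto)

definition clausen_arg :: "complex \<Rightarrow> complex" where
  "clausen_arg q = 4 * cubic_alpha q * (1 - cubic_alpha q)"

lemma theta_a_0: "theta_a 0 = 1"
proof -
  have v: "theta_mom 0 omega 0 = 1 - omega" "theta_mom 1 omega 0 = omega\<^sup>2 / 2"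
    using theta_mom_0[OF norm_omega, of 0] theta_mom_0[OF norm_omega, of 1] theta_coeff_values
    by (simp_all add: theta_coeff_def)
  have w: "\<i> * sqrt 3 * omega\<^sup>2 = 1 - omega"
  proof -
    have "sqrt 3 * sqrt 3 = 3" by simp
    then show ?thesis
      by (simp add: omega_def complex_eq_iff power2_eq_square field_simps)
  qed
  have g: "2 * c * s * (u / 2 / d) = c * s * u / d" for c s u d :: complex
    by (simp add: field_simps)
  have "theta_a 0 = \<i> * sqrt 3 * omega\<^sup>2 / (1 - omega)"
    using theta_a_log_mom[of 0] unfolding log_mom_def v g by simp
  then show ?thesis
    unfolding w using omega_neq_1 by simp
qed

text \<open>
  \<open>a\<close> and \<open>Y0 \<circ> clausen_arg\<close> solve the same second-order equation and their Wronskian vanishes at \<open>q = 0\<close>.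
\<close>

lemma theta_a_hypergeometric:
  assumes r: "0 \<le> r" "r < 1"
    and nz: "\<And>t. 0 \<le> t \<Longrightarrow> t \<le> r \<Longrightarrow> theta_a (- of_real t) \<noteq> 0"
    and X: "\<And>t. 0 \<le> t \<Longrightarrow> t \<le> r \<Longrightarrow> norm (clausen_arg (- of_real t)) < 1"
  defines "p \<equiv> - complex_of_real r"
  shows "Y0 (clausen_arg p) = theta_a p"
    and "theta_a_qderiv p = (theta_a p)\<^sup>2 * (Y1 (clausen_arg p) * (1 - 2 * cubic_alpha p))"
proof -
  \<comment> \<open>The Wronskian of the two functions with respect to q d/dq, divided by
    a^2.\<close>
  define w where "w q = Y0 (clausen_arg q) * (theta_a_qderiv q / (theta_a q)\<^sup>2) -
    theta_a q * (Y1 (clausen_arg q) * (1 - 2 * cubic_alpha q))" for q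
  {
    fix t assume t: "0 \<le> t" "t \<le> r"
    define q where "q = - complex_of_real t"
    have q: "norm q < 1" "theta_a q \<noteq> 0" "norm (clausen_arg q) < 1"
      using t r nz X by (auto simp: q_def)
    define a al x where "a = theta_a q" "al = cubic_alpha q" "x = clausen_arg q"
    note defs = this
    have x: "x = 4 * al * (1 - al)" by (simp add: defs clausen_arg_def)
    have d_al: "has_qderiv cubic_alpha (a\<^sup>2 * (al * (1 - al))) q"
      unfolding defs by (rule has_qderiv_cubic_alpha[OF q(1,2)])
    have d_lin: "has_qderiv (\<lambda>q. 1 - 2 * cubic_alpha q) (0 - 2 * (a\<^sup>2 * (al * (1 - al)))) q"
      by (intro has_qderiv_diff has_qderiv_const has_qderiv_cmult d_al)
    have d_x: "has_qderiv clausen_arg (x * (a\<^sup>2 * (1 - 2 * al))) q"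
    proof -
      have "has_qderiv (\<lambda>q. 4 * (cubic_alpha q * (1 - cubic_alpha q)))
        (4 * (a\<^sup>2 * (al * (1 - al)) * (1 - al) + al * (0 - a\<^sup>2 * (al * (1 - al))))) q"
        using has_qderiv_cmult[OF has_qderiv_mult[OF d_al has_qderiv_diff[OF has_qderiv_const[of 1] d_al]], of 4]
        unfolding defs .
      also have "4 * (a\<^sup>2 * (al * (1 - al)) * (1 - al) + al * (0 - a\<^sup>2 * (al * (1 - al)))) = x * (a\<^sup>2 * (1 - 2 * al))"
        unfolding x by (simp add: algebra_simps)
      finally show ?thesis
        unfolding clausen_arg_def[abs_def] by (simp add: mult.assoc)
    qed
    obtain D0 where D0: "(Y0 has_field_derivative D0) (at x)" "x * D0 = Y1 x"
      using Y0_deriv[of x] q(3) by (auto simp: defs)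
    obtain D1 where D1: "(Y1 has_field_derivative D1) (at x)" "x * D1 = Y2 x"
      using Y1_deriv[of x] q(3) by (auto simp: defs)
    have d_Y0: "has_qderiv (\<lambda>q. Y0 (clausen_arg q)) (Y1 x * (a\<^sup>2 * (1 - 2 * al))) q"
    proof -
      have "D0 * (x * c) = Y1 x * c" for c
        using D0(2) by (metis mult.assoc mult.commute)
      then show ?thesis
        using has_qderiv_compose[OF d_x D0(1)[unfolded defs]] by (simp only:)
    qed
    have d_Y1: "has_qderiv (\<lambda>q. Y1 (clausen_arg q)) (Y2 x * (a\<^sup>2 * (1 - 2 * al))) q"
    proof -
      have "D1 * (x * c) = Y2 x * c" for c
        using D1(2) by (metis mult.assoc mult.commute)
      then show ?thesis
        using has_qderiv_compose[OF d_x D1(1)[unfolded defs]] by (simp only:)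
    qed
    have w: "has_qderiv w ((Y1 x * (a\<^sup>2 * (1 - 2 * al)) * (theta_a_qderiv q / (theta_a q)\<^sup>2) +
        Y0 (clausen_arg q) * (2 / 9 * a ^ 3 * (al * (1 - al)))) -
        (theta_a_qderiv q * (Y1 (clausen_arg q) * (1 - 2 * cubic_alpha q)) +
         theta_a q * (Y2 x * (a\<^sup>2 * (1 - 2 * al)) * (1 - 2 * cubic_alpha q) +
           Y1 (clausen_arg q) * (0 - 2 * (a\<^sup>2 * (al * (1 - al))))))) q"
      unfolding w_def
      by (intro has_qderiv_diff[OF has_qderiv_mult has_qderiv_mult] has_qderiv_mult d_Y0 d_Y1 d_lin has_qderiv_theta_a q
          has_qderiv_theta_a_ode[OF q(1,2), folded defs])
    have "(1 - x) * Y2 x = x * (Y1 x / 2 + Y0 x / 18)"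
      using Y_ode[of x] q(3) by (simp add: defs)
    \<comment> \<open>That 1 - x is the square of 1 - 2 \<alpha> is what transports the equation of
      Y0 in x to the one of a in \<alpha>.\<close>
    moreover have "1 - x = (1 - 2 * al) * (1 - 2 * al)"
      unfolding x by (simp add: algebra_simps)
    ultimately have ode: "Y2 x * ((1 - 2 * al) * (1 - 2 * al)) = 4 * al * (1 - al) * (Y1 x / 2 + Y0 x / 18)"
      unfolding x[symmetric] by (simp add: mult.commute)
    have e1: "a ^ 3 * (Y2 x * ((1 - 2 * al) * (1 - 2 * al)) - 2 * (al * (1 - al)) * Y1 x) = Y0 x * (2 / 9 * a ^ 3 * (al * (1 - al)))"
      unfolding ode by (simp add: field_simps)
    have e2: "a * (Y2 x * (a\<^sup>2 * (1 - 2 * al)) * (1 - 2 * al) + Y1 x * (0 - 2 * (a\<^sup>2 * (al * (1 - al))))) =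
        a ^ 3 * (Y2 x * ((1 - 2 * al) * (1 - 2 * al)) - 2 * (al * (1 - al)) * Y1 x)"
      by (simp add: algebra_simps power2_eq_square power3_eq_cube)
    have e3: "Y1 x * (a\<^sup>2 * (1 - 2 * al)) * (theta_a_qderiv q / a\<^sup>2) = theta_a_qderiv q * (Y1 x * (1 - 2 * al))"
      using q(2) by (simp add: defs)
    have "has_qderiv w 0 q"
      using w unfolding defs[symmetric] e3 e2 e1 by simp
    then have w0: "has_qderiv w 0 (- of_real t)" by (simp add: q_def)
    \<comment> \<open>The quotient has q-derivative -w. Once w is known to vanish, the quotient
      keeps its value 1 from q = 0.\<close>
    have "has_qderiv (\<lambda>q. Y0 (clausen_arg q) / theta_a q)
        ((Y1 x * (a\<^sup>2 * (1 - 2 * al)) * theta_a q - Y0 (clausen_arg q) * theta_a_qderiv q) / (theta_a q * theta_a q)) q"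
      by (intro has_qderiv_divide d_Y0 has_qderiv_theta_a q)
    also have "(Y1 x * (a\<^sup>2 * (1 - 2 * al)) * theta_a q - Y0 (clausen_arg q) * theta_a_qderiv q) / (theta_a q * theta_a q) = - w q"
      using q(2) unfolding w_def by (simp add: defs field_simps power2_eq_square)
    finally have "has_qderiv (\<lambda>q. Y0 (clausen_arg q) / theta_a q) (- w (- of_real t)) (- of_real t)"
      by (simp add: q_def)
    note w0 this
  } note key = this
  have a0: "cubic_alpha 0 = 0" "clausen_arg 0 = 0"
    by (simp_all add: clausen_arg_def cubic_alpha_def cubic_ratio_0)
  have qd0: "theta_a_qderiv 0 = 0"
    using has_qderiv_theta_a[of 0] by (auto simp: has_qderiv_def)
  have Y1_0: "Y1 0 = 0"
    using Y0_deriv[of 0] by auto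
  have Y0_0: "Y0 0 = 1"
    by (simp add: Y0_def eval_fps_at_0 hyp_2F1_def)
  have w_zero: "w (- of_real t) = 0" if "0 \<le> t" "t \<le> r" for t
  proof -
    have "w (- of_real t) = w 0"
      by (rule has_qderiv_0_segment) (use key(1) that in auto)
    also have "w 0 = 0"
      by (simp add: w_def a0 qd0 Y1_0)
    finally show ?thesis .
  qed
  have "Y0 (clausen_arg p) / theta_a p = Y0 (clausen_arg 0) / theta_a 0"
    unfolding p_def by (rule has_qderiv_0_segment) (use key(2) w_zero r in fastforce)+
  then have "Y0 (clausen_arg p) / theta_a p = 1"
    by (simp add: a0 Y0_0 theta_a_0)
  then show V: "Y0 (clausen_arg p) = theta_a p"
    using nz[of r] r by (simp add: p_def divide_eq_1_iff split: if_splits)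
  have "w p = 0" and "theta_a p \<noteq> 0"
    unfolding p_def using w_zero nz r by auto
  then show "theta_a_qderiv p = (theta_a p)\<^sup>2 * (Y1 (clausen_arg p) * (1 - 2 * cubic_alpha p))"
    unfolding w_def V by (simp add: field_simps power2_eq_square)
qed

section \<open>Estimates on the negative real axis\<close>

text \<open>The series begins -1 + 3q - 5q^3 + ..., and its first two terms at q = -r are
  subtracted. From i = 2 on, 2i + 1 <= 4^i, exponents at least i + 1 and r <= 1/8 bound the terms by
  r / 2^i.\<close>

lemma theta_mom_1_near:
  assumes r: "0 \<le> r" "r \<le> 1 / 8"
  shows "norm (theta_mom 1 1 (- of_real r) + of_real (1 + 3 * r)) \<le> r / 2"
proof -
  define q where "q = - complex_of_real r"
  have nq: "norm q = r" "norm q < 1" using r by (auto simp: q_def)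
  define f where "f j = theta_coeff 1 1 j * q ^ triangle (1 + int j)" for j
  have f: "f sums theta_mom 1 1 q"
    unfolding f_def by (rule theta_mom_sums) (use nq in auto)
  have "(\<lambda>j. f (j + 2)) sums (theta_mom 1 1 q - (\<Sum>j<2. f j))"
    by (rule sums_split_initial_segment[OF f])
  moreover have "(\<Sum>j<2. f j) = - 1 + 3 * q"
  proof -
    have "triangle (1 + int 1) = 1"
      by (rule triangle_eqI) simp
    then show ?thesis
      using theta_coeff_values by (simp add: f_def numeral_2_eq_2)
  qed
  ultimately have tail: "(\<lambda>j. f (j + 2)) sums (theta_mom 1 1 q + of_real (1 + 3 * r))"
    by (simp add: q_def algebra_simps)
  have coeff: "theta_coeff 1 1 j = - ((-1) ^ j * (2 * of_nat j + 1))" for j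
  proof -
    have "(-1 :: complex) powi (1 + int j) = - ((-1) ^ j)" "(-1 :: complex) powi (- int j) = (-1) ^ j"
      by (simp_all add: power_int_minus_left uminus_power_if)
    then show ?thesis
      by (simp add: theta_coeff_def half_shift_def algebra_simps)
  qed
  have le: "norm (f (j + 2)) \<le> r * (1 / 2) ^ (j + 2)" for j
  proof -
    define i where "i = j + 2"
    have "2 * (i + 1) \<le> i * (i + 1)" by (simp add: i_def)
    then have "2 * (i + 1) \<le> 2 * triangle (1 + int i)"
      unfolding two_triangle_Suc_nat .
    then have T: "i + 1 \<le> triangle (1 + int i)"
      by simp
    have c: "real (2 * i + 1) \<le> 4 ^ i"
    proof -
      have "2 * (j + 2) + 1 \<le> (4 :: nat) ^ (j + 2)"
        by (induction j) auto
      then have "real (2 * (j + 2) + 1) \<le> real (4 ^ (j + 2))"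
        by (simp only: of_nat_le_iff)
      then show ?thesis by (simp add: i_def)
    qed
    have "norm (theta_coeff 1 1 i) = real (2 * i + 1)"
    proof -
      have "theta_coeff 1 1 i = - ((-1) ^ i * of_nat (2 * i + 1))"
        unfolding coeff by simp
      then show ?thesis
        by (simp only: norm_minus_cancel norm_mult norm_power norm_of_nat) simp
    qed
    then have "norm (f i) = real (2 * i + 1) * r ^ triangle (1 + int i)"
      by (simp add: f_def norm_mult norm_power nq del: of_nat_add of_nat_mult)
    also have "\<dots> \<le> 4 ^ i * r ^ (i + 1)"
      using c T r by (intro mult_mono power_decreasing) auto
    also have "\<dots> \<le> 4 ^ i * (r * (1 / 8) ^ i)"
      using r by (simp add: mult_left_mono power_mono)
    also have "\<dots> = r * (4 * (1 / 8)) ^ i"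
      unfolding power_mult_distrib by simp
    finally show ?thesis by (simp add: i_def)
  qed
  have "summable (\<lambda>j. r * (1 / 2) ^ (j + 2))"
    by (intro summable_mult summable_ignore_initial_segment summable_geometric) auto
  moreover have geo: "(\<Sum>j. r * (1 / 2) ^ (j + 2)) = r / 2"
  proof -
    have "(\<lambda>j. (r / 4) * (1 / 2) ^ j) sums ((r / 4) * (1 / (1 - 1 / 2)))"
      by (intro sums_mult geometric_sums) auto
    then show ?thesis
      by (simp add: sums_iff power2_eq_square)
  qed
  ultimately have "norm (\<Sum>j. f (j + 2)) \<le> r / 2"
    using norm_suminf_le[of "\<lambda>j. f (j + 2)" "\<lambda>j. r * (1 / 2) ^ (j + 2)"] le by metis
  then show ?thesis
    using tail by (simp add: sums_iff q_def)
qed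

text \<open>The factor besides 27 q is the fourth power of a quotient of
  \<open>theta_mom 1 1\<close> at q^3 and at q. Its norm is at most 1, since these values are close
  to -(1 + 3 r^3) and -(1 + 3 r).\<close>

lemma norm_cubic_ratio_le:
  assumes r: "0 \<le> r" "r \<le> 1 / 8"
  shows "norm (cubic_ratio (- of_real r)) \<le> 27 * r"
proof -
  define q where "q = - complex_of_real r"
  have q: "norm q < 1" using r by (simp add: q_def)
  have q3: "q ^ 3 = - of_real (r ^ 3)" by (simp add: q_def power3_eq_cube)
  have r3: "0 \<le> r ^ 3" "r ^ 3 \<le> r / 8"
  proof -
    show "0 \<le> r ^ 3" using r by simp
    have "r * (r * r) \<le> r * (1 * (1 / 8))"
      using r by (intro mult_left_mono mult_mono) auto
    then show "r ^ 3 \<le> r / 8" by (simp add: power3_eq_cube mult.assoc)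
  qed
  have "norm (theta_mom 1 1 (q ^ 3)) \<le> norm (theta_mom 1 1 q)"
  proof -
    have n: "norm (complex_of_real (1 + 3 * x)) = 1 + 3 * x" if "0 \<le> x" for x
      using that by (simp only: norm_of_real)
    have "norm (theta_mom 1 1 (q ^ 3)) \<le> norm (theta_mom 1 1 (q ^ 3) + of_real (1 + 3 * r ^ 3)) + norm (complex_of_real (1 + 3 * r ^ 3))"
      by (metis add_diff_cancel_right' norm_triangle_ineq4)
    also have "\<dots> \<le> r ^ 3 / 2 + (1 + 3 * r ^ 3)"
      unfolding n[OF r3(1)] q3 using r3 r by (intro add_right_mono theta_mom_1_near) auto
    also have "\<dots> \<le> 1 + 3 * r - r / 2"
      using r3 r by linarith
    also have "\<dots> \<le> norm (complex_of_real (1 + 3 * r)) - norm (theta_mom 1 1 q + of_real (1 + 3 * r))"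
      unfolding n[OF r(1)] using theta_mom_1_near[OF r] by (simp add: q_def)
    also have "\<dots> \<le> norm (theta_mom 1 1 q)"
      using norm_triangle_ineq[of "theta_mom 1 1 q + of_real (1 + 3 * r)" "- theta_mom 1 1 q"] by simp
    finally show ?thesis .
  qed
  then have "norm (theta_mom 1 1 (q ^ 3)) / norm (theta_mom 1 1 q) \<le> 1"
    using theta_mom_1_nonzero[OF q] by simp
  then have "(norm (theta_mom 1 1 (q ^ 3)) / norm (theta_mom 1 1 q)) ^ 4 \<le> 1"
    by (intro power_le_one) auto
  moreover have "cubic_ratio q = 27 * q * (theta_mom 1 1 (q ^ 3) / theta_mom 1 1 q) ^ 4"
    unfolding cubic_ratio_eta[OF q] theta_mom_jacobi[OF q] theta_mom_jacobi[OF norm_cube_less_1[OF q]]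
    by (simp add: power_divide flip: power_mult)
  ultimately show ?thesis
    using r by (simp add: norm_mult norm_power norm_divide q_def mult_left_le)
qed

text \<open>With m = \<open>cubic_ratio\<close>, the argument is 4 m / (1 + m)^2. For |m| <= t its
  norm is at most 4 t / (1 - t)^2, which equals 1 at t = 3 - 2 sqrt 2 = 0.17157...; the bound
  171/1000 lies just below.\<close>

lemma
  assumes r: "0 \<le> r" "27 * r \<le> 171 / 1000"
  shows theta_a_neg_nonzero: "theta_a (- of_real r) \<noteq> 0"
    and norm_clausen_arg_less_1: "norm (clausen_arg (- of_real r)) < 1"
proof -
  define m where "m = cubic_ratio (- of_real r)"
  have m: "norm m \<le> 171 / 1000"
    using norm_cubic_ratio_le[of r] r unfolding m_def by linarith
  have m1: "norm (1 + m) \<ge> 829 / 1000"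
    using norm_triangle_ineq[of "1 + m" "- m"] m by simp
  then have nz: "1 + m \<noteq> 0" by auto
  have q: "norm (- complex_of_real r) < 1" using r by simp
  show "theta_a (- of_real r) \<noteq> 0"
    using theta_a_eq_0_iff[OF q] nz by (simp add: m_def)
  have "clausen_arg (- of_real r) = 4 * m / (1 + m)\<^sup>2"
    using nz by (simp add: clausen_arg_def cubic_alpha_def m_def[symmetric] field_simps power2_eq_square)
  then have "norm (clausen_arg (- of_real r)) = 4 * norm m / (norm (1 + m))\<^sup>2"
    by (simp add: norm_divide norm_mult norm_power)
  also have "\<dots> \<le> 4 * (171 / 1000) / (829 / 1000)\<^sup>2"
    using m m1 by (intro frac_le mult_left_mono power_mono) auto
  also have "\<dots> < 1" by (simp add: power2_eq_square)
  finally show "norm (clausen_arg (- of_real r)) < 1" .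
qed

lemma exp_bound_N8:
  assumes "N \<ge> 8"
  shows "27 * exp (- pi * sqrt (real N / 3)) \<le> 171 / 1000"
proof -
  have "(1.63 :: real) \<le> sqrt (real N / 3)"
    using assms by (intro real_le_rsqrt) (simp add: power2_eq_square)
  moreover have "(3.14 :: real) \<le> pi"
    using pi_approx by simp
  ultimately have "(3.14 :: real) * 1.63 \<le> pi * sqrt (real N / 3)"
    by (intro mult_mono) auto
  then have "5.1 \<le> pi * sqrt (real N / 3)" by simp
  then have "exp (5.1 :: real) \<le> exp (pi * sqrt (real N / 3))"
    by simp
  moreover have "(160 :: real) \<le> exp 5.1"
  proof -
    \<comment> \<open>As 51/320 is 5.1/32, the quadratic Taylor bound raised to the power 32
      suffices; 160 is enough because 27/160 < 0.171.\<close>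
    have "(293 / 250 :: real) \<le> 1 + 51 / 320 + (51 / 320)\<^sup>2 / 2"
      by (simp add: power2_eq_square)
    also have "\<dots> \<le> exp (51 / 320)"
      by (rule exp_lower_Taylor_quadratic) simp
    finally have "(293 / 250 :: real) ^ 32 \<le> exp (51 / 320) ^ 32"
      by (intro power_mono) auto
    also have "\<dots> = exp 5.1"
      by (simp flip: exp_of_nat_mult)
    finally have "(293 / 250 :: real) ^ 32 \<le> exp 5.1" .
    moreover have "(160 :: real) \<le> (293 / 250) ^ 32"
      by (simp add: power_divide)
    ultimately show ?thesis by linarith
  qed
  ultimately have "160 \<le> exp (pi * sqrt (real N / 3))" by linarith
  then have "exp (- (pi * sqrt (real N / 3))) \<le> 1 / 160"
    unfolding exp_minus by (simp add: field_simps)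
  then show ?thesis by simp
qed

section \<open>Evaluation of \<open>C_hat\<close> and of the series\<close>

lemma C_hat_eq:
  assumes q: "norm q < 1" and N: "N > 0"
  shows "C_hat N q = (theta_a (- q) * (of_nat N * theta_a_qderiv (- (q ^ N))) - theta_a (- (q ^ N)) * theta_a_qderiv (- q)) /
     ((theta_a (- q))\<^sup>2 * (theta_a (- (q ^ N)))\<^sup>2)"
proof -
  have d: "\<exists>D. (theta_a has_field_derivative D) (at (- x)) \<and> theta_a_qderiv (- x) = - x * D" if "norm x < 1" for x
    using has_qderiv_theta_a[of "- x"] that unfolding has_qderiv_def by simp
  have qN: "norm (q ^ N) < 1"
    using q N by (simp add: norm_power power_less_one_iff)
  obtain D where D: "(theta_a has_field_derivative D) (at (- q))" "theta_a_qderiv (- q) = - q * D"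
    using d[OF q] by blast
  obtain D' where D': "(theta_a has_field_derivative D') (at (- (q ^ N)))" "theta_a_qderiv (- (q ^ N)) = - (q ^ N) * D'"
    using d[OF qN] by blast
  have "((\<lambda>z. - z) has_field_derivative - 1) (at q)"
    by (auto intro!: derivative_eq_intros)
  from DERIV_chain2[OF D(1) this] have 1: "q * deriv (\<lambda>z. theta_a (- z)) q = theta_a_qderiv (- q)"
    by (simp add: DERIV_imp_deriv D(2))
  have "((\<lambda>z. - (z ^ N)) has_field_derivative - (of_nat N * q ^ (N - 1))) (at q)"
    by (auto intro!: derivative_eq_intros)
  from DERIV_chain2[OF D'(1) this]
  have "q * deriv (\<lambda>z. theta_a (- (z ^ N))) q = - (of_nat N * (q ^ (N - 1) * q) * D')"
    by (simp add: DERIV_imp_deriv)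
  also have "q ^ (N - 1) * q = q ^ N"
    by (rule power_minus_mult[OF N])
  finally have 2: "q * deriv (\<lambda>z. theta_a (- (z ^ N))) q = of_nat N * theta_a_qderiv (- (q ^ N))"
    by (simp add: D'(2))
  show ?thesis
    unfolding C_hat_def 1 2 by (simp add: det_2)
qed

lemma theta_a_fricke_N:
  assumes "N > 0"
  defines "p \<equiv> - complex_of_real (exp (- pi * sqrt (real N / 3)))"
    and "q \<equiv> complex_of_real (exp (- pi / sqrt (3 * real N)))"
  shows "q ^ N = - p"
    and "theta_a (- q) = - of_real (sqrt N) * theta_a p"
    and "theta_a_qderiv (- q) = of_nat N * (of_real (sqrt N) * theta_a_qderiv p - of_real (sqrt 3 / pi) * theta_a p)"
proof -
  \<comment> \<open>With y = sqrt(N/12) the nome exp(-2 pi y) is -p and exp(-2 pi/(12y)) is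
    q.\<close>
  define y where "y = sqrt (real N / 3) / 2"
  have y: "y > 0" using assms(1) by (simp add: y_def)
  have y2: "y\<^sup>2 = real N / 12" by (simp add: y_def power_divide)
  have s: "sqrt (3 * real N) * sqrt (real N / 3) = real N"
    by (simp add: real_sqrt_mult[symmetric])
  have "6 * y = sqrt (3 * real N)"
  proof -
    have "sqrt (3 * real N) = sqrt (3\<^sup>2 * (real N / 3))" by (simp add: power2_eq_square)
    also have "\<dots> = 3 * sqrt (real N / 3)" by (simp only: real_sqrt_mult real_sqrt_abs)
    finally show ?thesis by (simp add: y_def)
  qed
  then have q: "- of_real (exp (- 2 * pi * (1 / (12 * y)))) = - q"
    using y by (simp add: q_def field_simps)
  have p: "- of_real (exp (- 2 * pi * y)) = p"
    by (simp add: p_def y_def)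
  have sy: "2 * sqrt 3 * y = sqrt N"
    by (simp add: y_def real_sqrt_divide)
  show "q ^ N = - p"
  proof -
    have "real N * (- pi / sqrt (3 * real N)) = - pi * sqrt (real N / 3)"
      using s assms(1) by (simp add: field_simps)
    then have "exp (- pi / sqrt (3 * real N)) ^ N = exp (- pi * sqrt (real N / 3))"
      by (simp only: exp_of_nat_mult[symmetric])
    then show ?thesis
      by (simp add: p_def q_def flip: of_real_power)
  qed
  show "theta_a (- q) = - of_real (sqrt N) * theta_a p"
    using theta_a_fricke[OF y] unfolding q p sy .
  have "of_real (2 * pi / N) * theta_a_qderiv (- q) = - of_real (2 * sqrt 3) * theta_a p + of_real (2 * pi * sqrt N) * theta_a_qderiv p"
    using theta_a_fricke_deriv[OF y] assms(1) unfolding q p y2 sy[symmetric] by (simp add: mult_ac)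
  note eq = this
  have "theta_a_qderiv (- q) = of_real (N / (2 * pi)) * (of_real (2 * pi / N) * theta_a_qderiv (- q))"
    using assms(1) by (simp add: field_simps)
  also have "\<dots> = of_real (N / (2 * pi)) * (- of_real (2 * sqrt 3) * theta_a p + of_real (2 * pi * sqrt N) * theta_a_qderiv p)"
    unfolding eq ..
  also have "\<dots> = of_nat N * (of_real (sqrt N) * theta_a_qderiv p - of_real (sqrt 3 / pi) * theta_a p)"
    by (simp add: field_simps)
  finally show "theta_a_qderiv (- q) = of_nat N * (of_real (sqrt N) * theta_a_qderiv p - of_real (sqrt 3 / pi) * theta_a p)" .
qed

theorem theorem5p2:
  fixes N :: nat and \<alpha> b a X :: complex
  assumes "N \<ge> 8"
  defines "\<alpha> \<equiv> alpha_dagger (- of_real (exp (- pi * sqrt (real N / 3))))"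
  defines "b \<equiv> 1 - 2 * \<alpha>"
  defines "a \<equiv> 1 / of_real (sqrt (real N)) * C_hat N (of_real (exp (- pi / sqrt (3 * real N))))"
  defines "X \<equiv> 4 * \<alpha> * (1 - \<alpha>)"
  shows "(\<lambda>k. pochhammer (1/2) k * pochhammer (1/3) k * pochhammer (2/3) k / (fact k) ^ 3 *
            (b * of_nat k + a) * X ^ k)
         sums of_real (sqrt (3 / real N) * (1 / pi))"
proof -
  have N: "N > 0" using assms(1) by simp
  define r where "r = exp (- pi * sqrt (real N / 3))"
  define p where "p = - complex_of_real r"
  define q where "q = complex_of_real (exp (- pi / sqrt (3 * real N)))"
  have r: "0 < r" "27 * r \<le> 171 / 1000"
    using exp_bound_N8[OF assms(1)] by (simp_all add: r_def)
  have p: "norm p < 1" "p \<noteq> 0" using r by (simp_all add: p_def)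
  have \<alpha>: "\<alpha> = cubic_alpha p"
    unfolding \<alpha>_def r_def[symmetric] p_def[symmetric] cubic_alpha_def
    by (rule alpha_dagger_cubic_ratio[OF p])
  have X: "X = clausen_arg p"
    by (simp add: X_def \<alpha> clausen_arg_def)
  have A: "theta_a p \<noteq> 0" and X1: "norm X < 1"
    using theta_a_neg_nonzero[of r] norm_clausen_arg_less_1[of r] r by (simp_all add: X p_def)
  have hyp: "Y0 X = theta_a p" "theta_a_qderiv p = (theta_a p)\<^sup>2 * (Y1 X * b)"
    using theta_a_hypergeometric[of r] theta_a_neg_nonzero norm_clausen_arg_less_1 r
    unfolding X b_def \<alpha> p_def by simp_all
  note fr = theta_a_fricke_N[OF N, folded r_def, folded p_def q_def]
  define A where "A = theta_a p"
  define T where "T = theta_a_qderiv p"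
  define s where "s = complex_of_real (sqrt N)"
  have s: "s \<noteq> 0" "s * s = of_nat N" using N by (simp_all add: s_def flip: of_real_mult)
  have A0: "A \<noteq> 0" using A by (simp add: A_def)
  have "norm q < 1" using N by (simp add: q_def)
  from C_hat_eq[OF this N]
  \<comment> \<open>Because a(-q) is - s A, the derivative terms of the determinant are both - s^3 A
    T and add up.\<close>
  have "C_hat N q = (- s * A * (s * s * T) - A * (s * s * (s * T - of_real (sqrt 3 / pi) * A))) / ((- s * A)\<^sup>2 * A\<^sup>2)"
    unfolding fr(2,3) fr(1) by (simp add: s(2) s_def[symmetric] A_def[symmetric] T_def[symmetric])
  also have "\<dots> = (s * s * A) * (of_real (sqrt 3 / pi) * A - 2 * s * T) / ((s * s * A) * A ^ 3)"
    by (simp add: algebra_simps power2_eq_square power3_eq_cube)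
  also have "\<dots> = (of_real (sqrt 3 / pi) * A - 2 * s * T) / A ^ 3"
    using s(1) A0 by (intro mult_divide_mult_cancel_left) simp
  finally have C: "C_hat N q = (of_real (sqrt 3 / pi) * A - 2 * s * T) / A ^ 3" .
  have a: "a * A\<^sup>2 = of_real (sqrt 3 / pi) / s - 2 * T / A"
    unfolding a_def q_def[symmetric] s_def[symmetric] C using s(1) A0
    by (simp add: field_simps power2_eq_square power3_eq_cube)
  \<comment> \<open>This is the contribution of the terms with k, opposite to the term - 2 T / A in
    a A^2.\<close>
  have "b * (2 * Y0 X * Y1 X) = 2 * T / A"
    using hyp A0 by (simp add: A_def T_def power2_eq_square)
  then have "b * (2 * Y0 X * Y1 X) + a * (Y0 X)\<^sup>2 = of_real (sqrt 3 / pi) / s"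
    using a hyp(1) by (simp add: A_def)
  also have "\<dots> = of_real (sqrt (3 / real N) * (1 / pi))"
    by (simp add: s_def real_sqrt_divide)
  finally show ?thesis
    using hyp_3F2_sums[OF X1, of b a] by (simp add: hyp_3F2_def)
qed

end
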